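(* There is no algorithm that, given a (non-probabilistic) parity tree automaton $\mathcal{A}$, decides whether $\mathcal{L}^{\forall}_{\mathrm{qual}}(\mathcal{A})=\varnothing$.
   Context: A $\Sigma$-tree is a map $t:\{0,1\}^*\to\Sigma$ ($\Sigma$ a finite alphabet); for a branch $\pi\in\{0,1\}^\omega$, $t(\pi)=t(\epsilon)t(\pi_0)t(\pi_0\pi_1)\cdots$. The coin-flipping measure $\mu$ on $\{0,1\}^\omega$ gives the cone $u\{0,1\}^\omega$ measure $2^{-|u|}$. A tree automaton is $\mathcal{A}=(Q,\Sigma,\Delta,q_\iota,\mathrm{Acc})$ with $Q$ finite, $\Delta\subseteq Q\times\Sigma\times Q\times Q$, $q_\iota\in Q$ and $\mathrm{Acc}\subseteq Q^\omega$; for a parity tree automaton, $\mathrm{Acc}$ is given by $\alpha:Q\to\{0,\dots,k\}$ and $r\in\mathrm{Acc}$ iff the minimum of $\alpha(q)$ over states $q$ occurring infinitely often in $r$ is even. A run on $t$ is a $Q$-tree $\rho$ with $\rho(\epsilon)=q_\iota$ and $(\rho(u),t(u),\rho(u0),\rho(u1))\in\Delta$ for all $u$; it is qualitatively accepting if $\mu(\{\pi\in\{0,1\}^\omega:\rho(\pi)\in\mathrm{Acc}\})=1$. The qualitative universal language is $\mathcal{L}^{\forall}_{\mathrm{qual}}(\mathcal{A})=\{t:\text{every run of }\mathcal{A}\text{ on }t\text{ is qualitatively accepting}\}$ (in particular trees with no run belong to it). *)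

theory Defs
  imports "HOL-Probability.Probability" "HOL-Library.Nat_Bijection"
begin

datatype recf = Zero | Succ | Proj nat | Comp recf "recf list" | Prim recf recf | Mn recf

inductive eval :: "recf \<Rightarrow> nat list \<Rightarrow> nat \<Rightarrow> bool" where
  eval_Zero: "eval Zero xs 0"
| eval_Succ: "eval Succ (x # xs) (Suc x)"
| eval_Proj: "i < length xs \<Longrightarrow> eval (Proj i) xs (xs ! i)"
| eval_Comp: "length ys = length gs \<Longrightarrow> (\<forall>i < length gs. eval (gs ! i) xs (ys ! i))
              \<Longrightarrow> eval f ys z \<Longrightarrow> eval (Comp f gs) xs z"
| eval_Prim0: "eval f xs y \<Longrightarrow> eval (Prim f g) (0 # xs) y"
| eval_PrimS: "eval (Prim f g) (n # xs) y \<Longrightarrow> eval g (n # y # xs) z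
              \<Longrightarrow> eval (Prim f g) (Suc n # xs) z"
| eval_Mn: "eval f (n # xs) 0 \<Longrightarrow> (\<forall>i < n. \<exists>y. eval f (i # xs) (Suc y))
              \<Longrightarrow> eval (Mn f) xs n"

text \<open>A parity tree automaton is given as (n, k, ts, q0, pr): states {0..<n},
  alphabet {0..<k}, transition list ts of tuples (q, a, q_left, q_right),
  initial state q0, priorities pr (the priority of state q is pr ! q).\<close>

type_synonym pta = "nat \<times> nat \<times> (nat \<times> nat \<times> nat \<times> nat) list \<times> nat \<times> nat list"

fun pta_wf :: "pta \<Rightarrow> bool" where
  "pta_wf (n, k, ts, q0, pr) \<longleftrightarrow> 0 < k \<and> q0 < n \<and> length pr = n \<and>
     (\<forall>(q, a, q1, q2) \<in> set ts. q < n \<and> a < k \<and> q1 < n \<and> q2 < n)"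

fun enc4 :: "nat \<times> nat \<times> nat \<times> nat \<Rightarrow> nat" where
  "enc4 (a, b, c, d) = prod_encode (a, prod_encode (b, prod_encode (c, d)))"

fun pta_encode :: "pta \<Rightarrow> nat" where
  "pta_encode (n, k, ts, q0, pr) =
     prod_encode (n, prod_encode (k, prod_encode (list_encode (map enc4 ts),
       prod_encode (q0, list_encode pr))))"

text \<open>Trees: maps from {0,1}* (bool lists, False = 0, True = 1) to labels.\<close>

definition is_tree :: "nat \<Rightarrow> (bool list \<Rightarrow> nat) \<Rightarrow> bool" where
  "is_tree k t \<longleftrightarrow> (\<forall>u. t u < k)"

fun is_run :: "pta \<Rightarrow> (bool list \<Rightarrow> nat) \<Rightarrow> (bool list \<Rightarrow> nat) \<Rightarrow> bool" where
  "is_run (n, k, ts, q0, pr) t \<rho> \<longleftrightarrow> \<rho> [] = q0 \<and>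
     (\<forall>u. (\<rho> u, t u, \<rho> (u @ [False]), \<rho> (u @ [True])) \<in> set ts)"

definition along :: "(bool list \<Rightarrow> 'a) \<Rightarrow> (nat \<Rightarrow> bool) \<Rightarrow> nat \<Rightarrow> 'a" where
  "along t \<pi> i = t (map \<pi> [0..<i])"

definition parity_acc :: "nat list \<Rightarrow> (nat \<Rightarrow> nat) \<Rightarrow> bool" where
  "parity_acc pr r \<longleftrightarrow> even (Min {pr ! q | q. \<exists>\<^sub>\<infinity> i. r i = q})"

definition coin :: "(nat \<Rightarrow> bool) measure" where
  "coin = PiM UNIV (\<lambda>_. measure_pmf (pmf_of_set (UNIV :: bool set)))"

fun qual_accepting :: "pta \<Rightarrow> (bool list \<Rightarrow> nat) \<Rightarrow> bool" where
  "qual_accepting (n, k, ts, q0, pr) \<rho> \<longleftrightarrow>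
     emeasure coin {\<pi> \<in> space coin. parity_acc pr (along \<rho> \<pi>)} = 1"

fun L_univ_qual :: "pta \<Rightarrow> (bool list \<Rightarrow> nat) set" where
  "L_univ_qual (n, k, ts, q0, pr) =
     {t. is_tree k t \<and> (\<forall>\<rho>. is_run (n, k, ts, q0, pr) t \<rho> \<longrightarrow> qual_accepting (n, k, ts, q0, pr) \<rho>)}"

end

theory Submission
  imports Defs
begin

text \<open>The halting problem for general recursive functions is reduced to emptiness.

  \<^emph>\<open>From trees to words.\<close> If for every state and letter the two successors may be exchanged, then
  swapping them at random turns the run along a fixed branch into a Markov chain driven by the word on
  that branch. By Fubini, the language is nonempty iff some word makes this chain, whose steps are
  fair coin flips, satisfy the acceptance condition almost surely.

  \<^emph>\<open>From words to programs.\<close> A word spells executions of a nondeterministic program over registers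
  with the actions \<open>r := r + r'\<close>, \<open>r := 0\<close> and equality tests. A pair of random walkers on the
  registers is at \<open>(i, j)\<close> with probability \<open>4\<^sup>-\<^sup>n s\<^sub>i s\<^sub>j\<close>, so tests can transfer the probability
  \<open>4\<^sup>-\<^sup>n (s\<^sub>a\<^sup>2 + s\<^sub>b\<^sup>2)\<close> to an account \<open>B\<close> and \<open>4\<^sup>-\<^sup>n 2 s\<^sub>a s\<^sub>b\<close> to an account \<open>G\<close>, to which
  \<open>4\<^sup>-\<^sup>n\<close> is added if the execution follows the control flow. Hence \<open>G > B\<close> iff the execution is
  correct and all its tests succeed. Before an execution starts, a coin decides which of the two
  accounts has to survive; surviving \<open>k\<close> executions in a row counts as a win with probability
  \<open>G\<^sup>k / 2\<close> and as a loss with probability \<open>B\<^sup>k / 2\<close>. The parity condition asks for infinitely many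
  wins and finitely many losses. If \<open>G > B\<close> is possible, this holds almost surely for a suitable
  word; otherwise every win is preceded by a loss with probability at least one half.

  \<^emph>\<open>Diagonalisation.\<close> The input of the program is the length of a chain of extra states, so the
  code of the automaton is computable from the input. A program that decides emptiness of its own
  automaton and accepts iff the language is empty gives a contradiction.\<close>

section \<open>Recursive functions\<close>

text \<open>Up to the common factor 4^-n both accounts are natural numbers, and \<open>G - B\<close>
  equals 1 if the control flow is respected, 0 otherwise, minus the sum of the squares
  \<open>(s a - s b)^2\<close> over all tests. This is why the walkers come in pairs: one walker
  yields only linear quantities, whose errors could cancel, while a square is never negative.
  Integrality matters as well: one failed test costs at least 1, which is all that the control flow
  can contribute. So an arbitrary word may break the rules but cannot profit from it. The gap
  between \<open>G\<close> and \<open>B\<close> may be tiny; only their ratio counts, since its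
  powers tend to 0 and the rarity of blocks that count at all is made up by repetition. The diagonal
  step uses no recursion theorem. The program is compiled before the chain exists, and the part of
  the automaton outside the chain does not depend on the length of the chain. The code of that part
  can therefore serve as the length, and the program recovers the whole automaton from its
  input.\<close>

inductive_cases eval_ZeroE: "eval Zero xs z"
inductive_cases eval_SuccE: "eval Succ xs z"
inductive_cases eval_ProjE: "eval (Proj i) xs z"
inductive_cases eval_CompE: "eval (Comp f gs) xs z"
inductive_cases eval_Prim0E: "eval (Prim f g) (0 # xs) z"
inductive_cases eval_PrimSE: "eval (Prim f g) (Suc n # xs) z"
inductive_cases eval_PrimE: "eval (Prim f g) xs z"
inductive_cases eval_MnE: "eval (Mn f) xs z"

lemma eval_functional: "eval f xs y \<Longrightarrow> eval f xs z \<Longrightarrow> y = z"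
proof (induction arbitrary: z rule: eval.induct)
  case (eval_Comp ys gs xs f z')
  from eval_Comp.prems obtain ys' where ys': "length ys' = length gs"
    "\<forall>i<length gs. eval (gs ! i) xs (ys' ! i)" "eval f ys' z"
    by (rule eval_CompE) blast
  have "ys = ys'"
    using eval_Comp.hyps(1) eval_Comp.IH(1) ys'(1,2) by (intro nth_equalityI) auto
  with ys'(3) eval_Comp.IH(2) show ?case by blast
next
  case (eval_Mn f n xs)
  from eval_Mn.prems have z: "eval f (z # xs) 0" "\<forall>i<z. \<exists>y. eval f (i # xs) (Suc y)"
    by (auto elim: eval_MnE)
  have "\<not> n < z" using z(2) eval_Mn.IH(1) by blast
  moreover have "\<not> z < n" using z(1) eval_Mn.IH(2) by blast
  ultimately show ?case by simp
next
  case (eval_PrimS f g n xs y z')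
  from eval_PrimS.prems obtain y' where "eval (Prim f g) (n # xs) y'" "eval g (n # y' # xs) z"
    by (rule eval_PrimSE)
  with eval_PrimS.IH show ?case by blast
qed (blast elim: eval_ZeroE eval_SuccE eval_ProjE eval_Prim0E)+

definition computable :: "nat \<Rightarrow> (nat list \<Rightarrow> nat) \<Rightarrow> bool" where
  "computable n F \<longleftrightarrow> (\<exists>e. \<forall>xs. length xs = n \<longrightarrow> eval e xs (F xs))"

lemma computable_cong:
  "computable n F \<Longrightarrow> (\<And>xs. length xs = n \<Longrightarrow> F xs = G xs) \<Longrightarrow> computable n G"
  unfolding computable_def by auto

lemma computable_nth: "i < n \<Longrightarrow> computable n (\<lambda>xs. xs ! i)"
  unfolding computable_def by (auto intro: eval_Proj)

text \<open>The body of a recursion sees its parameters behind the counter and the previous value,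
  hence as \<open>drop 2\<close>; nested recursions drop more.\<close>

lemma computable_nth_drop: "d + i < n \<Longrightarrow> computable n (\<lambda>xs. drop d xs ! i)"
  unfolding computable_def by (rule exI[of _ "Proj (d + i)"]) (auto intro: eval_Proj)

lemma computable_compose:
  assumes "computable (length Gs) F" "\<forall>G\<in>set Gs. computable n G"
  shows "computable n (\<lambda>xs. F (map (\<lambda>G. G xs) Gs))"
proof -
  obtain f where f: "\<And>xs. length xs = length Gs \<Longrightarrow> eval f xs (F xs)"
    using assms(1) unfolding computable_def by blast
  from assms(2) obtain e where e: "\<And>G xs. G \<in> set Gs \<Longrightarrow> length xs = n \<Longrightarrow> eval (e G) xs (G xs)"
    unfolding computable_def by metis
  have "eval (Comp f (map e Gs)) xs (F (map (\<lambda>G. G xs) Gs))" if "length xs = n" for xs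
    by (rule eval_Comp[where ys = "map (\<lambda>G. G xs) Gs"]) (auto simp: that intro!: e f)
  then show ?thesis unfolding computable_def by blast
qed

lemma computable_Suc: "computable n F \<Longrightarrow> computable n (\<lambda>xs. Suc (F xs))"
proof -
  have "computable 1 (\<lambda>xs. Suc (xs ! 0))"
    unfolding computable_def
    by (rule exI[of _ Succ]) (auto simp: length_Suc_conv intro: eval_Succ)
  from computable_compose[of "[F]" "\<lambda>xs. Suc (xs ! 0)" n] this
  show "computable n F \<Longrightarrow> computable n (\<lambda>xs. Suc (F xs))" by simp
qed

lemma computable_const: "computable n (\<lambda>xs. c)"
proof (induction c)
  case 0 show ?case unfolding computable_def using eval_Zero by blast
qed (rule computable_Suc)

text \<open>\<open>Prim\<close> recurses on its first argument only, so it is compiled for an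
  additional leading argument; composing with \<open>H\<close> and all projections then supplies
  that argument.\<close>

lemma computable_rec:
  assumes F: "computable n F" and B: "computable (Suc (Suc n)) (\<lambda>zs. B (zs ! 0) (zs ! 1) (drop 2 zs))"
    and H: "computable n H"
  shows "computable n (\<lambda>xs. rec_nat (F xs) (\<lambda>i y. B i y xs) (H xs))"
proof -
  obtain f where f: "\<And>xs. length xs = n \<Longrightarrow> eval f xs (F xs)"
    using F unfolding computable_def by blast
  obtain g where g: "\<And>zs. length zs = Suc (Suc n) \<Longrightarrow> eval g zs (B (zs ! 0) (zs ! 1) (drop 2 zs))"
    using B unfolding computable_def by blast
  have g': "eval g (i # y # xs) (B i y xs)" if "length xs = n" for i y xs
    using g[of "i # y # xs"] that by (simp add: numeral_2_eq_2)
  have "eval (Prim f g) (m # xs) (rec_nat (F xs) (\<lambda>i y. B i y xs) m)" if "length xs = n" for m xs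
  proof (induction m)
    case 0 show ?case using f[OF that] by (auto intro: eval_Prim0)
  next
    case (Suc m) show ?case using eval_PrimS[OF Suc g'[OF that]] by simp
  qed
  then have "computable (Suc n) (\<lambda>zs. rec_nat (F (tl zs)) (\<lambda>i y. B i y (tl zs)) (hd zs))"
    unfolding computable_def by (intro exI[of _ "Prim f g"]) (auto simp: length_Suc_conv)
  moreover have "computable n G" if "G \<in> set (H # map (\<lambda>i xs. xs ! i) [0..<n])" for G
    using that H computable_nth by auto
  ultimately have "computable n (\<lambda>xs. (\<lambda>zs. rec_nat (F (tl zs)) (\<lambda>i y. B i y (tl zs)) (hd zs))
      (map (\<lambda>G. G xs) (H # map (\<lambda>i xs. xs ! i) [0..<n])))"
    by (intro computable_compose) auto
  then show ?thesis
    by (rule computable_cong) (auto simp: comp_def map_nth)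
qed

lemma computable_add:
  assumes "computable n F" "computable n G"
  shows "computable n (\<lambda>xs. F xs + G xs)"
proof -
  have "computable n (\<lambda>xs. rec_nat (F xs) (\<lambda>i y. Suc y) (G xs))"
    by (intro computable_rec computable_Suc computable_nth assms) auto
  moreover have "rec_nat a (\<lambda>i y. Suc y) b = a + b" for a b by (induction b) auto
  ultimately show ?thesis by simp
qed

lemma computable_prod_encode:
  assumes "computable n F" "computable n G"
  shows "computable n (\<lambda>xs. prod_encode (F xs, G xs))"
proof -
  \<comment> \<open>The pairing function is \<open>triangle (a + b) + a\<close>, and a triangular
    number is a sum by primitive recursion.\<close>
  have "computable n (\<lambda>xs. rec_nat 0 (\<lambda>i y. y + Suc i) (F xs + G xs) + F xs)"
    by (intro computable_rec computable_add computable_const computable_Suc computable_nth assms) auto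
  moreover have "rec_nat 0 (\<lambda>i y. y + Suc i) b = triangle b" for b by (induction b) auto
  ultimately show ?thesis by (simp add: prod_encode_def)
qed

lemmas computable_intros = computable_nth computable_nth_drop computable_Suc computable_const
  computable_rec computable_add computable_prod_encode

section \<open>Programs with guesses and equality tests\<close>

datatype act = Add nat nat | Zro nat | Tst nat nat

text \<open>A test never blocks the update: in the automaton a failed test only shifts weight to the
  accounts, and the registers go on as if it had passed. Blocking is left to
  \<open>passes\<close>.\<close>

fun upd :: "act \<Rightarrow> (nat \<Rightarrow> nat) \<Rightarrow> nat \<Rightarrow> nat" where
  "upd (Add r r') s = s(r := s r + s r')"
| "upd (Zro r) s = s(r := 0)"
| "upd (Tst a b) s = s"

fun passes :: "act \<Rightarrow> (nat \<Rightarrow> nat) \<Rightarrow> bool" where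
  "passes (Tst a b) s \<longleftrightarrow> s a = s b"
| "passes _ s \<longleftrightarrow> True"

datatype prog = Act act | Seq prog prog | Star prog

fun sem :: "prog \<Rightarrow> (nat \<Rightarrow> nat) \<Rightarrow> (nat \<Rightarrow> nat) \<Rightarrow> bool" where
  "sem (Act a) s s' \<longleftrightarrow> passes a s \<and> s' = upd a s"
| "sem (Seq p q) s s' \<longleftrightarrow> (\<exists>t. sem p s t \<and> sem q t s')"
| "sem (Star p) s s' \<longleftrightarrow> (sem p)\<^sup>*\<^sup>* s s'"

abbreviation skip :: act where "skip \<equiv> Tst 0 0"

text \<open>The control states of a program are its continuations.\<close>

fun edges :: "prog \<Rightarrow> prog list \<Rightarrow> (prog list \<times> act \<times> prog list) set" where
  "edges (Act a) K = {(Act a # K, a, K)}"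
| "edges (Seq p q) K = insert (Seq p q # K, skip, p # q # K) (edges p (q # K) \<union> edges q K)"
| "edges (Star p) K = {(Star p # K, skip, K), (Star p # K, skip, p # Star p # K)}
     \<union> edges p (Star p # K)"

lemma finite_edges: "finite (edges p K)"
  by (induction p arbitrary: K) auto

definition cstep :: "('c \<times> act \<times> 'c) set \<Rightarrow> 'c \<times> (nat \<Rightarrow> nat) \<Rightarrow> 'c \<times> (nat \<Rightarrow> nat) \<Rightarrow> bool" where
  "cstep E x y \<longleftrightarrow> (\<exists>a. (fst x, a, fst y) \<in> E \<and> passes a (snd x) \<and> snd y = upd a (snd x))"

lemma cstepI: "(c, a, c') \<in> E \<Longrightarrow> passes a s \<Longrightarrow> s' = upd a s \<Longrightarrow> cstep E (c, s) (c', s')"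
  unfolding cstep_def by auto

lemma sem_imp_path:
  "sem p s s' \<Longrightarrow> edges p K \<subseteq> E \<Longrightarrow> (cstep E)\<^sup>*\<^sup>* (p # K, s) (K, s')"
proof (induction p arbitrary: K s s')
  case (Act a)
  then show ?case by (auto intro!: r_into_rtranclp cstepI)
next
  case (Seq p q)
  from Seq.prems obtain t where "sem p s t" "sem q t s'" by auto
  then have "(cstep E)\<^sup>*\<^sup>* (p # q # K, s) (q # K, t)" "(cstep E)\<^sup>*\<^sup>* (q # K, t) (K, s')"
    using Seq.IH Seq.prems(2) by auto
  moreover have "cstep E (Seq p q # K, s) (p # q # K, s)"
    using Seq.prems(2) by (auto intro!: cstepI[where a = skip])
  ultimately show ?case
    by (meson converse_rtranclp_into_rtranclp rtranclp_trans)
next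
  case (Star p)
  from Star.prems(1) have "(sem p)\<^sup>*\<^sup>* s s'" by simp
  then show ?case
  proof (induction rule: converse_rtranclp_induct)
    case base
    have "cstep E (Star p # K, s') (K, s')"
      using Star.prems(2) by (auto intro!: cstepI[where a = skip])
    then show ?case by blast
  next
    case (step s t)
    have "cstep E (Star p # K, s) (p # Star p # K, s)"
      using Star.prems(2) by (auto intro!: cstepI[where a = skip])
    moreover have "(cstep E)\<^sup>*\<^sup>* (p # Star p # K, s) (Star p # K, t)"
      using Star.IH step.hyps(1) Star.prems(2) by auto
    ultimately show ?case using step.IH
      by (meson converse_rtranclp_into_rtranclp rtranclp_trans)
  qed
qed

fun sems :: "prog list \<Rightarrow> (nat \<Rightarrow> nat) \<Rightarrow> (nat \<Rightarrow> nat) \<Rightarrow> bool" where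
  "sems [] s s' \<longleftrightarrow> s' = s"
| "sems (p # K) s s' \<longleftrightarrow> (\<exists>t. sem p s t \<and> sems K t s')"

text \<open>A continuation is the list of programs still to be run. Each edge preserves, backwards,
  the possibility of ending in \<open>s'\<close>, so a path need not be cut into the rounds of its
  loops.\<close>

lemma edge_sound:
  "(K1, a, K2) \<in> edges p K \<Longrightarrow> passes a s \<Longrightarrow> sems K2 (upd a s) s' \<Longrightarrow> sems K1 s s'"
proof (induction p arbitrary: K)
  case (Star p)
  have step: "sem (Star p) s u" if "sem p s t" "sem (Star p) t u" for t u
    using that by (auto intro: converse_rtranclp_into_rtranclp)
  from Star.prems(1) consider "K1 = Star p # K" "a = skip" "K2 = K"
    | "K1 = Star p # K" "a = skip" "K2 = p # Star p # K" | "(K1, a, K2) \<in> edges p (Star p # K)"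
    by auto
  then show ?case
  proof cases
    case 2
    with Star.prems(3) step show ?thesis by (auto simp del: sem.simps)
  qed (use Star in auto)
next
  case (Seq p q)
  from Seq.prems(1) consider "K1 = Seq p q # K" "a = skip" "K2 = p # q # K"
    | "(K1, a, K2) \<in> edges p (q # K)" | "(K1, a, K2) \<in> edges q K"
    by auto
  then show ?case
  proof cases
    case 1
    with Seq.prems(3) show ?thesis by simp blast
  qed (use Seq in auto)
qed auto

lemma path_imp_sem:
  assumes "(cstep (edges p []))\<^sup>*\<^sup>* ([p], s) ([], s')"
  shows "sem p s s'"
proof -
  have "sems (fst x) (snd x) s'" if "(cstep (edges p []))\<^sup>*\<^sup>* x ([], s')" for x
    using that
  proof (induction rule: converse_rtranclp_induct)
    case (step x y)
    from step(1) obtain a where "(fst x, a, fst y) \<in> edges p []" "passes a (snd x)"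
      "snd y = upd a (snd x)"
      unfolding cstep_def by blast
    with step(3) show ?case by (auto intro: edge_sound)
  qed simp
  from this[OF assms] show ?thesis by auto
qed

section \<open>Compiling recursive functions into programs\<close>

definition computes :: "prog \<Rightarrow> recf \<Rightarrow> nat list \<Rightarrow> nat \<Rightarrow> nat \<Rightarrow> bool" where
  "computes p f args out N \<longleftrightarrow> (\<forall>s. s 0 = 1 \<longrightarrow>
     (\<forall>s'. sem p s s' \<longrightarrow> (\<forall>r<N. r \<noteq> out \<longrightarrow> s' r = s r) \<and> eval f (map s args) (s' out)) \<and>
     (\<forall>y. eval f (map s args) y \<longrightarrow> (\<exists>s'. sem p s s' \<and> s' out = y)))"

lemma computesD:
  assumes "computes p f args out N" "s 0 = 1" "sem p s s'"
  shows "r < N \<Longrightarrow> r \<noteq> out \<Longrightarrow> s' r = s r" and "eval f (map s args) (s' out)"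
  using assms unfolding computes_def by auto

lemma computesE:
  assumes "computes p f args out N" "s 0 = 1" "eval f (map s args) y"
  obtains s' where "sem p s s'" "s' out = y" "\<And>r. r < N \<Longrightarrow> r \<noteq> out \<Longrightarrow> s' r = s r"
  using assms unfolding computes_def by metis

definition assign :: "nat \<Rightarrow> nat \<Rightarrow> prog" where
  "assign r r' = Seq (Act (Zro r)) (Act (Add r r'))"

lemma sem_assign: "r \<noteq> r' \<Longrightarrow> sem (assign r r') s s' \<longleftrightarrow> s' = s(r := s r')"
  by (auto simp: assign_def)

text \<open>Needed where arguments are missing, so that the function has no value: a zeroed register
  is compared with the constant 1 in register 0, which leaves no run.\<close>

definition fail :: "nat \<Rightarrow> prog" where
  "fail r = Seq (Act (Zro r)) (Act (Tst r 0))"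

lemma sem_fail: "s 0 = 1 \<Longrightarrow> 0 < r \<Longrightarrow> \<not> sem (fail r) s s'"
  by (auto simp: fail_def)

lemma guess_sem: "sem (Star (Act (Add r 0))) s s' \<Longrightarrow> s 0 = 1 \<Longrightarrow> 0 < r \<Longrightarrow> \<exists>n\<ge>s r. s' = s(r := n)"
proof -
  assume "sem (Star (Act (Add r 0))) s s'" and s: "s 0 = 1" "0 < r"
  then have "(sem (Act (Add r 0)))\<^sup>*\<^sup>* s s'" by simp
  then show ?thesis
  proof (induction rule: rtranclp_induct)
    case base show ?case by (intro exI[of _ "s r"]) auto
  next
    case (step t u)
    then obtain n where n: "n \<ge> s r" "t = s(r := n)" by blast
    from step(2) n s have "u = s(r := Suc n)" by auto
    with n show ?case by (intro exI[of _ "Suc n"]) auto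
  qed
qed

lemma sem_guess: "s 0 = 1 \<Longrightarrow> 0 < r \<Longrightarrow> s r \<le> n \<Longrightarrow> sem (Star (Act (Add r 0))) s (s(r := n))"
proof -
  assume s: "s 0 = 1" "0 < r" "s r \<le> n"
  from s(3) have "(sem (Act (Add r 0)))\<^sup>*\<^sup>* s (s(r := n))"
  proof (induction n rule: dec_induct)
    case (step n)
    have "sem (Act (Add r 0)) (s(r := n)) (s(r := Suc n))" using s by auto
    with step.IH show ?case by (meson rtranclp.rtrancl_into_rtrancl)
  qed auto
  then show ?thesis by simp
qed

lemma sem_Star_invariant:
  assumes "sem (Star p) s s'" "I s" "\<And>t u. I t \<Longrightarrow> sem p t u \<Longrightarrow> I u"
  shows "I s'"
proof -
  from assms(1) have "(sem p)\<^sup>*\<^sup>* s s'" by simp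
  then show ?thesis by induction (use assms in auto)
qed

lemma sem_Star_refl: "sem (Star p) s s"
  by simp

lemma sem_Star_step: "sem (Star p) s t \<Longrightarrow> sem p t u \<Longrightarrow> sem (Star p) s u"
  by (auto intro: rtranclp.rtrancl_into_rtrancl)

text \<open>Loops run a guessed number of rounds and an equality test rejects wrong guesses;
  divergence of \<open>f\<close> becomes the absence of a terminating run. Registers from
  \<open>N\<close> on are scratch space with arbitrary contents, written before they are read;
  subprograms get a larger bound that protects those in use.\<close>

lemma ex_computes:
  assumes "\<forall>a\<in>set args. a < N" "0 < out" "out < N" "out \<notin> set args"
  shows "\<exists>p. computes p f args out N"
  using assms
proof (induction f arbitrary: args out N)
  case Zero
  have "computes (Act (Zro out)) Zero args out N"
    by (auto simp: computes_def intro: eval_Zero elim: eval_ZeroE)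
  then show ?case by blast
next
  case Succ
  show ?case
  proof (cases args)
    case Nil
    have "computes (fail N) Succ args out N"
      using Succ sem_fail[of _ N] by (auto simp: computes_def Nil elim: eval_SuccE)
    then show ?thesis by blast
  next
    case (Cons a as)
    have "computes (Seq (assign out a) (Act (Add out 0))) Succ args out N"
      using Succ by (auto simp: computes_def Cons sem_assign intro: eval_Succ elim!: eval_SuccE)
    then show ?thesis by blast
  qed
next
  case (Proj i)
  show ?case
  proof (cases "i < length args")
    case False
    have "computes (fail N) (Proj i) args out N"
      using Proj sem_fail[of _ N] False by (auto simp: computes_def elim: eval_ProjE)
    then show ?thesis by blast
  next
    case True
    with Proj have "out \<noteq> args ! i" by auto
    then have "computes (assign out (args ! i)) (Proj i) args out N"
      using Proj True eval_Proj[of i "map _ args"]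
      by (auto simp: computes_def sem_assign elim!: eval_ProjE)
    then show ?thesis by blast
  qed
next
  case (Comp f gs)
  \<comment> \<open>The value of \<open>gs ! i\<close> waits in register \<open>N + i\<close> while
    the later members of the chain run, so their bound must lie above all of these
    registers.\<close>
  define N' where "N' = N + length gs"
  have "\<exists>p. computes p (gs ! i) args (N + i) N'" if "i < length gs" for i
    using that Comp.prems by (intro Comp.IH(2)) (auto simp: N'_def)
  then obtain P where P: "\<And>i. i < length gs \<Longrightarrow> computes (P i) (gs ! i) args (N + i) N'"
    by metis
  obtain q where q: "computes q f [N..<N'] out N'"
    using Comp.IH(1)[of "[N..<N']" N' out] Comp.prems by (auto simp: N'_def)
  define chain where "chain n = rec_nat (Act skip) (\<lambda>i p. Seq p (P i)) n" for n
  have sound: "(\<forall>r<N. s' r = s r) \<and> (\<forall>i<n. eval (gs ! i) (map s args) (s' (N + i)))"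
    if "sem (chain n) s s'" "n \<le> length gs" "s 0 = 1" for n s s'
    using that
  proof (induction n arbitrary: s')
    case 0 then show ?case by (simp add: chain_def)
  next
    case (Suc n)
    from Suc.prems(1) obtain t where t: "sem (chain n) s t" "sem (P n) t s'"
      by (auto simp: chain_def)
    from Suc.IH[OF t(1)] Suc.prems
    have IH: "\<forall>r<N. t r = s r" "\<forall>i<n. eval (gs ! i) (map s args) (t (N + i))" by auto
    have t0: "t 0 = 1" using IH(1) Suc.prems Comp.prems by auto
    note c = computesD[OF P[of n] t0 t(2)]
    have "map t args = map s args" using IH(1) Comp.prems by auto
    with c(2) Suc.prems(2) have "eval (gs ! n) (map s args) (s' (N + n))"
      by (simp del: map_eq_conv)
    moreover have "s' r = t r" if "r < N + n" for r
      using c(1)[of r] that Suc.prems by (auto simp: N'_def)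
    ultimately show ?case using IH Comp.prems by (auto simp: less_Suc_eq)
  qed
  have complete: "\<exists>s'. sem (chain n) s s' \<and> (\<forall>i<n. s' (N + i) = ys ! i)"
    if "n \<le> length gs" "s 0 = 1" "\<forall>i<length gs. eval (gs ! i) (map s args) (ys ! i)" for n s ys
    using that
  proof (induction n)
    case 0 then show ?case by (auto simp: chain_def)
  next
    case (Suc n)
    then obtain t where t: "sem (chain n) s t" "\<forall>i<n. t (N + i) = ys ! i" by auto
    from sound[OF t(1)] Suc.prems have tN: "\<forall>r<N. t r = s r" by auto
    then have "t 0 = 1" "map t args = map s args" using Suc.prems Comp.prems by auto
    with Suc.prems obtain s' where s': "sem (P n) t s'" "s' (N + n) = ys ! n"
      "\<And>r. r < N' \<Longrightarrow> r \<noteq> N + n \<Longrightarrow> s' r = t r"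
      using computesE[OF P[of n], of t "ys ! n"] by (metis Suc_le_lessD)
    have "s' (N + i) = ys ! i" if "i < Suc n" for i
      using s' t that Suc.prems by (cases "i = n") (auto simp: N'_def)
    with t(1) s'(1) show ?case by (auto simp: chain_def)
  qed
  have "computes (Seq (chain (length gs)) q) (Comp f gs) args out N"
    unfolding computes_def
  proof (intro allI impI conjI)
    fix s s' :: "nat \<Rightarrow> nat" and r assume s: "s 0 = 1" "sem (Seq (chain (length gs)) q) s s'"
    then obtain t where t: "sem (chain (length gs)) s t" "sem q t s'" by auto
    note snd = sound[OF t(1) order.refl s(1)]
    then have t0: "t 0 = 1" using s Comp.prems by auto
    note c = computesD[OF q t0 t(2)]
    show "eval (Comp f gs) (map s args) (s' out)"
      using snd c(2) by (intro eval_Comp[where ys = "map t [N..<N']"]) (auto simp: N'_def)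
    show "s' r = s r" if "r < N" "r \<noteq> out"
      using c(1)[of r] snd that by (auto simp: N'_def)
  next
    fix s :: "nat \<Rightarrow> nat" and y assume s: "s 0 = 1" "eval (Comp f gs) (map s args) y"
    then obtain ys where ys: "length ys = length gs"
      "\<forall>i<length gs. eval (gs ! i) (map s args) (ys ! i)" "eval f ys y"
      by (auto elim: eval_CompE)
    from complete[OF order.refl s(1) ys(2)] obtain t where
      t: "sem (chain (length gs)) s t" "\<forall>i<length gs. t (N + i) = ys ! i" by blast
    have "map t [N..<N'] = ys" using t(2) ys(1) by (intro nth_equalityI) (auto simp: N'_def)
    moreover have "t 0 = 1" using sound[OF t(1) order.refl s(1)] s Comp.prems by auto
    ultimately obtain s' where "sem q t s'" "s' out = y"
      using computesE[OF q, of t y] ys(3) by metis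
    with t(1) show "\<exists>s'. sem (Seq (chain (length gs)) q) s s' \<and> s' out = y" by auto
  qed
  then show ?case by blast
next
  case (Prim f g)
  show ?case
  proof (cases args)
    case Nil
    have "computes (fail N) (Prim f g) args out N"
      using Prim.prems sem_fail[of _ N] by (auto simp: computes_def Nil elim: eval_PrimE)
    then show ?thesis by blast
  next
    case (Cons a as)
    define i y z N' where "i = N" "y = N + 1" "z = N + 2" "N' = N + 3"
    note regs = i_y_z_N'_def
    obtain p where p: "computes p f as y N'"
      using Prim.IH(1)[of as N' y] Prim.prems by (fastforce simp: Cons regs)
    obtain q where q: "computes q g (i # y # as) z N'"
      using Prim.IH(2)[of "i # y # as" N' z] Prim.prems by (fastforce simp: Cons regs)
    define body where "body = Seq q (Seq (assign y z) (Act (Add i 0)))"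
    \<comment> \<open>The number of rounds is free; \<open>Tst i a\<close> keeps only the runs whose
      counter ends at the recursion argument.\<close>
    define P where "P = Seq (Act (Zro i)) (Seq p (Seq (Star body) (Seq (Act (Tst i a)) (assign out y))))"
    have a: "a < N" "\<forall>b\<in>set as. b < N" using Prim.prems by (auto simp: Cons)
    have asm: "map t as = map s as" if "\<forall>r<N. t r = s r" for s t :: "nat \<Rightarrow> nat"
      using that a by auto
    have "computes P (Prim f g) args out N"
      unfolding computes_def
    proof (intro allI impI)
      fix s :: "nat \<Rightarrow> nat" assume s: "s 0 = 1"
      have step: "(\<forall>r<N. u r = s r) \<and> (\<exists>v. eval g (t i # t y # map s as) v \<and> u i = Suc (t i) \<and> u y = v)"
        if tu: "\<forall>r<N. t r = s r" "sem body t u" for t u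
      proof -
        from tu(2) obtain t1 where t1: "sem q t t1" "u = (t1(y := t1 z))(i := t1 i + t1 0)"
          by (auto simp: body_def sem_assign regs)
        have "t 0 = 1" using tu s Prim.prems by auto
        note c = computesD[OF q this t1(1)]
        show ?thesis
          using c(1)[of i] c(1)[of 0] c(1) c(2) tu(1) asm[OF tu(1)] s Prim.prems by (auto simp: t1(2) regs simp del: map_eq_conv)
      qed
      show "(\<forall>s'. sem P s s' \<longrightarrow> (\<forall>r<N. r \<noteq> out \<longrightarrow> s' r = s r) \<and> eval (Prim f g) (map s args) (s' out)) \<and>
        (\<forall>v. eval (Prim f g) (map s args) v \<longrightarrow> (\<exists>s'. sem P s s' \<and> s' out = v))"
      proof (intro conjI allI impI)
        fix s' assume "sem P s s'"
        then obtain t1 t2 where t: "sem p (s(i := 0)) t1" "sem (Star body) t1 t2" "t2 i = t2 a" "s' = t2(out := t2 y)"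
          using Prim.prems by (auto simp: P_def sem_assign regs simp del: sem.simps(3))
        have "(s(i := 0)) 0 = 1" using s Prim.prems by (auto simp: regs)
        note c = computesD[OF p this t(1)]
        have "map (s(i := 0)) as = map s as" by (rule asm) (auto simp: regs)
        with c(2) have "(\<forall>r<N. t1 r = s r) \<and> eval (Prim f g) (t1 i # map s as) (t1 y)"
          using c(1) by (auto simp: regs simp del: map_eq_conv intro: eval_Prim0)
        with t(2) have inv: "(\<forall>r<N. t2 r = s r) \<and> eval (Prim f g) (t2 i # map s as) (t2 y)"
        proof (rule sem_Star_invariant[where
            I = "\<lambda>t. (\<forall>r<N. t r = s r) \<and> eval (Prim f g) (t i # map s as) (t y)"])
          fix t u assume "(\<forall>r<N. t r = s r) \<and> eval (Prim f g) (t i # map s as) (t y)" "sem body t u"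
          with step[of t u] show "(\<forall>r<N. u r = s r) \<and> eval (Prim f g) (u i # map s as) (u y)"
            by (auto intro: eval_PrimS)
        qed
        show "eval (Prim f g) (map s args) (s' out)" using inv t(3,4) a by (auto simp: Cons)
        show "s' r = s r" if "r < N" "r \<noteq> out" for r using inv t(4) that by auto
      next
        fix v assume v: "eval (Prim f g) (map s args) v"
        have reach: "\<exists>t. (\<exists>t1. sem p (s(i := 0)) t1 \<and> sem (Star body) t1 t) \<and> t i = n \<and> t y = v \<and> (\<forall>r<N. t r = s r)"
          if "eval (Prim f g) (n # map s as) v" for n v
          using that
        proof (induction n arbitrary: v)
          case 0
          then have "eval f (map (s(i := 0)) as) v"
            using asm[of "s(i := 0)" s] by (auto simp: regs simp del: map_eq_conv elim: eval_Prim0E)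
          moreover have "(s(i := 0)) 0 = 1" using s Prim.prems by (auto simp: regs)
          ultimately obtain t where t: "sem p (s(i := 0)) t" "t y = v"
            "\<And>r. r < N' \<Longrightarrow> r \<noteq> y \<Longrightarrow> t r = (s(i := 0)) r"
            using computesE[OF p] by metis
          have "t i = 0" "\<forall>r<N. t r = s r" using t(3) by (auto simp: regs)
          with t(1,2) sem_Star_refl show ?case by blast
        next
          case (Suc n)
          from Suc.prems obtain v' where v': "eval (Prim f g) (n # map s as) v'" "eval g (n # v' # map s as) v"
            by (auto elim: eval_PrimSE)
          from Suc.IH[OF v'(1)] obtain t t1 where t: "sem p (s(i := 0)) t1" "sem (Star body) t1 t"
            "t i = n" "t y = v'" "\<forall>r<N. t r = s r" by blast
          have "t 0 = 1" using t s Prim.prems by auto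
          moreover have "eval g (map t (i # y # as)) v" using v'(2) t asm[OF t(5)] by (simp del: map_eq_conv)
          ultimately obtain u where u: "sem q t u" "u z = v" "\<And>r. r < N' \<Longrightarrow> r \<noteq> z \<Longrightarrow> u r = t r"
            using computesE[OF q] by metis
          define w where "w = (u(y := u z))(i := u i + u 0)"
          have u0: "u i = n" "u 0 = 1" using u(3)[of i] u(3)[of 0] t s Prim.prems by (auto simp: regs)
          have "sem body t w" using u(1) by (auto simp: body_def sem_assign w_def regs)
          then have "sem (Star body) t1 w" using t(2) sem_Star_step by blast
          moreover have "w i = Suc n" "w y = v" "\<forall>r<N. w r = s r"
            using u0 u t by (auto simp: w_def regs)
          ultimately show ?case using t(1) by blast
        qed
        have "eval (Prim f g) (s a # map s as) v" using v by (simp add: Cons)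
        from reach[OF this] obtain t t1 where "sem p (s(i := 0)) t1" "sem (Star body) t1 t"
          "t i = s a" "t y = v" "\<forall>r<N. t r = s r" by blast
        then have "sem P s (t(out := t y))" "t y = v"
          using a Prim.prems
          by (simp_all add: P_def sem_assign regs del: sem.simps(3))
            (intro exI[of _ t1] conjI exI[of _ t]; simp del: sem.simps(3))
        then show "\<exists>s'. sem P s s' \<and> s' out = v" by auto
      qed
    qed
    then show ?thesis by blast
  qed
next
  case (Mn f)
  define i z w N' where "i = N" "z = N + 1" "w = N + 2" "N' = N + 3"
  note regs = i_z_w_N'_def
  obtain p where p: "computes p f (i # args) z N'"
    using Mn.IH[of "i # args" N' z] Mn.prems by (fastforce simp: regs)
  \<comment> \<open>There is no inequality test. That \<open>z\<close> is positive is certified by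
    guessing its value with a counter that starts at 1, the content of register 0.\<close>
  define pos where "pos = Seq (assign w 0) (Seq (Star (Act (Add w 0))) (Act (Tst w z)))"
  define body where "body = Seq p (Seq pos (Act (Add i 0)))"
  define P where "P = Seq (Act (Zro i)) (Seq (Star body) (Seq p (Seq (Act (Zro w)) (Seq (Act (Tst z w)) (assign out i)))))"
  have asm: "map t args = map s args" if "\<forall>r<N. t r = s r" for s t :: "nat \<Rightarrow> nat"
    using that Mn.prems by auto
  have pos_sound: "t z > 0 \<and> (\<forall>r<N. u r = t r) \<and> u i = t i" if "t 0 = 1" "sem pos t u" for t u
  proof -
    from that Mn.prems have "sem (Star (Act (Add w 0))) (t(w := 1)) u" "u w = u z"
      by (auto simp: pos_def sem_assign regs simp del: sem.simps(3))
    with guess_sem[OF this(1)] that Mn.prems obtain n where "n \<ge> 1" "u = t(w := n)"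
      by (auto simp: regs)
    with \<open>u w = u z\<close> Mn.prems show ?thesis by (auto simp: regs)
  qed
  have pos_complete: "\<exists>u. sem pos t u" if "t 0 = 1" "t z > 0" for t
  proof -
    have "sem (Star (Act (Add w 0))) (t(w := 1)) ((t(w := 1))(w := t z))"
      using that Mn.prems by (intro sem_guess) (auto simp: regs)
    then have "sem pos t (t(w := t z))"
      using that Mn.prems by (auto simp: pos_def sem_assign regs simp del: sem.simps(3))
    then show ?thesis by blast
  qed
  have "computes P (Mn f) args out N"
    unfolding computes_def
  proof (intro allI impI)
    fix s :: "nat \<Rightarrow> nat" assume s: "s 0 = 1"
    have step: "(\<forall>r<N. u r = s r) \<and> (\<exists>v. eval f (t i # map s args) (Suc v)) \<and> u i = Suc (t i)"
      if tu: "\<forall>r<N. t r = s r" "sem body t u" for t u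
    proof -
      from tu(2) obtain t1 t2 where t1: "sem p t t1" "sem pos t1 t2" "u = t2(i := t2 i + t2 0)"
        by (auto simp: body_def)
      have t0: "t 0 = 1" using tu s Mn.prems by auto
      note c = computesD[OF p t0 t1(1)]
      have "t1 0 = 1" using c(1)[of 0] t0 Mn.prems by (auto simp: regs)
      note d = pos_sound[OF this t1(2)]
      from d obtain v where v: "t1 z = Suc v" by (cases "t1 z") auto
      with c(2) have "eval f (t i # map s args) (Suc v)" using asm[OF tu(1)] by (simp del: map_eq_conv)
      then show ?thesis
        using v d c(1)[of i] c(1)[of 0] c(1) tu(1) s Mn.prems by (auto simp: t1(3) regs)
    qed
    show "(\<forall>s'. sem P s s' \<longrightarrow> (\<forall>r<N. r \<noteq> out \<longrightarrow> s' r = s r) \<and> eval (Mn f) (map s args) (s' out)) \<and>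
      (\<forall>v. eval (Mn f) (map s args) v \<longrightarrow> (\<exists>s'. sem P s s' \<and> s' out = v))"
    proof (intro conjI allI impI)
      fix s' assume "sem P s s'"
      then obtain t1 t2 where t: "sem (Star body) (s(i := 0)) t1" "sem p t1 t2" "t2 z = 0"
        "s' = t2(w := 0, out := t2 i)"
        using Mn.prems by (auto simp: P_def sem_assign regs simp del: sem.simps(3))
      have inv: "(\<forall>r<N. t1 r = s r) \<and> (\<forall>j<t1 i. \<exists>v. eval f (j # map s args) (Suc v))"
        using t(1)
      proof (rule sem_Star_invariant[where
          I = "\<lambda>t. (\<forall>r<N. t r = s r) \<and> (\<forall>j<t i. \<exists>v. eval f (j # map s args) (Suc v))"])
        fix t u assume "(\<forall>r<N. t r = s r) \<and> (\<forall>j<t i. \<exists>v. eval f (j # map s args) (Suc v))" "sem body t u"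
        with step[of t u] show "(\<forall>r<N. u r = s r) \<and> (\<forall>j<u i. \<exists>v. eval f (j # map s args) (Suc v))"
          by (auto simp: less_Suc_eq)
      qed (auto simp: regs)
      then have t1: "t1 0 = 1" "map t1 args = map s args" using s Mn.prems asm by auto
      note c = computesD[OF p t1(1) t(2)]
      have "t2 i = t1 i" using c(1)[of i] by (auto simp: regs)
      with inv c(2) t1(2) t(3) show "eval (Mn f) (map s args) (s' out)"
        by (auto simp: t(4) simp del: map_eq_conv intro: eval_Mn)
      show "s' r = s r" if "r < N" "r \<noteq> out" for r
        using inv c(1)[of r] that by (auto simp: t(4) regs)
    next
      fix v assume "eval (Mn f) (map s args) v"
      then have v: "eval f (v # map s args) 0" "\<forall>j<v. \<exists>y. eval f (j # map s args) (Suc y)"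
        by (auto elim: eval_MnE)
      have reach: "\<exists>t. sem (Star body) (s(i := 0)) t \<and> t i = n \<and> (\<forall>r<N. t r = s r)" if "n \<le> v" for n
        using that
      proof (induction n)
        case 0
        show ?case
          using sem_Star_refl by (intro exI[of _ "s(i := 0)"]) (auto simp: regs simp del: sem.simps(3))
      next
        case (Suc n)
        from Suc.IH[OF Suc_leD[OF Suc.prems]]
        obtain t where t: "sem (Star body) (s(i := 0)) t" "t i = n" "\<forall>r<N. t r = s r" by blast
        have "n < v" using Suc.prems by simp
        with v(2) obtain y where "eval f (n # map s args) (Suc y)" by blast
        moreover have t0: "t 0 = 1" using t s Mn.prems by auto
        ultimately obtain t1 where t1: "sem p t t1" "t1 z = Suc y" "\<And>r. r < N' \<Longrightarrow> r \<noteq> z \<Longrightarrow> t1 r = t r"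
          using computesE[OF p, of t "Suc y"] t0 t asm[OF t(3)] by (auto simp del: map_eq_conv)
        have "t1 0 = 1" using t1(3)[of 0] t0 by (auto simp: regs)
        from pos_complete[of t1] this t1(2) obtain t2 where t2: "sem pos t1 t2" by auto
        have "sem body t (t2(i := t2 i + t2 0))" using t1 t2 by (auto simp: body_def)
        moreover from step[OF t(3) this] have "\<forall>r<N. (t2(i := t2 i + t2 0)) r = s r" "(t2(i := t2 i + t2 0)) i = Suc n"
          using t(2) by auto
        ultimately show ?case using t(1) sem_Star_step by blast
      qed
      from reach[OF order.refl]
      obtain t where t: "sem (Star body) (s(i := 0)) t" "t i = v" "\<forall>r<N. t r = s r" by blast
      have t0: "t 0 = 1" using t s Mn.prems by auto
      obtain t1 where t1: "sem p t t1" "t1 z = 0" "\<And>r. r < N' \<Longrightarrow> r \<noteq> z \<Longrightarrow> t1 r = t r"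
        using computesE[OF p, of t 0] t0 v(1) t asm[OF t(3)] by (auto simp del: map_eq_conv)
      have "t1 i = v" using t1(3)[of i] t(2) by (auto simp: regs)
      then have "sem P s (t1(w := 0, out := v))"
        using t(1) t1(1,2) Mn.prems
        by (simp add: P_def sem_assign regs del: sem.simps(3))
          (intro exI[of _ t] conjI exI[of _ t1]; simp del: sem.simps(3))
      then show "\<exists>s'. sem P s s' \<and> s' out = v" by auto
    qed
  qed
  then show ?case by blast
qed

section \<open>The probabilistic word automaton of a program\<close>

text \<open>Expected payoff of the Markov chain driven by a finite word: \<open>stop\<close> pays at
  the first stopping state, the start included, and \<open>f\<close> pays where the word ends if no
  stopping state was met.\<close>

fun ev :: "('s \<Rightarrow> nat \<Rightarrow> bool \<Rightarrow> 's) \<Rightarrow> ('s \<Rightarrow> real option) \<Rightarrow> ('s \<Rightarrow> real) \<Rightarrow> 's \<Rightarrow> nat list \<Rightarrow> real" where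
  "ev \<delta> stop f q [] = (case stop q of Some x \<Rightarrow> x | None \<Rightarrow> f q)"
| "ev \<delta> stop f q (a # v) = (case stop q of Some x \<Rightarrow> x | None \<Rightarrow>
     (ev \<delta> stop f (\<delta> q a False) v + ev \<delta> stop f (\<delta> q a True) v) / 2)"

lemma ev_one: "ev \<delta> (\<lambda>_. None) (\<lambda>_. 1) q v = 1"
  by (induction v arbitrary: q) auto

lemma ev_nonneg:
  "(\<And>q x. stop q = Some x \<Longrightarrow> 0 \<le> x) \<Longrightarrow> (\<And>q. 0 \<le> f q) \<Longrightarrow> 0 \<le> ev \<delta> stop f q v"
  by (induction v arbitrary: q) (auto split: option.splits)

text \<open>The flag is \<open>True\<close> on the side of the account \<open>G\<close>. \<open>Walk \<sigma> i j\<close> is a pair of walkers at the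
  registers \<open>i\<close> and \<open>j\<close>; \<open>WAcc\<close> and \<open>LAcc\<close> are the two accounts; \<open>Launch\<close>, \<open>Chain\<close> and \<open>Ctl\<close> check the
  control flow on side \<open>True\<close>; \<open>EvW\<close> and \<open>EvL\<close> mark a win and a loss.\<close>

datatype 'c mst = EvL | EvW | Fresh | Dead | Launch | Init bool | Walk bool nat nat
  | WAcc bool | LAcc bool | Ctl 'c | Chain nat | Mid "'c mst" "'c mst"

text \<open>If the weight at a register is copied to each register listed, the weights
  \<open>s\<close> become \<open>upd a s\<close>. This includes \<open>Add r r\<close>, where the
  weight doubles; a reset lets the walker die.\<close>

fun moves :: "act \<Rightarrow> nat \<Rightarrow> nat list" where
  "moves (Add r r') i = (if i = r' then [i, r] else [i])"
| "moves (Zro r) i = (if i = r then [] else [i])"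
| "moves (Tst a b) i = [i]"

text \<open>The walkers stay where they are, and an additional outcome of the same weight goes to an
  account; thus a test does not disturb the later steps. The case \<open>a = b\<close>, in
  particular \<open>skip\<close>, leaves the accounts alone.\<close>

fun tests :: "act \<Rightarrow> bool \<Rightarrow> nat \<Rightarrow> nat \<Rightarrow> 'c mst list" where
  "tests (Tst a b) \<sigma> i j =
     (if a \<noteq> b \<and> i \<in> {a, b} \<and> j \<in> {a, b} then [if i = j then LAcc \<sigma> else WAcc \<sigma>] else [])"
| "tests _ \<sigma> i j = []"

text \<open>The letter 0 ends an execution, 1 ends a block of executions, \<open>i + 2\<close> stands for the edge
  \<open>es ! i\<close> and \<open>length es + 2\<close> for an increment of the input register 1. Register 0 holds the
  constant 1. A letter has four equally likely outcomes, hence takes two coin flips, and its second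
  copy in the word is read in the states \<open>Mid\<close>; missing outcomes are \<open>Dead\<close>.\<close>

definition letter_act :: "('c \<times> act \<times> 'c) list \<Rightarrow> nat \<Rightarrow> act" where
  "letter_act es a = (if a < length es + 2 then fst (snd (es ! (a - 2))) else Add 1 0)"

text \<open>On letter 0 only \<open>WAcc True\<close>, \<open>Ctl cf\<close> and
  \<open>LAcc False\<close> go on to a next execution; this realises the two accounts. Letter 1 in
  an \<open>Init\<close> state means that the block was survived and produces the event; in the
  middle of an execution it cancels the block. The last clause takes effect for
  \<open>Fresh\<close>, \<open>EvL\<close> and \<open>EvW\<close> and draws the side of the next
  block.\<close>

fun outs :: "('c \<times> act \<times> 'c) list \<Rightarrow> 'c \<Rightarrow> 'c mst \<Rightarrow> nat \<Rightarrow> 'c mst list" where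
  "outs es cf (Init \<sigma>) a = (if a = 1 then replicate 4 (if \<sigma> then EvW else EvL)
     else if \<sigma> then [Walk True 0 0, Launch] else [Walk False 0 0])"
| "outs es cf (Walk \<sigma> i j) a = (if a = 0 then [] else if a = 1 then replicate 4 Fresh
     else map (\<lambda>(i', j'). Walk \<sigma> i' j') (List.product (moves (letter_act es a) i) (moves (letter_act es a) j))
       @ tests (letter_act es a) \<sigma> i j)"
| "outs es cf (WAcc \<sigma>) a = (if a = 0 then if \<sigma> then replicate 4 (Init True) else []
     else if a = 1 then replicate 4 Fresh else [WAcc \<sigma>])"
| "outs es cf (LAcc \<sigma>) a = (if a = 0 then if \<sigma> then [] else replicate 4 (Init False)
     else if a = 1 then replicate 4 Fresh else [LAcc \<sigma>])"
| "outs es cf (Ctl c) a = (if a = 0 then if c = cf then replicate 4 (Init True) else []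
     else if a = 1 then replicate 4 Fresh
     else if a < length es + 2 \<and> fst (es ! (a - 2)) = c then [Ctl (snd (snd (es ! (a - 2))))] else [])"
| "outs es cf _ a = [Init True, Init True, Init False, Init False]"

fun cst :: "'c \<Rightarrow> nat \<Rightarrow> 'c mst" where
  "cst c 0 = Ctl c"
| "cst c (Suc i) = Chain i"

text \<open>\<open>Launch\<close> and \<open>Chain\<close> survive each single letter with
  probability 1/2, so a doubled letter costs them the same factor 1/4 as it costs the walkers. From
  \<open>Launch\<close> to \<open>Ctl cs\<close> it takes \<open>2 * m + 2\<close> letters, that is
  \<open>m + 1\<close> increments of register 1. \<open>Dead\<close> also moves by single letters,
  since the chain may fall into it between the two copies of a letter.\<close>

fun delta :: "('c \<times> act \<times> 'c) list \<Rightarrow> 'c \<Rightarrow> 'c \<Rightarrow> nat \<Rightarrow> 'c mst \<Rightarrow> nat \<Rightarrow> bool \<Rightarrow> 'c mst" where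
  "delta es cs cf m (Mid x y) a b = (if b then y else x)"
| "delta es cs cf m (Chain i) a b = (if a = length es + 2 \<and> \<not> b then cst cs i else Dead)"
| "delta es cs cf m Launch a b = (if a = length es + 2 \<and> \<not> b then cst cs (2 * m + 1) else Dead)"
| "delta es cs cf m Dead a b = (if a = 1 then Mid Fresh Fresh else Dead)"
| "delta es cs cf m q a b = (let l = outs es cf q a @ replicate 4 Dead
     in if b then Mid (l ! 2) (l ! 3) else Mid (l ! 0) (l ! 1))"

section \<open>Transport of weights by moves and tests\<close>

fun regs :: "act \<Rightarrow> nat set" where
  "regs (Add r r') = {r, r'}"
| "regs (Zro r) = {r}"
| "regs (Tst a b) = {a, b}"

text \<open>The square \<open>(s a - s b)\<^sup>2\<close> is \<open>errl - errw\<close>.\<close>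

fun errw :: "act \<Rightarrow> (nat \<Rightarrow> nat) \<Rightarrow> nat" where
  "errw (Tst a b) s = (if a = b then 0 else 2 * s a * s b)"
| "errw _ s = 0"

fun errl :: "act \<Rightarrow> (nat \<Rightarrow> nat) \<Rightarrow> nat" where
  "errl (Tst a b) s = (if a = b then 0 else s a * s a + s b * s b)"
| "errl _ s = 0"

lemma errw_le_errl: "errw a s \<le> errl a s"
proof (cases a)
  case (Tst x y)
  have "2 * s x * s y \<le> s x * s x + s y * s y"
    using sum_squares_bound[of "real (s x)" "real (s y)"] unfolding power2_eq_square
    by (metis (mono_tags, lifting) of_nat_add of_nat_le_iff of_nat_mult of_nat_numeral)
  then show ?thesis by (auto simp: Tst)
qed auto

lemma errw_eq_errl: "errw a s = errl a s \<longleftrightarrow> passes a s"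
proof (cases a)
  case (Tst x y)
  have sq: "(int (s x) - int (s y))\<^sup>2 = int (s x * s x + s y * s y) - int (2 * s x * s y)"
    by (simp add: power2_eq_square algebra_simps)
  have "s x = s y" if "2 * s x * s y = s x * s x + s y * s y"
    using sq unfolding that by simp
  then show ?thesis by (auto simp: Tst)
qed auto

text \<open>\<open>moves a\<close> is the transpose of the linear map that \<open>upd a\<close>
  performs on the registers.\<close>

lemma moves_sum:
  assumes "regs a \<subseteq> {..<R}"
  shows "(\<Sum>i<R. real (s i) * sum_list (map g (moves a i))) = (\<Sum>i<R. real (upd a s i) * g i)"
proof (cases a)
  case (Add r r')
  have "(\<Sum>i<R. real (s i) * sum_list (map g (moves a i)))
      = (\<Sum>i<R. real (s i) * g i + (if i = r' then real (s i) * g r else 0))"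
    by (intro sum.cong) (auto simp: Add algebra_simps)
  also have "\<dots> = (\<Sum>i<R. real (s i) * g i) + real (s r') * g r"
    using assms by (simp add: sum.distrib Add)
  also have "\<dots> = (\<Sum>i<R. real (s i) * g i + (if i = r then real (s r') * g r else 0))"
    using assms by (simp add: sum.distrib Add)
  also have "\<dots> = (\<Sum>i<R. real (upd a s i) * g i)"
    by (intro sum.cong) (auto simp: Add algebra_simps)
  finally show ?thesis .
qed (auto intro!: sum.cong)

lemma sum_list_product:
  "sum_list (map (\<lambda>(x, y). g x y) (List.product xs ys)) = sum_list (map (\<lambda>x. sum_list (map (g x) ys)) xs)"
  for g :: "'a \<Rightarrow> 'b \<Rightarrow> real"
  by (induction xs) (auto simp: comp_def)

lemma sum_sum_list_swap:
  "(\<Sum>j\<in>A. c j * sum_list (map (\<lambda>x. h x j) xs)) = sum_list (map (\<lambda>x. \<Sum>j\<in>A. c j * h x j) xs)"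
  for h :: "'a \<Rightarrow> 'b \<Rightarrow> real"
  by (induction xs) (auto simp: algebra_simps sum.distrib)

text \<open>The two walkers move independently, so product weights \<open>s i * s j\<close> remain
  product weights.\<close>

lemma moves_sum2:
  assumes "regs a \<subseteq> {..<R}"
  shows "(\<Sum>i<R. \<Sum>j<R. real (s i) * real (s j) *
      sum_list (map (\<lambda>(x, y). g x y) (List.product (moves a i) (moves a j))))
    = (\<Sum>i<R. \<Sum>j<R. real (upd a s i) * real (upd a s j) * g i j)"
proof -
  have "(\<Sum>i<R. \<Sum>j<R. real (s i) * real (s j) *
      sum_list (map (\<lambda>(x, y). g x y) (List.product (moves a i) (moves a j))))
    = (\<Sum>i<R. real (s i) * (\<Sum>j<R. real (s j) * sum_list (map (\<lambda>x. sum_list (map (g x) (moves a j))) (moves a i))))"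
    unfolding sum_list_product by (simp add: sum_distrib_left mult.assoc)
  also have "\<dots> = (\<Sum>i<R. real (s i) * sum_list (map (\<lambda>x. \<Sum>j<R. real (s j) * sum_list (map (g x) (moves a j))) (moves a i)))"
    by (subst sum_sum_list_swap) simp
  also have "\<dots> = (\<Sum>i<R. real (upd a s i) * (\<Sum>j<R. real (upd a s j) * g i j))"
    by (simp only: moves_sum[OF assms])
  finally show ?thesis by (simp add: sum_distrib_left mult.assoc)
qed

lemma sum_sum_delta:
  fixes x y R :: nat
  assumes "x < R" "y < R"
  shows "(\<Sum>i<R. \<Sum>j<R. if i = x then if j = y then c else 0 else 0) = (c :: real)"
proof -
  have "(\<Sum>j<R. if i = x then if j = y then c else 0 else 0) = (if i = x then c else 0)" for i
    using assms by simp
  then show ?thesis using assms by simp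
qed

lemma tests_sum:
  assumes "regs a \<subseteq> {..<R}"
  shows "(\<Sum>i<R. \<Sum>j<R. real (s i) * real (s j) * sum_list (map e (tests a \<sigma> i j)))
    = real (errw a s) * e (WAcc \<sigma>) + real (errl a s) * e (LAcc \<sigma>)"
proof (cases "\<exists>x y. a = Tst x y \<and> x \<noteq> y")
  case True
  then obtain x y where a: "a = Tst x y" and xy: "x \<noteq> y" by blast
  have R: "x < R" "y < R" using assms by (auto simp: a)
  have "real (s i) * real (s j) * sum_list (map e (tests a \<sigma> i j))
      = (if i = x then if j = x then real (s x) * real (s x) * e (LAcc \<sigma>) else 0 else 0)
      + (if i = y then if j = y then real (s y) * real (s y) * e (LAcc \<sigma>) else 0 else 0)
      + (if i = x then if j = y then real (s x) * real (s y) * e (WAcc \<sigma>) else 0 else 0)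
      + (if i = y then if j = x then real (s y) * real (s x) * e (WAcc \<sigma>) else 0 else 0)" for i j
    using xy by (auto simp: a)
  then show ?thesis using R xy
    by (simp add: sum.distrib sum_sum_delta) (simp add: a algebra_simps)
next
  case False
  then have "tests a \<sigma> i j = ([] :: 'a mst list)" "errw a s = 0" "errl a s = 0" for i j
    by (cases a; auto)+
  then show ?thesis by simp
qed

lemma length_moves: "length (moves a i) \<le> 2"
  by (cases a) auto

text \<open>Two walkers with at most two moves each just fit into four outcomes; a test needs at
  most two.\<close>

lemma length_outs: "length (outs es cf q a) \<le> 4"
proof (cases q)
  case (Walk \<sigma> i j)
  show ?thesis
  proof (cases "letter_act es a")
    case (Tst x y)
    then show ?thesis by (auto simp: Walk)
  next
    case (Add x y)
    have "length (moves (Add x y) i) * length (moves (Add x y) j) \<le> 2 * 2"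
      by (intro mult_mono length_moves) auto
    then show ?thesis by (auto simp: Walk Add)
  qed (auto simp: Walk)
qed auto

text \<open>Integral of \<open>e\<close> over the walkers and accounts of one side, with the common
  probability factor 4^-n removed, so that all weights are natural numbers.\<close>

definition mass :: "nat \<Rightarrow> bool \<Rightarrow> ('c mst \<Rightarrow> real) \<Rightarrow> (nat \<Rightarrow> nat) \<Rightarrow> nat \<Rightarrow> nat \<Rightarrow> real" where
  "mass R \<sigma> e s aw al = (\<Sum>i<R. \<Sum>j<R. real (s i) * real (s j) * e (Walk \<sigma> i j))
     + real aw * e (WAcc \<sigma>) + real al * e (LAcc \<sigma>)"

definition init :: "nat \<Rightarrow> nat \<Rightarrow> nat" where
  "init n = (\<lambda>r. if r = 0 then 1 else if r = 1 then n else 0)"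

text \<open>The states that spend two letters on one choice among four outcomes.\<close>

fun is_macro :: "'c mst \<Rightarrow> bool" where
  "is_macro (Mid x y) = False"
| "is_macro (Chain i) = False"
| "is_macro Launch = False"
| "is_macro Dead = False"
| "is_macro _ = True"

section \<open>Expected payoffs, letter by letter\<close>

locale machine =
  fixes es :: "('c \<times> act \<times> 'c) list" and cs cf :: 'c and m R :: nat
  assumes R: "2 \<le> R" and regs_es: "\<And>c a c'. (c, a, c') \<in> set es \<Longrightarrow> regs a \<subseteq> {..<R}"
begin

abbreviation "\<delta> \<equiv> delta es cs cf m"
abbreviation "k0 \<equiv> length es + 2"
abbreviation "act \<equiv> letter_act es"

text \<open>With payoffs only at the two events, weights evolve linearly throughout an execution,
  whatever the payoff.\<close>

definition proper :: "('c mst \<Rightarrow> real option) \<Rightarrow> bool" where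
  "proper stop \<longleftrightarrow> (\<forall>q. q \<noteq> EvL \<and> q \<noteq> EvW \<longrightarrow> stop q = None)"

lemma properD: "proper stop \<Longrightarrow> q \<noteq> EvL \<Longrightarrow> q \<noteq> EvW \<Longrightarrow> stop q = None"
  unfolding proper_def by blast

lemma regs_act: "2 \<le> a \<Longrightarrow> regs (act a) \<subseteq> {..<R}"
proof (cases "a < k0")
  case True
  assume "2 \<le> a"
  then have "es ! (a - 2) \<in> set es" using True by simp
  then show ?thesis using regs_es True by (metis letter_act_def prod.collapse)
qed (use R in \<open>auto simp: letter_act_def\<close>)

text \<open>The second letter \<open>a'\<close> is arbitrary: only the first one is looked at here,
  so a word that does not double its letters gains nothing from these states.\<close>

lemma macro_ev:
  assumes "proper stop" "is_macro q" "stop q = None"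
  shows "ev \<delta> stop f q (a # a' # v) = (sum_list (map (\<lambda>o'. ev \<delta> stop f o' v) (outs es cf q a))
    + (4 - real (length (outs es cf q a))) * ev \<delta> stop f Dead v) / 4"
proof -
  define l where "l = outs es cf q a"
  have \<delta>: "\<delta> q a b = (if b then Mid ((l @ replicate 4 Dead) ! 2) ((l @ replicate 4 Dead) ! 3)
      else Mid ((l @ replicate 4 Dead) ! 0) ((l @ replicate 4 Dead) ! 1))" for b
    using assms(2) by (cases q) (simp_all add: l_def Let_def del: outs.simps)
  have stop: "stop (Mid x y) = None" for x y using assms(1) by (auto intro: properD)
  have "length l \<le> 4" unfolding l_def by (rule length_outs)
  then consider "l = []" | x where "l = [x]" | x y where "l = [x, y]" | x y z where "l = [x, y, z]"
    | x y z w where "l = [x, y, z, w]"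
    by (cases l; cases "tl l"; cases "tl (tl l)"; cases "tl (tl (tl l))"; cases "tl (tl (tl (tl l)))") auto
  then show ?thesis
    unfolding l_def[symmetric]
    by cases (simp_all add: \<delta> stop assms(3) numeral_2_eq_2 numeral_3_eq_3 algebra_simps
      eval_nat_numeral add_divide_distrib)
qed

lemma mass_macro:
  assumes "proper stop"
  shows "mass R \<sigma> (\<lambda>q. ev \<delta> stop f q (a # a' # v)) s aw al
    = mass R \<sigma> (\<lambda>q. (sum_list (map (\<lambda>o'. ev \<delta> stop f o' v) (outs es cf q a))
    + (4 - real (length (outs es cf q a))) * ev \<delta> stop f Dead v) / 4) s aw al"
proof -
  have "stop (Walk \<sigma> i j) = None" "stop (WAcc \<sigma>) = None" "stop (LAcc \<sigma>) = None" for i j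
    using assms by (auto intro: properD)
  then show ?thesis unfolding mass_def by (simp only: macro_ev[OF assms] is_macro.simps simp_thms)
qed

definition deadw :: "bool \<Rightarrow> nat \<Rightarrow> (nat \<Rightarrow> nat) \<Rightarrow> nat \<Rightarrow> nat \<Rightarrow> real" where
  "deadw \<sigma> a s aw al = mass R \<sigma> (\<lambda>q. 4 - real (length (outs es cf q a))) s aw al"

lemma deadw_nonneg: "0 \<le> deadw \<sigma> a s aw al"
  unfolding deadw_def mass_def using length_outs[of es cf _ a]
  by (intro add_nonneg_nonneg sum_nonneg mult_nonneg_nonneg) (auto simp del: outs.simps simp: of_nat_le_iff[of _ 4, simplified])

text \<open>The identity holds whether or not the test passes; only the accounts tell the
  difference. The factor 4 and the new weights are the same for both sides, which keeps the sides
  comparable.\<close>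

lemma mass_step:
  assumes "proper stop" "2 \<le> a"
  shows "mass R \<sigma> (\<lambda>q. ev \<delta> stop f q (a # a' # v)) s aw al
    = (mass R \<sigma> (\<lambda>q. ev \<delta> stop f q v) (upd (act a) s) (aw + errw (act a) s) (al + errl (act a) s)
      + deadw \<sigma> a s aw al * ev \<delta> stop f Dead v) / 4"
proof -
  define e where "e q = ev \<delta> stop f q v" for q
  have "mass R \<sigma> (\<lambda>q. sum_list (map e (outs es cf q a))) s aw al
    = (\<Sum>i<R. \<Sum>j<R. real (s i) * real (s j) * sum_list (map (\<lambda>(x, y). e (Walk \<sigma> x y)) (List.product (moves (act a) i) (moves (act a) j))))
    + (\<Sum>i<R. \<Sum>j<R. real (s i) * real (s j) * sum_list (map e (tests (act a) \<sigma> i j)))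
    + real aw * e (WAcc \<sigma>) + real al * e (LAcc \<sigma>)"
    using assms(2) unfolding mass_def
    by (simp add: comp_def case_prod_unfold algebra_simps sum.distrib)
  also have "\<dots> = mass R \<sigma> e (upd (act a) s) (aw + errw (act a) s) (al + errl (act a) s)"
    unfolding moves_sum2[OF regs_act[OF assms(2)]] tests_sum[OF regs_act[OF assms(2)]]
    by (simp add: mass_def algebra_simps)
  finally have "mass R \<sigma> (\<lambda>q. sum_list (map e (outs es cf q a))) s aw al = \<dots>" .
  moreover have "mass R \<sigma> (\<lambda>q. (sum_list (map e (outs es cf q a))
    + (4 - real (length (outs es cf q a))) * e Dead) / 4) s aw al
    = (mass R \<sigma> (\<lambda>q. sum_list (map e (outs es cf q a))) s aw al + deadw \<sigma> a s aw al * e Dead) / 4"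
    unfolding mass_def deadw_def
    by (simp add: algebra_simps sum.distrib sum_distrib_left sum_divide_distrib sum_subtractf
         add_divide_distrib diff_divide_distrib del: outs.simps)
  ultimately show ?thesis unfolding mass_macro[OF assms(1)] e_def by simp
qed

end

declare ev.simps [simp del]

context machine
begin

text \<open>The checker with \<open>j\<close> increments still to be read. Chain positions count
  single letters, hence \<open>2 * j\<close>; with \<open>j = 0\<close> this is
  \<open>Ctl cs\<close>.\<close>

definition bstate :: "nat \<Rightarrow> 'c mst" where
  "bstate j = (if j = m + 1 then Launch else cst cs (2 * j))"

lemma bstate_Ctl: "Ctl c = bstate j \<Longrightarrow> j = 0"
  by (cases j) (auto simp: bstate_def split: if_splits)

definition valid :: bool where
  "valid \<longleftrightarrow> (\<exists>s. (cstep (set es))\<^sup>*\<^sup>* (cs, init (m + 1)) (cf, s))"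

lemma ev_Mid: "proper stop \<Longrightarrow> ev \<delta> stop f (Mid x y) (a # v) = (ev \<delta> stop f x v + ev \<delta> stop f y v) / 2"
  by (simp add: properD ev.simps)

lemma ev_Dead: "proper stop \<Longrightarrow> ev \<delta> stop f Dead (a # v) =
    (if a = 1 then ev \<delta> stop f (Mid Fresh Fresh) v else ev \<delta> stop f Dead v)"
  by (simp add: properD ev.simps)

lemma ev_Chain: "proper stop \<Longrightarrow> ev \<delta> stop f (Chain i) (a # v) =
    (if a = k0 then (ev \<delta> stop f (cst cs i) v + ev \<delta> stop f Dead v) / 2 else ev \<delta> stop f Dead v)"
  by (simp add: properD ev.simps)

lemma ev_Launch: "proper stop \<Longrightarrow> ev \<delta> stop f Launch (a # v) =
    (if a = k0 then (ev \<delta> stop f (cst cs (2 * m + 1)) v + ev \<delta> stop f Dead v) / 2 else ev \<delta> stop f Dead v)"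
  by (simp add: properD ev.simps)

lemma ev_bstate:
  assumes "proper stop" "1 \<le> j" "j \<le> m + 1"
  shows "ev \<delta> stop f (bstate j) (a # v) =
    (if a = k0 then (ev \<delta> stop f (Chain (2 * j - 2)) v + ev \<delta> stop f Dead v) / 2 else ev \<delta> stop f Dead v)"
proof (cases "j = m + 1")
  case True
  then show ?thesis by (simp add: bstate_def ev_Launch[OF assms(1)])
next
  case False
  obtain i where j: "j = Suc i" using assms(2) by (cases j) auto
  show ?thesis using False by (simp add: bstate_def j ev_Chain[OF assms(1)])
qed

text \<open>A doubled letter \<open>k0\<close> is survived with probability 1/4. Every deviation
  ends in \<open>Dead\<close>, possibly with the second letter still unread, whence the terms with
  \<open>a' # v\<close>.\<close>

lemma ev_bstate2:
  assumes "proper stop" "1 \<le> j" "j \<le> m + 1"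
  shows "ev \<delta> stop f (bstate j) (a # a' # v) =
    (if a = k0 then if a' = k0 then (ev \<delta> stop f (bstate (j - 1)) v + ev \<delta> stop f Dead v) / 4
        + ev \<delta> stop f Dead v / 2 else (ev \<delta> stop f Dead v + ev \<delta> stop f Dead (a' # v)) / 2
     else ev \<delta> stop f Dead (a' # v))"
proof -
  have "cst cs (2 * j - 2) = bstate (j - 1)"
    using assms(2,3) by (auto simp: bstate_def diff_mult_distrib2)
  then show ?thesis
    by (simp add: ev_bstate[OF assms] ev_Chain[OF assms(1)] ev_Dead[OF assms(1)])
qed

lemma Ctl_ev:
  assumes "proper stop"
  shows "ev \<delta> stop f (Ctl c) (a # a' # v) =
    (if a = 0 then if c = cf then ev \<delta> stop f (Init True) v else ev \<delta> stop f Dead v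
     else if a = 1 then ev \<delta> stop f Fresh v
     else if a < k0 \<and> fst (es ! (a - 2)) = c
       then (ev \<delta> stop f (Ctl (snd (snd (es ! (a - 2))))) v + 3 * ev \<delta> stop f Dead v) / 4
     else ev \<delta> stop f Dead v)"
  using assms by (subst macro_ev) (auto simp: properD eval_nat_numeral)

lemma Init_ev:
  assumes "proper stop"
  shows "ev \<delta> stop f (Init \<sigma>) (a # a' # v) =
    (if a = 1 then ev \<delta> stop f (if \<sigma> then EvW else EvL) v
     else if \<sigma> then (ev \<delta> stop f (Walk True 0 0) v + ev \<delta> stop f Launch v + 2 * ev \<delta> stop f Dead v) / 4
     else (ev \<delta> stop f (Walk False 0 0) v + 3 * ev \<delta> stop f Dead v) / 4)"
  using assms by (subst macro_ev) (auto simp: properD eval_nat_numeral)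

lemma fresh_ev:
  assumes "proper stop" "q \<in> {Fresh, EvL, EvW}" "stop q = None"
  shows "ev \<delta> stop f q (a # a' # v) = (ev \<delta> stop f (Init True) v + ev \<delta> stop f (Init False) v) / 2"
  using assms by (subst macro_ev) (auto simp: properD eval_nat_numeral)

lemma mass_0:
  assumes "proper stop"
  shows "mass R \<sigma> (\<lambda>q. ev \<delta> stop f q (0 # a' # v)) s aw al
   = (if \<sigma> then real aw * ev \<delta> stop f (Init True) v else real al * ev \<delta> stop f (Init False) v)
     + mass R \<sigma> (\<lambda>q :: 'c mst. 1) s (if \<sigma> then 0 else aw) (if \<sigma> then al else 0) * ev \<delta> stop f Dead v"
  unfolding mass_macro[OF assms]
  by (auto simp: mass_def eval_nat_numeral sum_distrib_left algebra_simps)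

lemma mass_1:
  assumes "proper stop"
  shows "mass R \<sigma> (\<lambda>q. ev \<delta> stop f q (Suc 0 # a' # v)) s aw al
   = mass R \<sigma> (\<lambda>q :: 'c mst. 1) s aw al * ev \<delta> stop f Fresh v"
  unfolding mass_macro[OF assms]
  by (auto simp: mass_def eval_nat_numeral sum_distrib_left algebra_simps)

lemma mass_one_nonneg: "0 \<le> mass R \<sigma> (\<lambda>q :: 'c mst. 1) s aw al"
  unfolding mass_def by (intro add_nonneg_nonneg sum_nonneg mult_nonneg_nonneg) auto

lemma mass_init: "mass R \<sigma> e (init 0) 0 0 = e (Walk \<sigma> 0 0)"
proof -
  have "(\<Sum>j<R. real (init 0 i) * real (init 0 j) * e (Walk \<sigma> i j)) =
      (\<Sum>j<R. if i = 0 then if j = 0 then e (Walk \<sigma> 0 0) else 0 else 0)" for i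
    by (intro sum.cong) (auto simp: init_def)
  then show ?thesis using R by (simp add: mass_def sum_sum_delta)
qed

section \<open>Without a correct execution, losses outweigh wins\<close>

definition sd :: "'c mst \<Rightarrow> real option" where
  "sd q = (if q = EvL then Some 1 else if q = EvW then Some (-1) else None)"

lemma proper_sd: "proper sd"
  by (auto simp: proper_def sd_def)

text \<open>The probability that the first event is a loss minus the probability that it is a
  win.\<close>

abbreviation d :: "nat list \<Rightarrow> 'c mst \<Rightarrow> real" where
  "d v q \<equiv> ev \<delta> sd (\<lambda>_. 0) q v"

text \<open>The situations in which the checker can be alive with weight 1 beside the walkers. Equal
  accounts mean that no test has failed so far, and then the checker has followed a genuine path; at
  \<open>Ctl cf\<close> this would give \<open>valid\<close>.\<close>

definition good :: "(nat \<Rightarrow> nat) \<Rightarrow> nat \<Rightarrow> nat \<Rightarrow> 'c mst \<Rightarrow> bool" where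
  "good s aw al q \<longleftrightarrow> aw \<le> al \<and>
     ((\<exists>j. 1 \<le> j \<and> j \<le> m + 1 \<and> q = bstate j \<and> s = init (m + 1 - j) \<and> aw = al) \<or>
      (\<exists>c. q = Ctl c \<and> (aw = al \<longrightarrow> (cstep (set es))\<^sup>*\<^sup>* (cs, init (m + 1)) (c, s))))"

text \<open>States from which no win is reached before a loss or \<open>Fresh\<close>.\<close>

fun lside :: "'c mst \<Rightarrow> bool" where
  "lside Dead = True" | "lside Fresh = True" | "lside (Mid x y) \<longleftrightarrow> x = Fresh \<and> y = Fresh"
| "lside EvL = True" | "lside (Init \<sigma>) \<longleftrightarrow> \<not> \<sigma>" | "lside (Walk \<sigma> i j) \<longleftrightarrow> \<not> \<sigma>"
| "lside (WAcc \<sigma>) \<longleftrightarrow> \<not> \<sigma>" | "lside (LAcc \<sigma>) \<longleftrightarrow> \<not> \<sigma>" | "lside _ = False"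

lemma delta_no_event: "\<nexists>x y. q = Mid x y \<Longrightarrow> \<delta> q a b \<noteq> EvL \<and> \<delta> q a b \<noteq> EvW"
proof (cases q)
  case (Chain i)
  then show ?thesis by (cases i) auto
qed (auto simp: Let_def simp del: outs.simps)

text \<open>Events are entered from \<open>Mid\<close> states only, so any other state is at least
  two letters away from one.\<close>

lemma d_short:
  assumes "length v \<le> 1" "q \<noteq> EvL" "q \<noteq> EvW" "\<nexists>x y. q = Mid x y"
  shows "d v q = 0"
proof (cases v)
  case (Cons a v')
  then have "v' = []" using assms(1) by simp
  then show ?thesis using delta_no_event[OF assms(4)] assms(2,3) by (simp add: Cons sd_def ev.simps)
qed (use assms in \<open>simp add: sd_def ev.simps\<close>)

lemma lside_tests: "o' \<in> set (tests a False i j) \<Longrightarrow> lside o'"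
  by (cases a) (auto split: if_splits)

lemma lside_outs:
  "lside q \<Longrightarrow> is_macro q \<Longrightarrow> q \<noteq> EvL \<Longrightarrow> q \<noteq> Fresh \<Longrightarrow> \<forall>o'\<in>set (outs es cf q a). lside o'"
  by (cases q) (auto dest: lside_tests)

text \<open>Either the checker hands a quarter of its weight to another good situation, where
  \<open>gd\<close> applies, or its whole weight goes to states of nonnegative value, and
  \<open>no\<close> settles the rest.\<close>

lemma good_step:
  assumes "good s aw al q" "2 \<le> a" "0 \<le> d v Dead" "0 \<le> d (a' # v) Dead"
    and no: "\<forall>s aw al. aw \<le> al \<longrightarrow> 0 \<le> mass R True (d v) s aw al + mass R False (d v) s aw al"
    and gd: "\<forall>s aw al q. good s aw al q \<longrightarrow> 0 \<le> mass R True (d v) s aw al + mass R False (d v) s aw al + d v q"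
  shows "0 \<le> mass R True (d (a # a' # v)) s aw al + mass R False (d (a # a' # v)) s aw al + d (a # a' # v) q"
proof -
  define s' aw' al' where "s' = upd (act a) s" "aw' = aw + errw (act a) s" "al' = al + errl (act a) s"
  note new = s'_aw'_al'_def
  have le: "aw' \<le> al'" using assms(1) errw_le_errl[of "act a" s] by (auto simp: new good_def)
  define D where "D = (deadw True a s aw al + deadw False a s aw al) * d v Dead"
  have D: "0 \<le> D" using deadw_nonneg[of True] deadw_nonneg[of False] assms(3) by (simp add: D_def)
  have eq: "mass R True (d (a # a' # v)) s aw al + mass R False (d (a # a' # v)) s aw al
    = (mass R True (d v) s' aw' al' + mass R False (d v) s' aw' al' + D) / 4"
    unfolding mass_step[OF proper_sd assms(2)] new D_def by (simp add: algebra_simps add_divide_distrib)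
  have "(\<exists>q'. good s' aw' al' q' \<and> d v q' / 4 \<le> d (a # a' # v) q) \<or> 0 \<le> d (a # a' # v) q"
  proof -
    from assms(1) consider (chain) j where "1 \<le> j" "j \<le> m + 1" "q = bstate j" "s = init (m + 1 - j)" "aw = al"
      | (ctl) c where "q = Ctl c" "aw = al \<longrightarrow> (cstep (set es))\<^sup>*\<^sup>* (cs, init (m + 1)) (c, s)"
      unfolding good_def by blast
    then show ?thesis
    proof cases
      case chain
      show ?thesis
      proof (cases "a = k0 \<and> a' = k0")
        case True
        have act: "act a = Add 1 0" using True by (simp add: letter_act_def)
        have s': "s' = init (m + 1 - (j - 1))" using chain(1,2,4)
          by (auto simp: new(1) act init_def fun_eq_iff)
        have aw': "aw' = al'" using chain(5) by (simp add: new act)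
        have "good s' aw' al' (bstate (j - 1))"
        proof (cases "j = 1")
          case True
          then show ?thesis using s' aw' by (auto simp: good_def bstate_def)
        next
          case False
          then have "1 \<le> j - 1 \<and> j - 1 \<le> m + 1" using chain(1,2) by auto
          then show ?thesis using s' aw' unfolding good_def by blast
        qed
        moreover have "d v (bstate (j - 1)) / 4 \<le> d (a # a' # v) q"
          using True assms(3) unfolding chain(3) ev_bstate2[OF proper_sd chain(1,2)]
          by (simp add: add_divide_distrib)
        ultimately show ?thesis by blast
      next
        case False
        then have "0 \<le> d (a # a' # v) q"
          using assms(3,4) unfolding chain(3) ev_bstate2[OF proper_sd chain(1,2)] by auto
        then show ?thesis by blast
      qed
    next
      case ctl
      show ?thesis
      proof (cases "a < k0 \<and> fst (es ! (a - 2)) = c")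
        case True
        define c' where "c' = snd (snd (es ! (a - 2)))"
        have "a - 2 < length es" using True assms(2) by linarith
        then have "es ! (a - 2) \<in> set es" by simp
        moreover have "es ! (a - 2) = (c, act a, c')"
          using True by (auto simp: c'_def letter_act_def prod_eq_iff)
        ultimately have E: "(c, act a, c') \<in> set es" by simp
        have "good s' aw' al' (Ctl c')"
        proof -
          have "(cstep (set es))\<^sup>*\<^sup>* (cs, init (m + 1)) (c', s')" if "aw' = al'"
          proof -
            have "aw = al" "errw (act a) s = errl (act a) s"
              using that errw_le_errl[of "act a" s] assms(1) by (auto simp: new good_def)
            then have "(cstep (set es))\<^sup>*\<^sup>* (cs, init (m + 1)) (c, s)" "passes (act a) s"
              using ctl(2) errw_eq_errl by auto
            with cstepI[OF E] show ?thesis by (auto simp: new intro: rtranclp.rtrancl_into_rtrancl)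
          qed
          with le show ?thesis unfolding good_def by blast
        qed
        moreover have "d v (Ctl c') / 4 \<le> d (a # a' # v) q"
          using True assms(2,3) unfolding ctl(1) Ctl_ev[OF proper_sd] c'_def by simp
        ultimately show ?thesis by blast
      next
        case False
        then have "0 \<le> d (a # a' # v) q"
          using assms(2,3) unfolding ctl(1) Ctl_ev[OF proper_sd] by auto
        then show ?thesis by blast
      qed
    qed
  qed
  then show ?thesis
  proof
    assume "\<exists>q'. good s' aw' al' q' \<and> d v q' / 4 \<le> d (a # a' # v) q"
    then obtain q' where q': "good s' aw' al' q'" "d v q' / 4 \<le> d (a # a' # v) q" by blast
    from gd q'(1) have "0 \<le> mass R True (d v) s' aw' al' + mass R False (d v) s' aw' al' + d v q'"
      by blast
    with q'(2) D show ?thesis unfolding eq add_divide_distrib by linarith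
  next
    assume "0 \<le> d (a # a' # v) q"
    moreover from no le have "0 \<le> mass R True (d v) s' aw' al' + mass R False (d v) s' aw' al'"
      by blast
    ultimately show ?thesis unfolding eq add_divide_distrib using D by linarith
  qed
qed

lemma d_mass_0:
  "mass R True (d (0 # a' # v)) s aw al
   = real aw * d v (Init True) + mass R True (\<lambda>q :: 'c mst. 1) s 0 al * d v Dead"
  "mass R False (d (0 # a' # v)) s aw al
   = real al * d v (Init False) + mass R False (\<lambda>q :: 'c mst. 1) s aw 0 * d v Dead"
  by (subst mass_0[OF proper_sd]; simp)+

lemma d_mass_1:
  "mass R \<sigma> (d (Suc 0 # a' # v)) s aw al = mass R \<sigma> (\<lambda>q :: 'c mst. 1) s aw al * d v Fresh"
  by (subst mass_1[OF proper_sd]; simp)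

text \<open>\<open>d v (Init True)\<close> alone may be negative; it is balanced by at least as much
  weight on \<open>Init False\<close>. The claims about masses carry this balance through an
  execution, without and with the checker. The induction is on the length, since \<open>Dead\<close>
  and the chain can get out of step with the letter pairs.\<close>

lemma not_valid_balance:
  assumes "\<not> valid"
  shows "(\<forall>q. lside q \<longrightarrow> 0 \<le> d v q) \<and> 0 \<le> d v (Init True) + d v (Init False) \<and>
    (\<forall>s aw al. aw \<le> al \<longrightarrow> 0 \<le> mass R True (d v) s aw al + mass R False (d v) s aw al) \<and>
    (\<forall>s aw al q. good s aw al q \<longrightarrow> 0 \<le> mass R True (d v) s aw al + mass R False (d v) s aw al + d v q)"
proof (induction v rule: length_induct)
  case (1 v)
  show ?case
  proof (cases "length v \<le> 1")
    case True
    have EvL: "d v EvL = 1" by (cases v) (auto simp: sd_def ev.simps)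
    have Mid: "d v (Mid Fresh Fresh) = 0"
      using True by (cases v) (auto simp: sd_def ev.simps)
    have bst: "bstate j \<noteq> EvL \<and> bstate j \<noteq> EvW \<and> (\<nexists>x y. bstate j = Mid x y)" for j
      by (cases "2 * j") (auto simp: bstate_def)
    have z: "d v q = 0" if "q \<noteq> EvL" "q \<noteq> EvW" "\<nexists>x y. q = Mid x y" for q
      using d_short True that by blast
    have "mass R \<sigma> (d v) s aw al = 0" for \<sigma> s aw al
      by (simp add: mass_def z)
    moreover have "0 \<le> d v q" if "lside q" for q
      using that EvL Mid z by (cases q) auto
    moreover have "d v q = 0" if "good s aw al q" for s aw al q
      using that bst z unfolding good_def by blast
    ultimately show ?thesis by (simp add: z)
  next
    case False
    then obtain a a' v' where v: "v = a # a' # v'"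
      by (cases v; cases "tl v") auto
    have IH: "\<forall>q. lside q \<longrightarrow> 0 \<le> d v' q" "0 \<le> d v' (Init True) + d v' (Init False)"
      "\<forall>s aw al. aw \<le> al \<longrightarrow> 0 \<le> mass R True (d v') s aw al + mass R False (d v') s aw al"
      "\<forall>s aw al q. good s aw al q \<longrightarrow> 0 \<le> mass R True (d v') s aw al + mass R False (d v') s aw al + d v' q"
      and IH2: "\<forall>q. lside q \<longrightarrow> 0 \<le> d (a' # v') q"
      using 1 v by auto
    have EvL: "d u EvL = 1" "d u EvW = -1" for u by (cases u; simp add: sd_def ev.simps)+
    have F: "0 \<le> d v' Fresh" "0 \<le> d v' Dead" "0 \<le> d v' (Init False)" "0 \<le> d (a' # v') Dead"
      using IH(1) IH2 by auto
    have ls: "0 \<le> d v q" if q: "lside q" for q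
    proof -
      consider "q = Dead" | "q = Fresh" | "q = Mid Fresh Fresh" | "q = EvL"
        | "is_macro q" "q \<noteq> EvL" "q \<noteq> Fresh"
        using q by (cases q) auto
      then show ?thesis
      proof cases
        case 5
        have "stop q = None" if "proper stop" for stop
          using q that 5 by (cases q) (auto intro: properD)
        then have "sd q = None" using proper_sd by blast
        moreover have "0 \<le> sum_list (map (\<lambda>o'. d v' o') (outs es cf q a))"
          using lside_outs[OF q 5] IH(1) by (intro sum_list_nonneg) auto
        moreover have "0 \<le> (4 - real (length (outs es cf q a))) * d v' Dead"
          using length_outs[of es cf q a] F by (intro mult_nonneg_nonneg) auto
        ultimately show ?thesis
          unfolding v macro_ev[OF proper_sd 5(1) \<open>sd q = None\<close>]
          by (intro divide_nonneg_pos add_nonneg_nonneg) auto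
      next
        case 1
        show ?thesis unfolding v 1 by (subst ev_Dead[OF proper_sd]) (use IH2 in auto)
      next
        case 2
        have "sd q = None" "q \<in> {Fresh, EvL, EvW}" by (simp_all add: 2 sd_def)
        then show ?thesis unfolding v using fresh_ev[OF proper_sd] IH(2) by (metis divide_nonneg_pos zero_less_numeral)
      next
        case 3
        show ?thesis unfolding v 3 ev_Mid[OF proper_sd] using IH2 by auto
      next
        case 4
        then show ?thesis using EvL by simp
      qed
    qed
    have mass: "0 \<le> mass R True (d v) s aw al + mass R False (d v) s aw al" if "aw \<le> al" for s aw al
    proof -
      consider "a = 0" | "a = Suc 0" | "2 \<le> a" by linarith
      then show ?thesis
      proof cases
        case 1
        \<comment> \<open>The \<open>aw\<close> units on both sides balance each other, and the
          surplus \<open>al - aw\<close> sits on the losing side.\<close>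
        have "0 \<le> real aw * (d v' (Init True) + d v' (Init False)) + real (al - aw) * d v' (Init False)"
          by (intro add_nonneg_nonneg[OF mult_nonneg_nonneg[OF _ IH(2)] mult_nonneg_nonneg[OF _ F(3)]]) auto
        then have "0 \<le> real aw * d v' (Init True) + real al * d v' (Init False)"
          using that by (simp add: of_nat_diff algebra_simps)
        moreover have "0 \<le> mass R True (\<lambda>q :: 'c mst. 1) s 0 al * d v' Dead" "0 \<le> mass R False (\<lambda>q :: 'c mst. 1) s aw 0 * d v' Dead"
          by (auto intro!: mult_nonneg_nonneg mass_one_nonneg F)
        ultimately show ?thesis
          unfolding v 1 d_mass_0 by linarith
      next
        case 2
        show ?thesis unfolding v 2 d_mass_1
          using mass_one_nonneg F by (intro add_nonneg_nonneg mult_nonneg_nonneg) auto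
      next
        case 3
        have "0 \<le> deadw True a s aw al * d v' Dead" "0 \<le> deadw False a s aw al * d v' Dead"
          by (auto intro!: mult_nonneg_nonneg deadw_nonneg F)
        moreover have "0 \<le> mass R True (d v') (upd (act a) s) (aw + errw (act a) s) (al + errl (act a) s)
          + mass R False (d v') (upd (act a) s) (aw + errw (act a) s) (al + errl (act a) s)"
          using IH(3) that errw_le_errl[of "act a" s] by (simp add: add_mono)
        ultimately show ?thesis unfolding v mass_step[OF proper_sd 3] add_divide_distrib
          by linarith
      qed
    qed
    have gd: "0 \<le> mass R True (d v) s aw al + mass R False (d v) s aw al + d v q" if g: "good s aw al q" for s aw al q
    proof (cases "2 \<le> a")
      case True
      show ?thesis unfolding v by (rule good_step[OF g True F(2,4) IH(3,4)])
    next
      case False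
      have le: "aw \<le> al" using g by (simp add: good_def)
      have "0 \<le> d v q \<or> (a = 0 \<and> q = Ctl cf)"
      proof -
        from g consider (chain) j where "1 \<le> j" "j \<le> m + 1" "q = bstate j" | (ctl) c where "q = Ctl c"
          unfolding good_def by blast
        then show ?thesis
        proof cases
          case chain
          have "a \<noteq> k0" using False by simp
          then show ?thesis unfolding v chain(3) ev_bstate2[OF proper_sd chain(1,2)] using F by simp
        next
          case ctl
          show ?thesis unfolding v ctl Ctl_ev[OF proper_sd] using F False by auto
        qed
      qed
      then show ?thesis
      proof
        assume "0 \<le> d v q"
        with mass[OF le] show ?thesis by (simp add: add_nonneg_nonneg)
      next
        assume *: "a = 0 \<and> q = Ctl cf"
        have "aw \<noteq> al"
        proof
          assume "aw = al"
          then have "valid" using g * unfolding good_def valid_def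
            by (auto dest: bstate_Ctl)
          with assms show False by simp
        qed
        \<comment> \<open>Integrality: a strict deficit is at least one unit and so pays for the
          unit of the checker.\<close>
        with le have lt: "Suc aw \<le> al" by simp
        have "0 \<le> real (Suc aw) * (d v' (Init True) + d v' (Init False)) + real (al - Suc aw) * d v' (Init False)"
          by (intro add_nonneg_nonneg[OF mult_nonneg_nonneg[OF _ IH(2)] mult_nonneg_nonneg[OF _ F(3)]]) auto
        then have "0 \<le> real (Suc aw) * d v' (Init True) + real al * d v' (Init False)"
          using lt by (simp add: of_nat_diff algebra_simps)
        moreover have "0 \<le> mass R True (\<lambda>q :: 'c mst. 1) s 0 al * d v' Dead" "0 \<le> mass R False (\<lambda>q :: 'c mst. 1) s aw 0 * d v' Dead"
          by (auto intro!: mult_nonneg_nonneg mass_one_nonneg F)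
        moreover have "d v q = d v' (Init True)" using * unfolding v by (simp add: Ctl_ev[OF proper_sd])
        ultimately show ?thesis
          using * unfolding v by (simp add: d_mass_0 algebra_simps)
      qed
    qed
    have "0 \<le> d v (Init True) + d v (Init False)"
    proof (cases "a = 1")
      case True
      then show ?thesis unfolding v Init_ev[OF proper_sd] by (simp add: EvL)
    next
      case False
      \<comment> \<open>Starting an execution on both sides amounts to the weights of
        \<open>init 0\<close>, empty accounts, and the checker at \<open>Launch\<close> with all
        \<open>m + 1\<close> increments ahead.\<close>
      have "good (init 0) 0 0 Launch" by (auto simp: good_def bstate_def intro!: exI[of _ "m + 1"])
      then have "0 \<le> d v' (Walk True 0 0) + d v' (Walk False 0 0) + d v' Launch"
        using IH(4) mass_init by metis
      then show ?thesis using False F unfolding v Init_ev[OF proper_sd] by (simp add: add_divide_distrib)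
    qed
    with ls mass gd show ?thesis by blast
  qed
qed

section \<open>Words that spell a correct execution\<close>

definition history :: "nat list \<Rightarrow> (nat \<Rightarrow> nat) \<Rightarrow> nat \<Rightarrow> 'c mst \<Rightarrow> bool" where
  "history u s x q \<longleftrightarrow> set u \<subseteq> {0..k0} - {1} \<and> (\<exists>n dd. (\<forall>\<sigma>. 0 \<le> dd \<sigma>) \<and> (\<forall>\<sigma> stop f v. proper stop \<longrightarrow>
     ev \<delta> stop f (Init \<sigma>) (u @ v) = (mass R \<sigma> (\<lambda>q. ev \<delta> stop f q v) s x x
       + of_bool \<sigma> * ev \<delta> stop f q v) / 4 ^ n + dd \<sigma> * ev \<delta> stop f Dead v))"

text \<open>Any letter other than 1 starts an execution. The constants 1/2 and 3/4 are the shares of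
  the idle outcomes, two of four on side \<open>True\<close> and three of four on side
  \<open>False\<close>.\<close>

lemma history_start: "history [0, 0] (init 0) 0 Launch"
  unfolding history_def
proof (intro conjI exI allI impI)
  fix \<sigma> stop f v assume "proper stop"
  then show "ev \<delta> stop f (Init \<sigma>) ([0, 0] @ v) = (mass R \<sigma> (\<lambda>q. ev \<delta> stop f q v) (init 0) 0 0
       + of_bool \<sigma> * ev \<delta> stop f Launch v) / 4 ^ 1 + (if \<sigma> then 1 / 2 else 3 / 4) * ev \<delta> stop f Dead v"
    by (simp add: Init_ev mass_init add_divide_distrib)
qed auto

text \<open>A passed test adds the same amount to both accounts, so one number \<open>x\<close>
  describes them; the checker adds its unit on side \<open>True\<close> only. The letter is doubled
  for the sake of the chain.\<close>

lemma history_step: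
  assumes "history u s x q" "2 \<le> a" "a \<le> k0" "passes (act a) s"
    and q: "\<And>stop f v. proper stop \<Longrightarrow> ev \<delta> stop f q (a # a # v)
       = (ev \<delta> stop f q' v + 3 * ev \<delta> stop f Dead v) / 4"
  shows "history (u @ [a, a]) (upd (act a) s) (x + errw (act a) s) q'"
proof -
  from assms(1) obtain n dd where u: "set u \<subseteq> {0..k0} - {1}" and dd: "\<forall>\<sigma>. 0 \<le> dd \<sigma>"
    and eq: "\<And>\<sigma> stop f v. proper stop \<Longrightarrow>
     ev \<delta> stop f (Init \<sigma>) (u @ v) = (mass R \<sigma> (\<lambda>q. ev \<delta> stop f q v) s x x
       + of_bool \<sigma> * ev \<delta> stop f q v) / 4 ^ n + dd \<sigma> * ev \<delta> stop f Dead v"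
    unfolding history_def by blast
  define dd' where "dd' \<sigma> = (deadw \<sigma> a s x x + of_bool \<sigma> * 3) / 4 ^ Suc n + dd \<sigma>" for \<sigma>
  have dead: "ev \<delta> stop f Dead (a # a # v) = ev \<delta> stop f Dead v" if "proper stop" for stop f v
    using assms(2) by (simp add: ev_Dead[OF that])
  have err: "errl (act a) s = errw (act a) s" using assms(4) errw_eq_errl by metis
  show ?thesis
    unfolding history_def
  proof (intro conjI exI[of _ "Suc n"] exI[of _ dd'] allI impI)
    show "set (u @ [a, a]) \<subseteq> {0..k0} - {1}" using u assms(2,3) by auto
    show "0 \<le> dd' \<sigma>" for \<sigma>
      unfolding dd'_def using dd deadw_nonneg by (intro add_nonneg_nonneg divide_nonneg_pos) auto
    fix \<sigma> stop f v assume p: "proper stop"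
    show "ev \<delta> stop f (Init \<sigma>) ((u @ [a, a]) @ v) = (mass R \<sigma> (\<lambda>q. ev \<delta> stop f q v) (upd (act a) s)
        (x + errw (act a) s) (x + errw (act a) s) + of_bool \<sigma> * ev \<delta> stop f q' v) / 4 ^ Suc n
        + dd' \<sigma> * ev \<delta> stop f Dead v"
      by (simp add: eq[OF p] mass_step[OF p assms(2)] q[OF p] dead[OF p] err dd'_def add_divide_distrib algebra_simps)
  qed
qed

lemma history_chain:
  assumes "j \<le> m + 1"
  shows "\<exists>u. history u (init j) 0 (bstate (m + 1 - j))"
  using assms
proof (induction j)
  case 0
  have "bstate (m + 1 - 0) = Launch" by (simp add: bstate_def)
  with history_start show ?case by metis
next
  case (Suc j)
  then obtain u where u: "history u (init j) 0 (bstate (m + 1 - j))" by auto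
  have act: "act k0 = Add 1 0" by (simp add: letter_act_def)
  have j: "1 \<le> m + 1 - j" "m + 1 - j \<le> m + 1" using Suc.prems by auto
  have "history (u @ [k0, k0]) (upd (act k0) (init j)) (0 + errw (act k0) (init j)) (bstate (m + 1 - j - 1))"
  proof (rule history_step[OF u])
    show "passes (act k0) (init j)" by (simp only: act passes.simps)
    show "ev \<delta> stop f (bstate (m + 1 - j)) (k0 # k0 # v)
       = (ev \<delta> stop f (bstate (m + 1 - j - 1)) v + 3 * ev \<delta> stop f Dead v) / 4" if "proper stop" for stop f v
      by (subst ev_bstate2[OF that j]) (simp add: add_divide_distrib)
  qed auto
  moreover have "upd (act k0) (init j) = init (Suc j)" "errw (act k0) (init j) = 0"
    unfolding act by (auto simp: init_def fun_eq_iff)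
  moreover have "m + 1 - j - 1 = m + 1 - Suc j" by simp
  ultimately show ?case by (metis add_0)
qed

lemma history_path:
  assumes "(cstep (set es))\<^sup>*\<^sup>* (cs, init (m + 1)) z"
  shows "\<exists>u x. history u (snd z) x (Ctl (fst z))"
  using assms
proof (induction rule: rtranclp_induct)
  case base
  have "bstate (m + 1 - (m + 1)) = Ctl cs" by (simp add: bstate_def)
  with history_chain[of "m + 1"] show ?case by auto
next
  case (step y z)
  then obtain u x where u: "history u (snd y) x (Ctl (fst y))" by blast
  from step(2) obtain b where b: "(fst y, b, fst z) \<in> set es" "passes b (snd y)" "snd z = upd b (snd y)"
    unfolding cstep_def by blast
  from b(1) obtain i where i: "i < length es" "es ! i = (fst y, b, fst z)"
    by (auto simp: in_set_conv_nth)
  have act: "act (i + 2) = b" using i by (simp add: letter_act_def)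
  have "history (u @ [i + 2, i + 2]) (upd (act (i + 2)) (snd y)) (x + errw (act (i + 2)) (snd y)) (Ctl (fst z))"
  proof (rule history_step[OF u])
    show "passes (act (i + 2)) (snd y)" unfolding act by (rule b(2))
  qed (use i in \<open>simp_all add: Ctl_ev\<close>)
  then show ?case unfolding act b(3)[symmetric] by blast
qed

text \<open>The values are \<open>g = (x + 1) / 4 ^ n\<close> and \<open>b = x / 4 ^ n\<close>: the
  whole advantage is the unit of the checker.\<close>

lemma valid_history:
  assumes "valid"
  obtains h g b where "set h \<subseteq> {0..k0} - {1}" "0 \<le> b" "b < g" "g \<le> 1"
    "\<And>stop f v. proper stop \<Longrightarrow>
       ev \<delta> stop f (Init True) (h @ v) = g * ev \<delta> stop f (Init True) v + (1 - g) * ev \<delta> stop f Dead v"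
    "\<And>stop f v. proper stop \<Longrightarrow>
       ev \<delta> stop f (Init False) (h @ v) = b * ev \<delta> stop f (Init False) v + (1 - b) * ev \<delta> stop f Dead v"
proof -
  from assms obtain s where "(cstep (set es))\<^sup>*\<^sup>* (cs, init (m + 1)) (cf, s)" unfolding valid_def by blast
  from history_path[OF this] obtain u x where "history u s x (Ctl cf)" by auto
  then obtain n dd where u: "set u \<subseteq> {0..k0} - {1}" and dd: "\<forall>\<sigma>. 0 \<le> dd \<sigma>"
    and eq: "\<And>\<sigma> stop f v. proper stop \<Longrightarrow>
     ev \<delta> stop f (Init \<sigma>) (u @ v) = (mass R \<sigma> (\<lambda>q. ev \<delta> stop f q v) s x x
       + of_bool \<sigma> * ev \<delta> stop f (Ctl cf) v) / 4 ^ n + dd \<sigma> * ev \<delta> stop f Dead v"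
    unfolding history_def by blast
  define G where "G \<sigma> = (real x + of_bool \<sigma>) / 4 ^ n" for \<sigma>
  define K where "K \<sigma> = mass R \<sigma> (\<lambda>q :: 'c mst. 1) s (if \<sigma> then 0 else x) (if \<sigma> then x else 0) / 4 ^ n + dd \<sigma>" for \<sigma>
  have eq': "ev \<delta> stop f (Init \<sigma>) ((u @ [0, 0]) @ v) = G \<sigma> * ev \<delta> stop f (Init \<sigma>) v + K \<sigma> * ev \<delta> stop f Dead v"
    if p: "proper stop" for \<sigma> stop f v
    by (cases \<sigma>) (simp_all add: eq[OF p] mass_0[OF p] Ctl_ev[OF p] ev_Dead[OF p] G_def K_def
        add_divide_distrib algebra_simps)
  have "proper (\<lambda>_. None)" by (simp add: proper_def)
  \<comment> \<open>With payoff 1 everywhere and no stopping the identity becomes conservation of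
    probability, which determines the share of \<open>Dead\<close>.\<close>
  from eq'[OF this, where f = "\<lambda>_. 1" and v = "[]"] have "G \<sigma> + K \<sigma> = 1" for \<sigma>
    by (simp add: ev_one del: append_assoc)
  then have K1: "K \<sigma> = 1 - G \<sigma>" for \<sigma> by (simp add: eq_diff_eq add.commute)
  have K0: "0 \<le> K \<sigma>" for \<sigma>
    unfolding K_def using dd mass_one_nonneg by (intro add_nonneg_nonneg divide_nonneg_pos) auto
  show thesis
  proof (rule that)
    show "set (u @ [0, 0]) \<subseteq> {0..k0} - {1}" using u by auto
    show "0 \<le> G False" "G False < G True" by (auto simp: G_def divide_strict_right_mono)
    show "G True \<le> 1" using K0[of True] K1[of True] by simp
  qed (use eq' K1 in auto)
qed

lemma ev_Dead_skip:
  assumes "proper stop" "1 \<notin> set u"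
  shows "ev \<delta> stop f Dead (u @ v) = ev \<delta> stop f Dead v"
  using assms(2) by (induction u) (auto simp: ev_Dead[OF assms(1)])

text \<open>The block repeats the history \<open>k\<close> times, so that losing and winning have the ratio
  \<open>(b / g) ^ k\<close>, which tends to 0.\<close>

lemma valid_block:
  assumes "valid"
  obtains g b where "0 \<le> b" "b < g" "g \<le> 1"
    "\<And>k. \<exists>u. u \<noteq> [] \<and> set u \<subseteq> {0..k0} \<and> (\<forall>stop f v q. proper stop \<longrightarrow> q \<in> {Fresh, EvL, EvW} \<longrightarrow> stop q = None \<longrightarrow>
       ev \<delta> stop f q (u @ v) = g ^ k / 2 * ev \<delta> stop f EvW v + b ^ k / 2 * ev \<delta> stop f EvL v
        + (1 - g ^ k / 2 - b ^ k / 2) * ev \<delta> stop f Fresh v)"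
proof -
  from assms obtain h g b where h: "set h \<subseteq> {0..k0} - {1}" "0 \<le> b" "b < g" "g \<le> 1"
    and eqs: "\<And>stop f v. proper stop \<Longrightarrow>
       ev \<delta> stop f (Init True) (h @ v) = g * ev \<delta> stop f (Init True) v + (1 - g) * ev \<delta> stop f Dead v"
    "\<And>stop f v. proper stop \<Longrightarrow>
       ev \<delta> stop f (Init False) (h @ v) = b * ev \<delta> stop f (Init False) v + (1 - b) * ev \<delta> stop f Dead v"
    by (rule valid_history) (rule that; assumption)
  have dead: "ev \<delta> stop f Dead (h @ v) = ev \<delta> stop f Dead v" if "proper stop" for stop f v
    using h(1) by (intro ev_Dead_skip that) auto
  have deadr: "ev \<delta> stop f Dead (concat (replicate k h) @ v) = ev \<delta> stop f Dead v" if "proper stop" for stop f v k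
    by (induction k) (simp_all add: dead[OF that])
  have iterT: "ev \<delta> stop f (Init True) (concat (replicate k h) @ v) = g ^ k * ev \<delta> stop f (Init True) v
      + (1 - g ^ k) * ev \<delta> stop f Dead v" if p: "proper stop" for stop f v k
  proof (induction k)
    case (Suc k)
    then show ?case by (simp add: eqs[OF p] deadr[OF p]) (simp add: algebra_simps)
  qed simp
  have iterF: "ev \<delta> stop f (Init False) (concat (replicate k h) @ v) = b ^ k * ev \<delta> stop f (Init False) v
      + (1 - b ^ k) * ev \<delta> stop f Dead v" if p: "proper stop" for stop f v k
  proof (induction k)
    case (Suc k)
    then show ?case by (simp add: eqs[OF p] deadr[OF p]) (simp add: algebra_simps)
  qed simp
  show thesis
  proof (rule that[OF h(2-4)])
    fix k
    \<comment> \<open>The first two letters draw the side, the copies of \<open>h\<close> play the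
      executions, and the last two letters turn survivors into events and \<open>Dead\<close> into
      \<open>Fresh\<close>.\<close>
    define u where "u = [0, 0] @ concat (replicate k h) @ [1, 1]"
    show "\<exists>u. u \<noteq> [] \<and> set u \<subseteq> {0..k0} \<and> (\<forall>stop f v q. proper stop \<longrightarrow> q \<in> {Fresh, EvL, EvW} \<longrightarrow> stop q = None \<longrightarrow>
       ev \<delta> stop f q (u @ v) = g ^ k / 2 * ev \<delta> stop f EvW v + b ^ k / 2 * ev \<delta> stop f EvL v
        + (1 - g ^ k / 2 - b ^ k / 2) * ev \<delta> stop f Fresh v)"
    proof (intro exI[of _ u] conjI allI impI)
      show "u \<noteq> []" by (simp add: u_def)
      show "set u \<subseteq> {0..k0}" using h(1) by (auto simp: u_def)
      fix stop f v q assume p: "proper stop" "q \<in> {Fresh, EvL, EvW}" "stop q = (None :: real option)"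
      have "ev \<delta> stop f Dead (1 # 1 # v) = ev \<delta> stop f Fresh v"
        by (simp add: ev_Dead[OF p(1)] ev_Mid[OF p(1)])
      then show "ev \<delta> stop f q (u @ v) = g ^ k / 2 * ev \<delta> stop f EvW v + b ^ k / 2 * ev \<delta> stop f EvL v
        + (1 - g ^ k / 2 - b ^ k / 2) * ev \<delta> stop f Fresh v"
        by (simp add: u_def fresh_ev[OF p] iterT[OF p(1)] iterF[OF p(1)] Init_ev[OF p(1)] algebra_simps add_divide_distrib diff_divide_distrib)
    qed
  qed
qed

end

section \<open>Coin flips\<close>

abbreviation "fair \<equiv> measure_pmf (pmf_of_set (UNIV :: bool set))"

text \<open>The index set is general because flips are attached to positions of a branch as well as
  to nodes of the tree.\<close>

definition coins :: "'i itself \<Rightarrow> ('i \<Rightarrow> bool) measure" where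
  "coins _ = PiM (UNIV :: 'i set) (\<lambda>_. fair)"

lemma coin_eq: "coin = coins TYPE(nat)"
  by (simp add: coin_def coins_def)

lemma space_coins [simp]: "space (coins TYPE('i)) = UNIV"
  by (simp add: coins_def space_PiM)

lemma prob_space_coins: "prob_space (coins TYPE('i))"
  unfolding coins_def by (intro prob_space_PiM prob_space_measure_pmf)

lemma space_coin [simp]: "space coin = UNIV"
  by (simp add: coin_eq)

interpretation coin: prob_space coin
  unfolding coin_eq by (rule prob_space_coins)

lemma measurable_coins_component [measurable]: "(\<lambda>s. s i) \<in> coins TYPE('i) \<rightarrow>\<^sub>M count_space UNIV"
proof -
  have "(\<lambda>s. s i) \<in> coins TYPE('i) \<rightarrow>\<^sub>M fair"
    unfolding coins_def by (rule measurable_component_singleton) simp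
  then show ?thesis by (simp cong: measurable_cong_sets)
qed

lemma measurable_into_coins:
  assumes "\<And>i. (\<lambda>x. f x i) \<in> N \<rightarrow>\<^sub>M count_space UNIV"
  shows "f \<in> N \<rightarrow>\<^sub>M coins TYPE('i)"
proof -
  have "(\<lambda>x i. f x i) \<in> N \<rightarrow>\<^sub>M coins TYPE('i)"
    unfolding coins_def
  proof (rule measurable_PiM_single')
    fix i show "(\<lambda>x. f x i) \<in> N \<rightarrow>\<^sub>M fair"
      using assms[of i] by (simp cong: measurable_cong_sets)
  qed auto
  then show ?thesis by simp
qed

lemma measurable_prefix [measurable]: "(\<lambda>c. map c [0..<n]) \<in> coin \<rightarrow>\<^sub>M count_space UNIV"
proof (rule measurable_count_space_eq2_countable[THEN iffD2], intro conjI ballI)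
  fix l :: "bool list"
  have "(\<lambda>c. map c [0..<n]) -` {l} \<inter> space coin = (if length l = n then \<Inter>i\<in>{..<n}. {c \<in> space coin. c i = l ! i} else {})"
    by (simp add: set_eq_iff list_eq_iff_nth_eq) blast
  moreover have "{c \<in> space coin. c i = l ! i} \<in> sets coin" for i
    using measurable_sets[OF measurable_coins_component[of i], of "{l ! i}"] by (simp add: vimage_def coin_eq)
  ultimately show "(\<lambda>c. map c [0..<n]) -` {l} \<inter> space coin \<in> sets coin"
    using sets.top[of coin] by (auto intro!: sets.countable_INT'')
qed auto

lemma measurable_prefix_fun: "(\<lambda>c. F (map c [0..<n])) \<in> coin \<rightarrow>\<^sub>M count_space UNIV"
  by (rule measurable_compose[OF measurable_prefix]) simp

lemma coins_finite:
  assumes "finite J"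
  shows "emeasure (coins TYPE('i)) {s. \<forall>j\<in>J. s j = x j} = ennreal (1 / 2 ^ card J)"
proof -
  interpret product_prob_space "\<lambda>_ :: 'i. fair" UNIV
    by unfold_locales
  have "emeasure (coins TYPE('i)) {s \<in> space (PiM UNIV (\<lambda>_ :: 'i. fair)). \<forall>j\<in>J. s j \<in> {x j}}
      = (\<Prod>j\<in>J. emeasure fair {x j})"
    unfolding coins_def by (rule emeasure_PiM_Collect) (use assms in auto)
  also have "\<dots> = (\<Prod>j\<in>J. ennreal (1 / 2))"
    by (intro prod.cong refl) (simp add: emeasure_pmf_single)
  also have "\<dots> = ennreal (\<Prod>j\<in>J. 1 / 2)"
    by (rule prod_ennreal) simp
  also have "\<dots> = ennreal (1 / 2 ^ card J)"
    by (simp add: power_one_over)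
  finally show ?thesis by (simp add: space_PiM)
qed

lemma coin_prefix: "length l = n \<Longrightarrow> emeasure coin {c. map c [0..<n] = l} = ennreal (1 / 2 ^ n)"
proof -
  assume l: "length l = n"
  have "{c. map c [0..<n] = l} = {c. \<forall>j\<in>{..<n}. c j = l ! j}"
    using l by (auto simp: list_eq_iff_nth_eq)
  then show ?thesis using coins_finite[of "{..<n}" "\<lambda>j. l ! j"] by (simp add: coin_eq)
qed

lemma emeasure_prefix:
  assumes "sets N = sets coin" "\<And>l. length l = n \<Longrightarrow> emeasure N {c. map c [0..<n] = l} = ennreal (1 / 2 ^ n)"
  shows "emeasure N {c. A (map c [0..<n])} = (\<Sum>l\<in>{l. length l = n \<and> A l}. ennreal (1 / 2 ^ n))"
proof -
  have fin: "finite {l :: bool list. length l = n \<and> A l}"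
    using finite_lists_length_eq[of "UNIV :: bool set" n] by (rule rev_finite_subset) auto
  have sets: "{c. map c [0..<n] = l} \<in> sets N" for l
    using measurable_sets[OF measurable_prefix, of "{l}" n] by (simp add: assms(1) vimage_def)
  have "{c. A (map c [0..<n])} = (\<Union>l\<in>{l. length l = n \<and> A l}. {c. map c [0..<n] = l})"
    by auto
  also have "emeasure N \<dots> = (\<Sum>l\<in>{l. length l = n \<and> A l}. emeasure N {c. map c [0..<n] = l})"
    by (rule sum_emeasure[symmetric]) (use fin sets in \<open>auto simp: disjoint_family_on_def\<close>)
  also have "\<dots> = (\<Sum>l\<in>{l. length l = n \<and> A l}. ennreal (1 / 2 ^ n))"
    by (intro sum.cong refl assms(2)) auto
  finally show ?thesis .
qed

text \<open>A cylinder over finitely many positions is a finite union of cones of one length, so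
  agreement on cones suffices.\<close>

lemma coin_eqI:
  assumes "sets N = sets coin"
    and pre: "\<And>n l. length l = n \<Longrightarrow> emeasure N {c. map c [0..<n] = l} = ennreal (1 / 2 ^ n)"
  shows "N = coin"
proof -
  have fin: "finite_measure coin" by (rule coin.finite_measure_axioms)
  have "coin = N"
  proof (rule measure_eqI_PiM_infinite[where I = UNIV and M = "\<lambda>_. fair"])
    show "sets coin = sets (PiM UNIV (\<lambda>_. fair))" by (simp add: coin_def)
    then show "sets N = sets (PiM UNIV (\<lambda>_. fair))" using assms(1) by simp
  next
    fix E :: "nat \<Rightarrow> bool set" and J :: "nat set" assume J: "finite J"
    define n where "n = (if J = {} then 0 else Suc (Max J))"
    have n: "j < n" if "j \<in> J" for j using that Max_ge[OF J that] by (auto simp: n_def less_Suc_eq_le)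
    have "prod_emb UNIV (\<lambda>_. fair) J (Pi\<^sub>E J E) = {c. \<forall>j\<in>J. map c [0..<n] ! j \<in> E j}"
      using n by (auto simp: prod_emb_def PiE_iff)
    then show "emeasure coin (prod_emb UNIV (\<lambda>_. fair) J (Pi\<^sub>E J E)) = emeasure N (prod_emb UNIV (\<lambda>_. fair) J (Pi\<^sub>E J E))"
      using emeasure_prefix[OF refl coin_prefix, of n "\<lambda>l. \<forall>j\<in>J. l ! j \<in> E j"]
        emeasure_prefix[OF assms, of n "\<lambda>l. \<forall>j\<in>J. l ! j \<in> E j"] by simp
  qed (rule fin)
  then show ?thesis by simp
qed

section \<open>Finite words as events of the coin measure\<close>

fun pr :: "nat \<Rightarrow> (bool list \<Rightarrow> bool) \<Rightarrow> real" where
  "pr 0 A = of_bool (A [])"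
| "pr (Suc n) A = (pr n (\<lambda>l. A (False # l)) + pr n (\<lambda>l. A (True # l))) / 2"

lemma pr_card: "pr n A = real (card {l. length l = n \<and> A l}) / 2 ^ n"
proof (induction n arbitrary: A)
  case 0
  have "{l. length l = 0 \<and> A l} = (if A [] then {[]} else {})" by auto
  then show ?case by simp
next
  case (Suc n)
  have fin: "finite {l :: bool list. length l = n \<and> B l}" for B
    using finite_lists_length_eq[of "UNIV :: bool set" n] by (rule rev_finite_subset) auto
  have "{l. length l = Suc n \<and> A l} = (#) False ` {l. length l = n \<and> A (False # l)}
      \<union> (#) True ` {l. length l = n \<and> A (True # l)}"
    by (auto simp: length_Suc_conv image_iff) (metis (full_types))
  moreover have "card \<dots> = card {l. length l = n \<and> A (False # l)} + card {l. length l = n \<and> A (True # l)}"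
    by (subst card_Un_disjoint) (auto simp: fin card_image)
  ultimately show ?case by (simp add: Suc add_divide_distrib)
qed

lemma measure_prefix: "measure coin {c. A (map c [0..<n])} = pr n A"
proof -
  have "emeasure coin {c. A (map c [0..<n])} = ennreal (pr n A)"
    unfolding emeasure_prefix[OF refl coin_prefix, of n A, simplified] pr_card
    by (simp add: ennreal_of_nat_eq_real_of_nat flip: ennreal_mult)
  moreover have "0 \<le> pr n A" unfolding pr_card by simp
  ultimately show ?thesis by (simp add: measure_def)
qed

lemma sets_prefix: "{c. A (map c [0..<n])} \<in> sets coin"
  using measurable_sets[OF measurable_prefix, of "{l. A l}" n] by (simp add: vimage_def)

primrec st :: "('s \<Rightarrow> nat \<Rightarrow> bool \<Rightarrow> 's) \<Rightarrow> 's \<Rightarrow> (nat \<Rightarrow> nat) \<Rightarrow> (nat \<Rightarrow> bool) \<Rightarrow> nat \<Rightarrow> 's" where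
  "st \<delta> q w c 0 = q"
| "st \<delta> q w c (Suc i) = \<delta> (st \<delta> q w c i) (w i) (c i)"

lemma st_prefix: "map c [0..<i] = map c' [0..<i] \<Longrightarrow> st \<delta> q w c i = st \<delta> q w c' i"
  by (induction i) auto

lemma st_of_prefix: "st \<delta> q w c i = st \<delta> q w (\<lambda>j. map c [0..<i] ! j) i"
  by (rule st_prefix) auto

lemma measurable_st [measurable]: "(\<lambda>c. st \<delta> q w c i) \<in> coin \<rightarrow>\<^sub>M count_space UNIV"
  by (subst st_of_prefix, rule measurable_prefix_fun)

lemma st_add: "st \<delta> q w c (i + j) = st \<delta> (st \<delta> q w c i) (\<lambda>j. w (i + j)) (\<lambda>j. c (i + j)) j"
  by (induction j) auto

definition acc :: "'s \<Rightarrow> 's \<Rightarrow> (nat \<Rightarrow> 's) \<Rightarrow> bool" where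
  "acc eL eW r \<longleftrightarrow> (\<forall>m. \<exists>i\<ge>m. r i = eW) \<and> (\<exists>m. \<forall>i\<ge>m. r i \<noteq> eL)"

lemma pred_acc:
  assumes "\<And>i. X i \<in> N \<rightarrow>\<^sub>M count_space UNIV"
  shows "{x \<in> space N. acc eL eW (\<lambda>i. X i x)} \<in> sets N"
proof -
  note assms[measurable]
  show ?thesis unfolding acc_def by measurable
qed

lemma distr_shift: "distr coin coin (\<lambda>c i. c (k + i)) = coin"
proof (rule coin_eqI)
  have meas: "(\<lambda>c i. c (k + i)) \<in> coin \<rightarrow>\<^sub>M coin"
    unfolding coin_eq by (rule measurable_into_coins) measurable
  fix l :: "bool list" and n assume l: "length l = n"
  have "{c. map c [0..<n] = l} \<in> sets coin" using sets_prefix[of "\<lambda>x. x = l"] by simp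
  then have "emeasure (distr coin coin (\<lambda>c i. c (k + i))) {c. map c [0..<n] = l}
      = emeasure coin {c. map (\<lambda>i. c (k + i)) [0..<n] = l}"
    by (subst emeasure_distr[OF meas]) (auto simp: vimage_def)
  also have "{c. map (\<lambda>i. c (k + i)) [0..<n] = l} = {c. \<forall>j\<in>(+) k ` {..<n}. c j = l ! (j - k)}"
    using l by (auto simp: list_eq_iff_nth_eq)
  also have "emeasure coin \<dots> = ennreal (1 / 2 ^ n)"
    unfolding coin_eq by (subst coins_finite) (auto simp: card_image)
  finally show "emeasure (distr coin coin (\<lambda>c i. c (k + i))) {c. map c [0..<n] = l} = ennreal (1 / 2 ^ n)" .
qed simp

lemma measurable_shift: "(\<lambda>c i. c (k + i)) \<in> coin \<rightarrow>\<^sub>M coin"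
  unfolding coin_eq by (rule measurable_into_coins) measurable

lemma AE_shift: "AE c in coin. P c \<Longrightarrow> AE c in coin. P (\<lambda>i. c (k + i))"
  using AE_distrD[OF measurable_shift[of k], of P] unfolding distr_shift .

fun trace :: "('s \<Rightarrow> nat \<Rightarrow> bool \<Rightarrow> 's) \<Rightarrow> 's \<Rightarrow> nat list \<Rightarrow> bool list \<Rightarrow> 's list" where
  "trace \<delta> q (a # v) (b # l) = \<delta> q a b # trace \<delta> (\<delta> q a b) v l"
| "trace \<delta> q _ _ = []"

lemma map_upt_Suc_shift: "map f [0..<Suc n] = f 0 # map (\<lambda>i. f (Suc i)) [0..<n]"
  by (simp add: upt_conv_Cons map_Suc_upt[symmetric] comp_def del: upt_Suc)

lemma st_Suc_shift: "st \<delta> q w c (Suc i) = st \<delta> (\<delta> q (w 0) (c 0)) (\<lambda>i. w (Suc i)) (\<lambda>i. c (Suc i)) i"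
  using st_add[of \<delta> q w c 1 i] by simp

lemma trace_st: "trace \<delta> q (map w [0..<n]) (map c [0..<n]) = map (\<lambda>i. st \<delta> q w c (Suc i)) [0..<n]"
proof (induction n arbitrary: q w c)
  case (Suc n)
  show ?case
    unfolding map_upt_Suc_shift trace.simps Suc st_Suc_shift[symmetric] by simp
qed simp

text \<open>This and the next two lemmas choose payoffs for which \<open>ev\<close> is the
  probability of hitting a state, of avoiding it, and of a property of the final state. The start
  must differ from \<open>e\<close>, because \<open>ev\<close> looks at it and \<open>trace\<close>
  omits it.\<close>

lemma ev_hit: "q \<noteq> e \<Longrightarrow> ev \<delta> (\<lambda>q. if q = e then Some 1 else None) (\<lambda>_. 0) q v
   = pr (length v) (\<lambda>l. e \<in> set (trace \<delta> q v l))"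
proof (induction v arbitrary: q)
  case (Cons a v)
  have one: "ev \<delta> (\<lambda>q. if q = e then Some 1 else None) (\<lambda>_. 0) e v = 1" by (cases v) (auto simp: ev.simps)
  have T: "pr n (\<lambda>_. True) = 1" for n by (induction n) auto
  have "ev \<delta> (\<lambda>q. if q = e then Some 1 else None) (\<lambda>_. 0) (\<delta> q a b) v
     = pr (length v) (\<lambda>l. e = \<delta> q a b \<or> e \<in> set (trace \<delta> (\<delta> q a b) v l))" for b
    using Cons.IH one T by (cases "\<delta> q a b = e") auto
  then show ?case using Cons.prems by (simp add: ev.simps)
qed (simp add: ev.simps)

lemma ev_avoid: "q \<noteq> e \<Longrightarrow> ev \<delta> (\<lambda>q. if q = e then Some 0 else None) (\<lambda>_. 1) q v
   = pr (length v) (\<lambda>l. e \<notin> set (trace \<delta> q v l))"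
proof (induction v arbitrary: q)
  case (Cons a v)
  have one: "ev \<delta> (\<lambda>q. if q = e then Some 0 else None) (\<lambda>_. 1) e v = 0" by (cases v) (auto simp: ev.simps)
  have T: "pr n (\<lambda>_. False) = 0" for n by (induction n) auto
  have "ev \<delta> (\<lambda>q. if q = e then Some 0 else None) (\<lambda>_. 1) (\<delta> q a b) v
     = pr (length v) (\<lambda>l. e \<noteq> \<delta> q a b \<and> e \<notin> set (trace \<delta> (\<delta> q a b) v l))" for b
    using Cons.IH one T by (cases "\<delta> q a b = e") auto
  then show ?case using Cons.prems by (simp add: ev.simps)
qed (simp add: ev.simps)

lemma ev_last: "ev \<delta> (\<lambda>_. None) (\<lambda>q. of_bool (P q)) q v
   = pr (length v) (\<lambda>l. P (last (q # trace \<delta> q v l)))"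
proof (induction v arbitrary: q)
  case (Cons a v)
  have "trace \<delta> q (a # v) (b # l) \<noteq> []" for b l by simp
  with Cons show ?case by (simp add: ev.simps)
qed (simp add: ev.simps)

text \<open>At least \<open>k\<close> wins before the first loss. Once a prefix shows this it stays
  true, so along a run these events increase and their probabilities pass to the limit.\<close>

fun wins :: "'s \<Rightarrow> 's \<Rightarrow> nat \<Rightarrow> 's list \<Rightarrow> bool" where
  "wins eL eW 0 l = True"
| "wins eL eW (Suc k) [] = False"
| "wins eL eW (Suc k) (q # l) =
     (if q = eW then wins eL eW k l else if q = eL then False else wins eL eW (Suc k) l)"

lemma wins_append: "wins eL eW k l \<Longrightarrow> wins eL eW k (l @ l')"
  by (induction eL eW k l rule: wins.induct) (auto split: if_splits)

lemma wins_count: "eL \<notin> set l \<Longrightarrow> eL \<noteq> eW \<Longrightarrow> k \<le> length (filter (\<lambda>q. q = eW) l) \<Longrightarrow> wins eL eW k l"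
  by (induction eL eW k l rule: wins.induct) auto

section \<open>Almost sure acceptance\<close>

lemma coin_AE_not:
  assumes "{c. Q c} \<in> sets coin" "measure coin {c. Q c} = 0"
  shows "AE c in coin. \<not> Q c"
proof -
  have "{c. Q c} \<in> null_sets coin" using assms by (auto simp: coin.emeasure_eq_measure)
  from AE_not_in[OF this] show ?thesis by simp
qed

text \<open>\<open>Z\<close> is only enclosed from outside, which spares a proof of its
  measurability.\<close>

lemma coin_nullI:
  assumes "\<And>k. \<exists>B. Z \<subseteq> B \<and> B \<in> sets coin \<and> measure coin B \<le> (1 / 2) ^ k"
  shows "AE c in coin. c \<notin> Z"
proof -
  from assms obtain B where B: "\<And>k. Z \<subseteq> B k" "\<And>k. B k \<in> sets coin" "\<And>k. measure coin (B k) \<le> (1 / 2) ^ k"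
    by metis
  define N where "N = (\<Inter>k. B k)"
  have N: "N \<in> sets coin" unfolding N_def using B(2) by (intro sets.countable_INT) auto
  have "measure coin N \<le> (1 / 2) ^ k" for k
  proof -
    have "measure coin N \<le> measure coin (B k)"
      using B(2) N by (intro coin.finite_measure_mono) (auto simp: N_def)
    with B(3)[of k] show ?thesis by simp
  qed
  moreover have "(\<lambda>k. (1 / 2 :: real) ^ k) \<longlonglongrightarrow> 0" by (intro LIMSEQ_realpow_zero) auto
  ultimately have "measure coin N \<le> 0"
    by (intro LIMSEQ_le_const) auto
  then have "emeasure coin N = 0"
    by (simp add: coin.emeasure_eq_measure measure_le_0_iff)
  then have "N \<in> null_sets coin" using N by auto
  then have "AE c in coin. c \<notin> N" by (rule AE_not_in)
  moreover have "Z \<subseteq> N" using B(1) by (auto simp: N_def)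
  ultimately show ?thesis by (auto elim: eventually_mono)
qed

lemma ex_count:
  assumes "\<And>m. \<exists>i\<ge>m. X i = e"
  shows "\<exists>N. k \<le> length (filter (\<lambda>q. q = e) (map X [0..<N]))"
proof (induction k)
  case (Suc k)
  then obtain N where N: "k \<le> length (filter (\<lambda>q. q = e) (map X [0..<N]))" by blast
  from assms obtain i where i: "i \<ge> N" "X i = e" by blast
  have "[0..<Suc i] = [0..<N] @ [N..<i] @ [i]"
    using i(1) upt_add_eq_append[of 0 N "i - N"] by simp
  then show ?case using N i(2) by (intro exI[of _ "Suc i"]) (simp del: upt_Suc)
qed simp

context machine
begin

definition swin :: "'c mst \<Rightarrow> real option" where
  "swin q = (if q = EvW then Some 1 else if q = EvL then Some 0 else None)"

definition slose :: "'c mst \<Rightarrow> real option" where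
  "slose q = (if q = EvL then Some 1 else if q = EvW then Some 0 else None)"

lemma ev_diff: "d v q = ev \<delta> slose (\<lambda>_. 0) q v - ev \<delta> swin (\<lambda>_. 0) q v"
proof (induction v arbitrary: q)
  case (Cons a v)
  show ?case by (simp add: ev.simps Cons sd_def[of q] swin_def[of q] slose_def[of q] field_simps)
qed (simp add: ev.simps sd_def swin_def slose_def)

lemma ev_sum_le: "ev \<delta> slose (\<lambda>_. 0) q v + ev \<delta> swin (\<lambda>_. 0) q v \<le> 1"
proof (induction v arbitrary: q)
  case (Cons a v)
  show ?case using Cons[of "\<delta> q a False"] Cons[of "\<delta> q a True"]
    by (auto simp: ev.simps swin_def[of q] slose_def[of q] field_simps)
qed (auto simp: ev.simps swin_def slose_def)

lemma delta_fresh: "q \<in> {Fresh, EvL, EvW} \<Longrightarrow> \<delta> q a b = \<delta> Fresh a b"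
  by auto

lemma trace_fresh: "q \<in> {Fresh, EvL, EvW} \<Longrightarrow> trace \<delta> q v l = trace \<delta> Fresh v l"
  by (cases v; cases l) (simp_all add: delta_fresh[of q] del: delta.simps)

lemma st_fresh: "q \<in> {Fresh, EvL, EvW} \<Longrightarrow> st \<delta> q w c (Suc i) = st \<delta> Fresh w c (Suc i)"
  unfolding st_Suc_shift by (simp add: delta_fresh[of q] del: delta.simps)

lemma ev_fresh: "q \<in> {Fresh, EvL, EvW} \<Longrightarrow> stop q = None \<Longrightarrow> stop Fresh = None \<Longrightarrow> f q = f Fresh \<Longrightarrow>
    ev \<delta> stop f q v = ev \<delta> stop f Fresh v"
  by (cases v) (simp_all add: ev.simps delta_fresh[of q] del: delta.simps)

lemma pr_const [simp]: "pr n (\<lambda>_. True) = 1" "pr n (\<lambda>_. False) = 0"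
  by (induction n) auto

text \<open>Condition on the first event: a loss ends the count, and after a win the chain continues
  as from \<open>Fresh\<close>, where \<open>A\<close> bounds the remaining \<open>k\<close>
  wins.\<close>

lemma wins_step:
  assumes A: "\<And>v. pr (length v) (\<lambda>l. wins EvL EvW k (trace \<delta> Fresh v l)) \<le> (1 / 2) ^ k"
    and q: "q \<noteq> EvL" "q \<noteq> EvW"
  shows "pr (length v) (\<lambda>l. wins EvL EvW (Suc k) (trace \<delta> q v l)) \<le> (1 / 2) ^ k * ev \<delta> swin (\<lambda>_. 0) q v"
  using q
proof (induction v arbitrary: q)
  case (Cons a v)
  have "pr (length v) (\<lambda>l. wins EvL EvW (Suc k) (trace \<delta> q (a # v) (b # l)))
     \<le> (1 / 2) ^ k * ev \<delta> swin (\<lambda>_. 0) (\<delta> q a b) v" for b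
  proof -
    have e: "ev \<delta> swin (\<lambda>_. 0) EvW v = 1" "ev \<delta> swin (\<lambda>_. 0) EvL v = 0"
      by (cases v; simp add: ev.simps swin_def)+
    consider "\<delta> q a b = EvW" | "\<delta> q a b = EvL" | "\<delta> q a b \<noteq> EvW" "\<delta> q a b \<noteq> EvL" by blast
    then show ?thesis
    proof cases
      case 1
      then show ?thesis using A[of v] trace_fresh[of EvW v] by (simp add: e)
    next
      case 2
      then show ?thesis by (simp add: e)
    next
      case 3
      then show ?thesis using Cons.IH[of "\<delta> q a b"] by simp
    qed
  qed
  from this[of False] this[of True] show ?case
    using Cons.prems by (simp add: ev.simps swin_def[of q] algebra_simps del: trace.simps)
qed (simp add: ev.simps swin_def)

text \<open>From \<open>Fresh\<close> a loss comes first at least as likely as a win, and the two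
  chances add up to at most 1; so each further win costs a factor 1/2.\<close>

lemma not_valid_wins:
  assumes "\<not> valid"
  shows "pr (length v) (\<lambda>l. wins EvL EvW k (trace \<delta> Fresh v l)) \<le> (1 / 2) ^ k"
proof (induction k arbitrary: v)
  case (Suc k)
  have "0 \<le> d v Fresh" using not_valid_balance[OF assms, of v] by auto
  with ev_sum_le[of Fresh v] have "ev \<delta> swin (\<lambda>_. 0) Fresh v \<le> 1 / 2"
    unfolding ev_diff by simp
  then have le: "(1 / 2) ^ k * ev \<delta> swin (\<lambda>_. 0) Fresh v \<le> (1 / 2) ^ k * (1 / 2)"
    by (intro mult_left_mono) auto
  have "pr (length v) (\<lambda>l. wins EvL EvW (Suc k) (trace \<delta> Fresh v l)) \<le> (1 / 2) ^ k * (1 / 2)"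
    by (rule order_trans[OF wins_step[OF Suc] le]) auto
  then show ?case by simp
qed simp

text \<open>From an arbitrary state the first win may be certain, so one factor is given
  away.\<close>

lemma not_valid_wins':
  assumes "\<not> valid"
  shows "pr (length v) (\<lambda>l. wins EvL EvW (Suc k) (trace \<delta> q v l)) \<le> (1 / 2) ^ k"
proof (cases "q = EvL \<or> q = EvW")
  case True
  then have "trace \<delta> q v l = trace \<delta> Fresh v l" for l by (intro trace_fresh) auto
  moreover have "(1 / 2 :: real) ^ Suc k \<le> (1 / 2) ^ k" by simp
  moreover note not_valid_wins[OF assms, of v "Suc k"]
  ultimately show ?thesis by (auto intro: order_trans simp del: power_Suc wins.simps)
next
  case False
  have "0 \<le> ev \<delta> slose (\<lambda>_. 0) q v" by (rule ev_nonneg) (auto simp: slose_def split: if_splits)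
  with ev_sum_le[of q v] have "ev \<delta> swin (\<lambda>_. 0) q v \<le> 1" by simp
  then have le: "(1 / 2) ^ k * ev \<delta> swin (\<lambda>_. 0) q v \<le> (1 / 2) ^ k * 1"
    by (intro mult_left_mono) auto
  have "pr (length v) (\<lambda>l. wins EvL EvW (Suc k) (trace \<delta> q v l)) \<le> (1 / 2) ^ k * 1"
    by (rule order_trans[OF wins_step[OF not_valid_wins[OF assms]] le]) (use False in auto)
  then show ?thesis by simp
qed

lemma not_valid_null:
  assumes "\<not> valid"
  shows "AE c in coin. \<not> ((\<forall>m. \<exists>i\<ge>m. st \<delta> q w c i = EvW) \<and> (\<forall>i. st \<delta> q w c (Suc i) \<noteq> EvL))"
proof -
  define Z where "Z = {c. (\<forall>m. \<exists>i\<ge>m. st \<delta> q w c i = EvW) \<and> (\<forall>i. st \<delta> q w c (Suc i) \<noteq> EvL)}"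
  have "\<exists>B. Z \<subseteq> B \<and> B \<in> sets coin \<and> measure coin B \<le> (1 / 2) ^ k" for k
  proof -
    define B where "B N = {c. wins EvL EvW (Suc k) (trace \<delta> q (map w [0..<N]) (map c [0..<N]))}" for N
    have meas: "B N \<in> sets coin" for N unfolding B_def by (rule sets_prefix)
    have le: "measure coin (B N) \<le> (1 / 2) ^ k" for N
      using not_valid_wins'[OF assms, of "map w [0..<N]" k q] unfolding B_def
      by (subst measure_prefix[where A = "\<lambda>l. wins EvL EvW (Suc k) (trace \<delta> q (map w [0..<N]) l)"]) simp
    have "incseq B"
    proof (rule incseq_SucI)
      show "B N \<subseteq> B (Suc N)" for N
        unfolding B_def trace_st using wins_append by auto
    qed
    then have "(\<lambda>N. measure coin (B N)) \<longlonglongrightarrow> measure coin (\<Union>N. B N)"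
      using meas by (intro coin.finite_Lim_measure_incseq) auto
    then have "measure coin (\<Union>N. B N) \<le> (1 / 2) ^ k"
      by (rule LIMSEQ_le_const2) (use le in auto)
    moreover have "Z \<subseteq> (\<Union>N. B N)"
    proof
      fix c assume c: "c \<in> Z"
      have "\<exists>i\<ge>m. st \<delta> q w c (Suc i) = EvW" for m
      proof -
        from c obtain i where "i \<ge> Suc m" "st \<delta> q w c i = EvW" unfolding Z_def by blast
        then show ?thesis by (cases i) auto
      qed
      from ex_count[OF this] obtain N where
        "Suc k \<le> length (filter (\<lambda>q. q = EvW) (map (\<lambda>i. st \<delta> q w c (Suc i)) [0..<N]))" by blast
      moreover have "EvL \<notin> set (map (\<lambda>i. st \<delta> q w c (Suc i)) [0..<N])"
        using c unfolding Z_def by (auto simp del: st.simps dest: sym)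
      ultimately have "c \<in> B N"
        unfolding B_def trace_st by (simp only: mem_Collect_eq) (rule wins_count; simp del: st.simps)
      then show "c \<in> (\<Union>N. B N)" by blast
    qed
    moreover have "(\<Union>N. B N) \<in> sets coin" using meas by blast
    ultimately show ?thesis by blast
  qed
  from coin_nullI[OF this] show ?thesis by (simp add: Z_def)
qed

lemma not_valid_imp:
  assumes "\<not> valid"
  shows "\<not> (AE c in coin. acc EvL EvW (st \<delta> q w c))"
proof
  assume a: "AE c in coin. acc EvL EvW (st \<delta> q w c)"
  \<comment> \<open>The state after the last loss depends on the flips. Quantifying over all
    prefixes \<open>l\<close> fixes that state in each of countably many almost sure
    statements.\<close>
  have "AE c in coin. \<forall>i. \<forall>l :: bool list. \<not> ((\<forall>m. \<exists>j\<ge>m. st \<delta> (st \<delta> q w (\<lambda>j. l ! j) i) (\<lambda>j. w (i + j)) (\<lambda>j. c (i + j)) j = EvW)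
     \<and> (\<forall>j. st \<delta> (st \<delta> q w (\<lambda>j. l ! j) i) (\<lambda>j. w (i + j)) (\<lambda>j. c (i + j)) (Suc j) \<noteq> EvL))"
    unfolding AE_all_countable by (intro allI) (rule AE_shift[OF not_valid_null[OF assms]])
  with a have "AE c in coin. False"
  proof eventually_elim
    fix c
    assume acc: "acc EvL EvW (st \<delta> q w c)"
      and no: "\<forall>i. \<forall>l :: bool list. \<not> ((\<forall>m. \<exists>j\<ge>m. st \<delta> (st \<delta> q w (\<lambda>j. l ! j) i) (\<lambda>j. w (i + j)) (\<lambda>j. c (i + j)) j = EvW)
     \<and> (\<forall>j. st \<delta> (st \<delta> q w (\<lambda>j. l ! j) i) (\<lambda>j. w (i + j)) (\<lambda>j. c (i + j)) (Suc j) \<noteq> EvL))"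
    from acc obtain i where i: "\<forall>j\<ge>i. st \<delta> q w c j \<noteq> EvL" and W: "\<forall>m. \<exists>j\<ge>m. st \<delta> q w c j = EvW"
      unfolding acc_def by blast
    have eq: "st \<delta> (st \<delta> q w (\<lambda>j. map c [0..<i] ! j) i) (\<lambda>j. w (i + j)) (\<lambda>j. c (i + j)) j = st \<delta> q w c (i + j)" for j
      unfolding st_add[of _ _ _ _ i j] by (subst st_of_prefix[of \<delta> q w c i]) (rule refl)
    have "\<exists>j\<ge>m. st \<delta> q w c (i + j) = EvW" for m
    proof -
      from W obtain j where "j \<ge> i + m" "st \<delta> q w c j = EvW" by blast
      then show ?thesis by (intro exI[of _ "j - i"]) auto
    qed
    moreover have "st \<delta> q w c (i + Suc j) \<noteq> EvL" for j using i by (simp del: st.simps)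
    ultimately show False using no[THEN spec, of i, THEN spec, of "map c [0..<i]"] unfolding eq by blast
  qed
  then show False by (simp add: coin.AE_False)
qed

text \<open>A block is repeated about \<open>1 / W\<close> times, where \<open>W\<close> is its probability of a win.\<close>

lemma valid_phase:
  assumes "valid" "0 < \<epsilon>"
  shows "\<exists>u. u \<noteq> [] \<and> set u \<subseteq> {0..k0}
    \<and> ev \<delta> (\<lambda>_. None) (\<lambda>q. of_bool (q \<notin> {Fresh, EvL, EvW})) Fresh u = 0
    \<and> ev \<delta> (\<lambda>q. if q = EvL then Some 1 else None) (\<lambda>_. 0) Fresh u \<le> \<epsilon>
    \<and> (\<forall>v. ev \<delta> (\<lambda>q. if q = EvW then Some 0 else None) (\<lambda>_. 1) Fresh (u @ v)
       \<le> 1 / 2 * ev \<delta> (\<lambda>q. if q = EvW then Some 0 else None) (\<lambda>_. 1) Fresh v)"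
proof -
  from valid_block[OF assms(1)] obtain g b where gb: "0 \<le> b" "b < g" "g \<le> 1"
    and blk: "\<And>k. \<exists>u. u \<noteq> [] \<and> set u \<subseteq> {0..k0} \<and> (\<forall>stop f v q. proper stop \<longrightarrow> q \<in> {Fresh, EvL, EvW} \<longrightarrow> stop q = None \<longrightarrow>
       ev \<delta> stop f q (u @ v) = g ^ k / 2 * ev \<delta> stop f EvW v + b ^ k / 2 * ev \<delta> stop f EvL v
        + (1 - g ^ k / 2 - b ^ k / 2) * ev \<delta> stop f Fresh v)"
    by metis
  \<comment> \<open>This makes \<open>L / W\<close> smaller than \<epsilon>/2; at most 2/W
    repetitions of the block then lose with probability at most \<epsilon>.\<close>
  have "\<exists>k. (b / g) ^ k < \<epsilon> / 2"
    using gb assms(2) by (intro real_arch_pow_inv) auto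
  then obtain k where k: "(b / g) ^ k < \<epsilon> / 2" by blast
  define W L where "W = g ^ k / 2" and "L = b ^ k / 2"
  obtain u where u: "u \<noteq> []" "set u \<subseteq> {0..k0}"
    and ev: "\<And>stop f v q. proper stop \<Longrightarrow> q \<in> {Fresh, EvL, EvW} \<Longrightarrow> stop q = None \<Longrightarrow>
       ev \<delta> stop f q (u @ v) = W * ev \<delta> stop f EvW v + L * ev \<delta> stop f EvL v
        + (1 - W - L) * ev \<delta> stop f Fresh v"
    using blk[of k] unfolding W_def L_def by metis
  have W: "0 < W" "W \<le> 1 / 2" using gb by (auto simp: W_def power_le_one)
  have L: "0 \<le> L" "L \<le> W" "L < \<epsilon> / 2 * W"
    using gb k by (auto simp: W_def L_def power_divide field_simps intro: power_mono)
  \<comment> \<open>With \<open>N * W\<close> at least 1, all repetitions miss a win with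
    probability at most exp(-1), which is below 1/2.\<close>
  define N where "N = nat \<lceil>1 / W\<rceil>"
  have N: "1 / W \<le> real N" "real N \<le> 1 / W + 1"
    using W by (auto simp: N_def intro: real_nat_ceiling_ge)
  define U where "U n = concat (replicate n u)" for n
  have U: "U (Suc n) @ v = u @ U n @ v" for n v by (simp add: U_def)
  have U0: "U 0 = []" by (simp add: U_def)
  let ?none = "\<lambda>_ :: 'c mst. None :: real option"
  let ?f = "\<lambda>q :: 'c mst. of_bool (q \<notin> {Fresh, EvL, EvW}) :: real"
  let ?l = "\<lambda>q :: 'c mst. if q = EvL then Some (1 :: real) else None"
  let ?w = "\<lambda>q :: 'c mst. if q = EvW then Some (0 :: real) else None"
  have p: "proper ?none" "proper ?l" "proper ?w" by (auto simp: proper_def)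
  have A: "ev \<delta> ?none ?f Fresh (U n @ []) = 0" for n
  proof (induction n)
    case (Suc n)
    have "ev \<delta> ?none ?f EvW v = ev \<delta> ?none ?f Fresh v" "ev \<delta> ?none ?f EvL v = ev \<delta> ?none ?f Fresh v" for v
      by (intro ev_fresh; simp)+
    then show ?case unfolding U by (subst ev[OF p(1)]) (use Suc in simp_all)
  qed (simp add: U0 ev.simps)
  have B: "ev \<delta> ?l (\<lambda>_. 0) Fresh (U n @ []) \<le> real n * L" for n
  proof (induction n)
    case (Suc n)
    have "ev \<delta> ?l (\<lambda>_. 0) EvW v = ev \<delta> ?l (\<lambda>_. 0) Fresh v" for v
      by (intro ev_fresh; simp)
    moreover have "ev \<delta> ?l (\<lambda>_. 0) EvL v = 1" for v by (cases v) (simp_all add: ev.simps)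
    ultimately have "ev \<delta> ?l (\<lambda>_. 0) Fresh (U (Suc n) @ []) = L + (1 - L) * ev \<delta> ?l (\<lambda>_. 0) Fresh (U n @ [])"
      unfolding U by (subst ev[OF p(2)]) (simp_all add: algebra_simps)
    moreover have "0 \<le> L * ev \<delta> ?l (\<lambda>_. 0) Fresh (U n @ [])"
      using L(1) by (intro mult_nonneg_nonneg ev_nonneg) (auto split: if_splits)
    ultimately show ?case using Suc by (simp add: algebra_simps)
  qed (simp add: U0 ev.simps)
  have C: "ev \<delta> ?w (\<lambda>_. 1) Fresh (U n @ v) = (1 - W) ^ n * ev \<delta> ?w (\<lambda>_. 1) Fresh v" for n v
  proof (induction n)
    case (Suc n)
    have "ev \<delta> ?w (\<lambda>_. 1) EvL v = ev \<delta> ?w (\<lambda>_. 1) Fresh v" for v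
      by (intro ev_fresh; simp)
    moreover have "ev \<delta> ?w (\<lambda>_. 1) EvW v = 0" for v by (cases v) (simp_all add: ev.simps)
    ultimately have "ev \<delta> ?w (\<lambda>_. 1) Fresh (U (Suc n) @ v) = (1 - W) * ev \<delta> ?w (\<lambda>_. 1) Fresh (U n @ v)"
      unfolding U by (subst ev[OF p(3)]) (simp_all add: algebra_simps)
    then show ?case using Suc by simp
  qed (simp add: U0)
  have "real N * L \<le> (1 / W + 1) * L" using N L by (intro mult_right_mono) auto
  also have "\<dots> \<le> 2 / W * L" using W L by (intro mult_right_mono) (auto simp: field_simps)
  also have "\<dots> \<le> \<epsilon>" using W L by (simp add: field_simps)
  finally have NL: "real N * L \<le> \<epsilon>" .
  have "(1 - W) ^ N \<le> exp (- W) ^ N"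
    using W exp_ge_add_one_self[of "- W"] by (intro power_mono) auto
  also have "\<dots> = exp (- (real N * W))" by (simp add: exp_of_nat_mult[symmetric])
  also have "\<dots> \<le> exp (- 1)" using N(1) W by (simp add: field_simps)
  also have "\<dots> \<le> 1 / 2" using exp_ge_add_one_self[of 1] by (simp add: exp_minus field_simps)
  finally have NW: "(1 - W) ^ N \<le> 1 / 2" .
  have N0: "N \<noteq> 0"
  proof
    assume "N = 0"
    with N(1) have "1 / W \<le> 0" by simp
    with W(1) show False by (simp add: divide_le_0_iff)
  qed
  show ?thesis
  proof (intro exI[of _ "U N"] conjI allI)
    show "U N \<noteq> []" using u(1) N0 by (cases N) (auto simp: U_def)
    show "set (U N) \<subseteq> {0..k0}" using u(2) by (auto simp: U_def)
    show "ev \<delta> ?none ?f Fresh (U N) = 0" using A[of N] by simp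
    show "ev \<delta> ?l (\<lambda>_. 0) Fresh (U N) \<le> \<epsilon>" using B[of N] NL by simp
    fix v
    have "0 \<le> ev \<delta> ?w (\<lambda>_. 1) Fresh v" by (rule ev_nonneg) (auto split: if_splits)
    then show "ev \<delta> ?w (\<lambda>_. 1) Fresh (U N @ v) \<le> 1 / 2 * ev \<delta> ?w (\<lambda>_. 1) Fresh v"
      unfolding C by (rule mult_right_mono[OF NW])
  qed
qed

text \<open>Phase \<open>r\<close> loses with probability at most 2^-r, so by Borel-Cantelli only
  finitely many phases contain a loss. From any phase on, \<open>k\<close> phases pass without a win
  with probability at most 2^-k, so wins recur. Both estimates can be made phase by phase because
  almost surely each phase ends in a state that continues like \<open>Fresh\<close>.\<close>

lemma valid_imp:
  assumes "valid"
  shows "\<exists>w. (\<forall>i. w i \<le> k0) \<and> (AE c in coin. acc EvL EvW (st \<delta> Fresh w c))"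
proof -
  let ?F = "{Fresh, EvL, EvW} :: 'c mst set"
  let ?none = "\<lambda>_ :: 'c mst. None :: real option"
  let ?f = "\<lambda>q :: 'c mst. of_bool (q \<notin> ?F) :: real"
  let ?l = "\<lambda>q :: 'c mst. if q = EvL then Some (1 :: real) else None"
  let ?w = "\<lambda>q :: 'c mst. if q = EvW then Some (0 :: real) else None"
  have "\<forall>r. \<exists>u. u \<noteq> [] \<and> set u \<subseteq> {0..k0} \<and> ev \<delta> ?none ?f Fresh u = 0
    \<and> ev \<delta> ?l (\<lambda>_. 0) Fresh u \<le> (1 / 2) ^ r
    \<and> (\<forall>v. ev \<delta> ?w (\<lambda>_. 1) Fresh (u @ v) \<le> 1 / 2 * ev \<delta> ?w (\<lambda>_. 1) Fresh v)"
    using valid_phase[OF assms] by (intro allI) simp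
  then obtain X where X: "\<And>r. X r \<noteq> []" "\<And>r. set (X r) \<subseteq> {0..k0}"
    "\<And>r. ev \<delta> ?none ?f Fresh (X r) = 0" "\<And>r. ev \<delta> ?l (\<lambda>_. 0) Fresh (X r) \<le> (1 / 2) ^ r"
    "\<And>r v. ev \<delta> ?w (\<lambda>_. 1) Fresh (X r @ v) \<le> 1 / 2 * ev \<delta> ?w (\<lambda>_. 1) Fresh v"
    by metis
  define P where "P r = concat (map X [0..<r])" for r
  define T where "T r = length (P r)" for r
  \<comment> \<open>The phases are nonempty, so the first \<open>Suc i\<close> of them already
    contain position \<open>i\<close>.\<close>
  define w where "w i = P (Suc i) ! i" for i
  have P_Suc: "P (Suc r) = P r @ X r" for r by (simp add: P_def)
  have P_add: "\<exists>v. P (r + n) = P r @ v" for r n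
    by (induction n) (auto simp: P_Suc)
  have T_ge: "r \<le> T r" for r
  proof (induction r)
    case (Suc r)
    have "1 \<le> length (X r)" using X(1)[of r] by (cases "X r") auto
    then show ?case using Suc by (simp add: T_def P_Suc)
  qed simp
  have w_eq: "w i = P r ! i" if "i < T r" for i r
  proof -
    have i: "i < length (P (Suc i))" using T_ge[of "Suc i"] by (simp add: T_def)
    obtain v v' where v: "P (r + Suc i) = P r @ v" "P (Suc i + r) = P (Suc i) @ v'"
      using P_add by metis
    have "w i = (P (Suc i) @ v') ! i" using i by (simp add: w_def nth_append)
    also have "\<dots> = (P r @ v) ! i" using v by (metis add.commute)
    finally show ?thesis using that by (simp add: T_def nth_append)
  qed
  have w_seg: "map (\<lambda>i. w (T r + i)) [0..<n] = drop (T r) (P R)" if "T r + n = T R" for r n R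
    using that w_eq[of _ R] by (intro nth_equalityI) (auto simp: T_def)
  have w_X: "map (\<lambda>i. w (T r + i)) [0..<length (X r)] = X r" for r
    using w_seg[of r "length (X r)" "Suc r"] by (simp add: T_def P_Suc)
  have w_le: "w i \<le> k0" for i
  proof -
    have "w i \<in> set (P (Suc i))" unfolding w_def using T_ge[of "Suc i"] by (intro nth_mem) (simp add: T_def)
    then show ?thesis using X(2) by (fastforce simp: P_def)
  qed
  define wr where "wr r = (\<lambda>i. w (T r + i))" for r
  have st_T: "st \<delta> Fresh w c (T r + Suc i) = st \<delta> Fresh (wr r) (\<lambda>i. c (T r + i)) (Suc i)"
    if "st \<delta> Fresh w c (T r) \<in> ?F" for c r i
    unfolding st_add[of _ _ _ _ "T r"] wr_def by (rule st_fresh[OF that])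
  have A: "AE c in coin. \<forall>r. st \<delta> Fresh w c (T r) \<in> ?F"
  proof -
    have "AE c in coin. st \<delta> Fresh (wr r) (\<lambda>i. c (T r + i)) (length (X r)) \<in> ?F" for r
    proof (rule AE_shift)
      let ?A = "\<lambda>l. last (Fresh # trace \<delta> Fresh (X r) l) \<notin> ?F"
      have "measure coin {c. ?A (map c [0..<length (X r)])} = 0"
        unfolding measure_prefix[of ?A] using X(3)[of r] unfolding ev_last[of \<delta> "\<lambda>q. q \<notin> ?F"] .
      then have "AE c in coin. \<not> ?A (map c [0..<length (X r)])"
        by (rule coin_AE_not[OF sets_prefix])
      moreover have "last (Fresh # trace \<delta> Fresh (X r) (map c [0..<length (X r)])) = st \<delta> Fresh (wr r) c (length (X r))" for c
      proof -
        have "trace \<delta> Fresh (X r) (map c [0..<length (X r)]) = map (\<lambda>i. st \<delta> Fresh (wr r) c (Suc i)) [0..<length (X r)]"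
          using trace_st[of \<delta> Fresh "wr r" "length (X r)" c] unfolding wr_def w_X .
        then show ?thesis using X(1)[of r] by (simp add: last_map del: st.simps)
      qed
      ultimately show "AE c in coin. st \<delta> Fresh (wr r) c (length (X r)) \<in> ?F" by simp
    qed
    then have "AE c in coin. \<forall>r. st \<delta> Fresh (wr r) (\<lambda>i. c (T r + i)) (length (X r)) \<in> ?F"
      unfolding AE_all_countable by blast
    then show ?thesis
    proof eventually_elim
      fix c assume c: "\<forall>r. st \<delta> Fresh (wr r) (\<lambda>i. c (T r + i)) (length (X r)) \<in> ?F"
      show "\<forall>r. st \<delta> Fresh w c (T r) \<in> ?F"
      proof
        fix r show "st \<delta> Fresh w c (T r) \<in> ?F"
        proof (induction r)
          case (Suc r)
          obtain n where n: "length (X r) = Suc n" using X(1)[of r] by (cases "X r") auto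
          have "T (Suc r) = T r + Suc n" using n by (simp add: T_def P_Suc)
          then show ?case using st_T[OF Suc, of n] c n by metis
        qed (simp add: T_def P_def)
      qed
    qed
  qed
  have B: "AE c in coin. \<exists>R. \<forall>r\<ge>R. \<forall>i<length (X r). st \<delta> Fresh (wr r) (\<lambda>i. c (T r + i)) (Suc i) \<noteq> EvL"
  proof -
    define E where "E r = {c. EvL \<in> set (trace \<delta> Fresh (X r) (map c [0..<length (X r)]))}" for r
    define S where "S r = {c. (\<lambda>i. c (T r + i)) \<in> E r}" for r
    have E: "E r \<in> sets coin" for r unfolding E_def by (rule sets_prefix)
    have S: "S r = (\<lambda>c i. c (T r + i)) -` E r \<inter> space coin" for r
      by (auto simp: S_def)
    have S_sets: "S r \<in> sets coin" for r unfolding S using measurable_shift E by (rule measurable_sets)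
    have "measure coin (S r) = measure coin (E r)" for r
      unfolding S using measure_distr[OF measurable_shift E, of "T r"] by (simp add: distr_shift)
    also have "measure coin (E r) \<le> (1 / 2) ^ r" for r
      unfolding E_def measure_prefix[of "\<lambda>l. EvL \<in> set (trace \<delta> Fresh (X r) l)"]
      using X(4)[of r] by (subst ev_hit[symmetric]) auto
    finally have le: "measure coin (S r) \<le> (1 / 2) ^ r" for r .
    have "summable (\<lambda>r. measure coin (S r))"
      by (rule summable_comparison_test'[where g = "\<lambda>r. (1 / 2) ^ r" and N = 0])
        (auto simp: le intro: summable_geometric)
    then have "AE c in coin. eventually (\<lambda>r. c \<in> space coin - S r) sequentially"
      using S_sets by (intro borel_cantelli_AE1) (auto simp: coin.emeasure_eq_measure)
    then show ?thesis
    proof eventually_elim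
      fix c assume "eventually (\<lambda>r. c \<in> space coin - S r) sequentially"
      then obtain R where R: "\<forall>r\<ge>R. c \<notin> S r" by (auto simp: eventually_sequentially)
      have "st \<delta> Fresh (wr r) (\<lambda>i. c (T r + i)) (Suc i) \<noteq> EvL" if "r \<ge> R" "i < length (X r)" for r i
      proof -
        have "trace \<delta> Fresh (X r) (map (\<lambda>i. c (T r + i)) [0..<length (X r)])
          = map (\<lambda>i. st \<delta> Fresh (wr r) (\<lambda>i. c (T r + i)) (Suc i)) [0..<length (X r)]"
          using trace_st[of \<delta> Fresh "wr r" "length (X r)"] unfolding wr_def w_X .
        moreover have "EvL \<notin> set (trace \<delta> Fresh (X r) (map (\<lambda>i. c (T r + i)) [0..<length (X r)]))"
          using R that(1) by (simp add: S_def E_def)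
        moreover have "st \<delta> Fresh (wr r) (\<lambda>i. c (T r + i)) (Suc i)
          \<in> set (map (\<lambda>i. st \<delta> Fresh (wr r) (\<lambda>i. c (T r + i)) (Suc i)) [0..<length (X r)])"
          using that(2) by (simp del: st.simps)
        ultimately show ?thesis by metis
      qed
      then show "\<exists>R. \<forall>r\<ge>R. \<forall>i<length (X r). st \<delta> Fresh (wr r) (\<lambda>i. c (T r + i)) (Suc i) \<noteq> EvL" by blast
    qed
  qed
  have C: "AE c in coin. \<forall>r. \<exists>i. st \<delta> Fresh (wr r) (\<lambda>i. c (T r + i)) (Suc i) = EvW"
  proof -
    have "AE c in coin. \<exists>i. st \<delta> Fresh (wr r) c (Suc i) = EvW" for r
    proof -
      define Z where "Z = {c. \<forall>i. st \<delta> Fresh (wr r) c (Suc i) \<noteq> EvW}"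
      have "\<exists>B. Z \<subseteq> B \<and> B \<in> sets coin \<and> measure coin B \<le> (1 / 2) ^ k" for k
      proof -
        define Y where "Y = concat (map X [r..<r + k])"
        have "[0..<r + k] = [0..<r] @ [r..<r + k]" by (rule upt_add_eq_append) simp
        then have PY: "P (r + k) = P r @ Y" by (simp add: P_def Y_def)
        have Y: "map (wr r) [0..<length Y] = Y"
          using w_seg[of r "length Y" "r + k"] by (simp add: T_def PY wr_def)
        define B where "B = {c. EvW \<notin> set (trace \<delta> Fresh Y (map c [0..<length Y]))}"
        have "ev \<delta> ?w (\<lambda>_. 1) Fresh (concat (map X [r..<r + j])) \<le> (1 / 2) ^ j" for j
        proof (induction j arbitrary: r)
          case (Suc j)
          have "[r..<r + Suc j] = r # [Suc r..<Suc r + j]" by (simp add: upt_conv_Cons)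
          then show ?case using X(5)[of r "concat (map X [Suc r..<Suc r + j])"] Suc[of "Suc r"] by simp
        qed (simp add: ev.simps)
        then have "measure coin B \<le> (1 / 2) ^ k"
          unfolding B_def measure_prefix[of "\<lambda>l. EvW \<notin> set (trace \<delta> Fresh Y l)"]
          by (subst ev_avoid[symmetric]) (auto simp: Y_def)
        moreover have "Z \<subseteq> B"
          using trace_st[of \<delta> Fresh "wr r" "length Y"] unfolding Y B_def Z_def
          by (auto simp del: st.simps dest: sym)
        moreover have "B \<in> sets coin" unfolding B_def by (rule sets_prefix)
        ultimately show ?thesis by blast
      qed
      from coin_nullI[OF this] show ?thesis by (simp add: Z_def)
    qed
    then show ?thesis unfolding AE_all_countable by (intro allI AE_shift)
  qed
  from A B C have "AE c in coin. acc EvL EvW (st \<delta> Fresh w c)"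
  proof eventually_elim
    fix c
    assume a: "\<forall>r. st \<delta> Fresh w c (T r) \<in> ?F"
      and b: "\<exists>R. \<forall>r\<ge>R. \<forall>i<length (X r). st \<delta> Fresh (wr r) (\<lambda>i. c (T r + i)) (Suc i) \<noteq> EvL"
      and c: "\<forall>r. \<exists>i. st \<delta> Fresh (wr r) (\<lambda>i. c (T r + i)) (Suc i) = EvW"
    have "\<exists>i\<ge>n. st \<delta> Fresh w c i = EvW" for n
    proof -
      from c obtain i where "st \<delta> Fresh (wr n) (\<lambda>i. c (T n + i)) (Suc i) = EvW" by blast
      with a have "st \<delta> Fresh w c (T n + Suc i) = EvW" using st_T by metis
      moreover have "n \<le> T n + Suc i" using T_ge[of n] by simp
      ultimately show ?thesis by blast
    qed
    moreover from b obtain R where R: "\<And>r i. r \<ge> R \<Longrightarrow> i < length (X r) \<Longrightarrow>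
        st \<delta> Fresh (wr r) (\<lambda>i. c (T r + i)) (Suc i) \<noteq> EvL" by blast
    have "st \<delta> Fresh w c i \<noteq> EvL" if i: "T R < i" for i
    proof -
      \<comment> \<open>The phase whose letters produce the state at time \<open>i\<close>; the
        state at time \<open>T r\<close> still belongs to the phase before, hence the strict
        inequality.\<close>
      define r where "r = (GREATEST r. T r < i)"
      have bound: "r' \<le> i" if "T r' < i" for r' using T_ge[of r'] that by simp
      have r: "T r < i" unfolding r_def by (rule GreatestI_nat[of _ R i]) (use i bound in auto)
      have "R \<le> r" unfolding r_def by (rule Greatest_le_nat[of _ _ i]) (use i bound in auto)
      have "\<not> T (Suc r) < i"
      proof
        assume "T (Suc r) < i"
        then have "Suc r \<le> r" unfolding r_def by (intro Greatest_le_nat[of _ _ i]) (use bound in auto)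
        then show False by simp
      qed
      then have "i \<le> T r + length (X r)" by (simp add: T_def P_Suc)
      with r obtain j where j: "i = T r + Suc j" "j < length (X r)"
        by (metis add_less_cancel_left less_imp_Suc_add less_le_trans add_Suc_right lessI)
      have "st \<delta> Fresh w c i = st \<delta> Fresh (wr r) (\<lambda>i. c (T r + i)) (Suc j)"
        unfolding j(1) using a st_T by blast
      with R[OF \<open>R \<le> r\<close> j(2)] show ?thesis by metis
    qed
    then have "\<exists>m. \<forall>i\<ge>m. st \<delta> Fresh w c i \<noteq> EvL"
      by (intro exI[of _ "Suc (T R)"]) (auto simp: Suc_le_eq)
    ultimately show "acc EvL EvW (st \<delta> Fresh w c)" unfolding acc_def by blast
  qed
  with w_le show ?thesis by blast
qed

end

section \<open>From trees to words\<close>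

text \<open>State 0 is the loss with priority 1, state 1 the win with priority 2, and all others
  have the odd priority 3. Boundedness of \<open>r\<close> ensures that \<open>Min\<close> is taken
  over a finite nonempty set.\<close>

lemma parity_acc_iff:
  assumes r: "\<And>i. r i < n" and n: "2 \<le> n"
  shows "parity_acc (1 # 2 # replicate (n - 2) 3) r \<longleftrightarrow> acc 0 1 r"
proof -
  define p where "p = 1 # 2 # replicate (n - 2) (3 :: nat)"
  define I where "I = {q. \<exists>\<^sub>\<infinity> i. r i = q}"
  have p: "p ! 0 = 1" "p ! 1 = 2" "\<And>q. 2 \<le> q \<Longrightarrow> q < n \<Longrightarrow> p ! q = 3"
    using n by (auto simp: p_def nth_Cons' )
  have I_n: "q < n" if "q \<in> I" for q
    using that r by (auto simp: I_def dest: INFM_EX)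
  then have "I \<subseteq> {..<n}" by auto
  then have fin: "finite I" by (rule finite_subset) simp
  have "\<exists>q\<in>{..<n}. \<exists>\<^sub>\<infinity> i. r i = q"
  proof (rule ccontr)
    assume "\<not> ?thesis"
    then have "\<forall>q\<in>{..<n}. \<forall>\<^sub>\<infinity> i. r i \<noteq> q" by (simp add: not_INFM)
    then have "\<forall>\<^sub>\<infinity> i. \<forall>q\<in>{..<n}. r i \<noteq> q" by (simp add: eventually_ball_finite)
    then have "\<exists>i. \<forall>q\<in>{..<n}. r i \<noteq> q" by (auto simp: MOST_nat)
    then show False using r by auto
  qed
  then have ne: "I \<noteq> {}" by (auto simp: I_def)
  have set_eq: "{p ! q | q. \<exists>\<^sub>\<infinity> i. r i = q} = (\<lambda>q. p ! q) ` I" by (auto simp: I_def)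
  define S where "S = (\<lambda>q. p ! q) ` I"
  have I_cases: "q = 0 \<and> p ! q = 1 \<or> q = 1 \<and> p ! q = 2 \<or> 2 \<le> q \<and> p ! q = 3" if "q \<in> I" for q
  proof -
    consider "q = 0" | "q = 1" | "2 \<le> q" by linarith
    then show ?thesis using p I_n[OF that] by cases auto
  qed
  have S: "finite S" "S \<noteq> {}" using fin ne by (simp_all add: S_def)
  have S3: "S \<subseteq> {1, 2, 3}"
  proof
    fix x assume "x \<in> S"
    then obtain q where "q \<in> I" "x = p ! q" by (auto simp: S_def)
    with I_cases[of q] show "x \<in> {1, 2, 3}" by auto
  qed
  have S1: "1 \<in> S \<longleftrightarrow> 0 \<in> I"
  proof
    assume "1 \<in> S"
    then obtain q where "q \<in> I" "1 = p ! q" by (auto simp: S_def)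
    with I_cases[of q] show "0 \<in> I" by auto
  next
    assume "0 \<in> I"
    then have "p ! 0 \<in> S" unfolding S_def by (rule imageI)
    with p(1) show "1 \<in> S" by simp
  qed
  have S2: "2 \<in> S \<longleftrightarrow> 1 \<in> I"
  proof
    assume "2 \<in> S"
    then obtain q where "q \<in> I" "2 = p ! q" by (auto simp: S_def)
    with I_cases[of q] show "1 \<in> I" by auto
  next
    assume "1 \<in> I"
    then have "p ! 1 \<in> S" unfolding S_def by (rule imageI)
    with p(2) show "2 \<in> S" by simp
  qed
  have "even (Min S) \<longleftrightarrow> 2 \<in> S \<and> 1 \<notin> S"
  proof -
    have M: "Min S \<in> S" using S by simp
    with S3 consider "Min S = 1" | "Min S = 2" | "Min S = 3" by auto
    then show ?thesis
    proof cases
      case 2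
      have "1 \<notin> S" using Min_le[OF S(1), of 1] 2 by auto
      with M 2 show ?thesis by auto
    next
      case 3
      have "2 \<notin> S" using Min_le[OF S(1), of 2] 3 by auto
      with 3 show ?thesis by auto
    qed (use M in auto)
  qed
  then have "parity_acc p r \<longleftrightarrow> 1 \<in> I \<and> 0 \<notin> I"
    unfolding parity_acc_def set_eq S_def[symmetric] S1 S2 by blast
  also have "\<dots> \<longleftrightarrow> acc 0 1 r"
    by (auto simp: I_def acc_def INFM_nat_le)
  finally show ?thesis by (simp add: p_def)
qed

section \<open>Random exchange of successors\<close>

definition swap :: "(bool list \<Rightarrow> bool) \<Rightarrow> (nat \<Rightarrow> bool) \<Rightarrow> nat \<Rightarrow> bool" where
  "swap s c i = (c i \<noteq> s (map c [0..<i]))"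

lemma measurable_swap: "swap s \<in> coin \<rightarrow>\<^sub>M coin"
  unfolding coin_eq
proof (rule measurable_into_coins)
  fix i
  have "swap s c i = (map c [0..<Suc i] ! i \<noteq> s (butlast (map c [0..<Suc i])))" for c
    by (simp add: swap_def nth_append)
  then show "(\<lambda>c. swap s c i) \<in> coins TYPE(nat) \<rightarrow>\<^sub>M count_space UNIV"
    using measurable_prefix_fun[of "\<lambda>l. l ! i \<noteq> s (butlast l)" "Suc i"] by (simp add: coin_eq)
qed

text \<open>Each new bit is flipped or kept according to the earlier ones, so \<open>swap s\<close>
  permutes the words of every length and hence preserves the measure.\<close>

lemma swap_prefix: "length l = n \<Longrightarrow> \<exists>l'. length l' = n \<and> (\<forall>c. map (swap s c) [0..<n] = l \<longleftrightarrow> map c [0..<n] = l')"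
proof (induction n arbitrary: l)
  case (Suc n)
  then obtain x xs where l: "l = xs @ [x]" "length xs = n" by (metis length_Suc_conv_rev)
  with Suc.IH obtain xs' where xs': "length xs' = n" "\<And>c. map (swap s c) [0..<n] = xs \<longleftrightarrow> map c [0..<n] = xs'"
    by blast
  have "map (swap s c) [0..<Suc n] = l \<longleftrightarrow> map c [0..<Suc n] = xs' @ [x \<noteq> s xs']" for c
    using xs'(2)[of c] by (auto simp: l swap_def)
  with xs'(1) show ?case by (intro exI[of _ "xs' @ [x \<noteq> s xs']"]) auto
qed auto

lemma distr_swap: "distr coin coin (swap s) = coin"
proof (rule coin_eqI)
  fix l :: "bool list" and n assume l: "length l = n"
  from swap_prefix[OF this] obtain l' where l': "length l' = n"
    "\<And>c. map (swap s c) [0..<n] = l \<longleftrightarrow> map c [0..<n] = l'" by blast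
  have "{c. map c [0..<n] = l} \<in> sets coin" using sets_prefix[of "\<lambda>x. x = l"] by simp
  then have "emeasure (distr coin coin (swap s)) {c. map c [0..<n] = l}
      = emeasure coin {c. map (swap s c) [0..<n] = l}"
    by (subst emeasure_distr[OF measurable_swap]) (auto simp: vimage_def)
  then show "emeasure (distr coin coin (swap s)) {c. map c [0..<n] = l} = ennreal (1 / 2 ^ n)"
    unfolding l'(2) coin_prefix[OF l'(1)] .
qed simp

abbreviation "swaps \<equiv> coins TYPE(bool list)"

interpretation swaps: prob_space swaps
  by (rule prob_space_coins)

lemma measurable_swap2: "(\<lambda>s. swap s c) \<in> swaps \<rightarrow>\<^sub>M coin"
  unfolding coin_eq
proof (rule measurable_into_coins)
  fix i
  have "(\<lambda>s. (\<lambda>b. c i \<noteq> b) (s (map c [0..<i]))) \<in> swaps \<rightarrow>\<^sub>M count_space UNIV"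
    by (rule measurable_compose[OF measurable_coins_component]) simp
  then show "(\<lambda>s. swap s c i) \<in> swaps \<rightarrow>\<^sub>M count_space UNIV" by (simp add: swap_def)
qed

text \<open>The nodes on a branch have different lengths, so the swaps consulted along it are
  distinct coordinates and therefore independent.\<close>

lemma distr_swap2: "distr swaps coin (\<lambda>s. swap s c) = coin"
proof (rule coin_eqI)
  fix l :: "bool list" and n assume l: "length l = n"
  define J where "J = (\<lambda>i. map c [0..<i]) ` {..<n}"
  have inj: "inj_on (\<lambda>i. map c [0..<i]) {..<n}"
    by (rule inj_on_inverseI[where g = length]) simp
  have J: "finite J" "card J = n" by (auto simp: J_def card_image[OF inj])
  have "{c. map c [0..<n] = l} \<in> sets coin" using sets_prefix[of "\<lambda>x. x = l"] by simp
  then have "emeasure (distr swaps coin (\<lambda>s. swap s c)) {c. map c [0..<n] = l}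
      = emeasure swaps {s. map (swap s c) [0..<n] = l}"
    by (subst emeasure_distr[OF measurable_swap2]) (auto simp: vimage_def)
  also have "{s. map (swap s c) [0..<n] = l} = {s. \<forall>u\<in>J. s u = (c (length u) \<noteq> l ! length u)}"
    using l by (auto simp: J_def list_eq_iff_nth_eq swap_def)
  also have "emeasure swaps \<dots> = ennreal (1 / 2 ^ n)"
    using coins_finite[OF J(1)] J(2) by simp
  finally show "emeasure (distr swaps coin (\<lambda>s. swap s c)) {c. map c [0..<n] = l} = ennreal (1 / 2 ^ n)" .
qed simp

locale coin_automaton =
  fixes D :: "nat \<Rightarrow> nat \<Rightarrow> bool \<Rightarrow> nat" and n k :: nat and ts :: "(nat \<times> nat \<times> nat \<times> nat) list" and q0 :: nat
  assumes closed: "\<And>q a b. q < n \<Longrightarrow> a < k \<Longrightarrow> D q a b < n"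
    and ts: "set ts = {(q, a, D q a b, D q a (\<not> b)) | q a b. q < n \<and> a < k}"
    and q0: "q0 < n" and n: "2 \<le> n"
begin

definition "prio = 1 # 2 # replicate (n - 2) (3 :: nat)"

lemma qual_accepting_iff:
  assumes "\<And>u. \<rho> u < n"
  shows "qual_accepting (n, k, ts, q0, prio) \<rho> \<longleftrightarrow> (AE c in coin. acc 0 1 (along \<rho> c))"
proof -
  have "(\<lambda>c. along \<rho> c i) \<in> coin \<rightarrow>\<^sub>M count_space UNIV" for i
    unfolding along_def by (rule measurable_prefix_fun)
  from pred_acc[where X = "\<lambda>i c. along \<rho> c i" and N = coin, OF this]
  have meas: "{c \<in> space coin. acc 0 1 (along \<rho> c)} \<in> sets coin" by simp
  have "parity_acc prio (along \<rho> c) \<longleftrightarrow> acc 0 1 (along \<rho> c)" for c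
    unfolding prio_def by (rule parity_acc_iff) (auto simp: along_def assms n)
  moreover have "Measurable.pred coin (\<lambda>c. acc 0 1 (along \<rho> c))"
    using meas by (simp add: pred_def)
  ultimately show ?thesis by (simp add: coin.AE_iff_emeasure_eq_1)
qed

text \<open>Nodes of the tree grow at the end of the list, primitive recursion works at its
  head.\<close>

primrec swap_run_rev :: "(bool list \<Rightarrow> nat) \<Rightarrow> (bool list \<Rightarrow> bool) \<Rightarrow> bool list \<Rightarrow> nat" where
  "swap_run_rev t s [] = q0"
| "swap_run_rev t s (b # v) = D (swap_run_rev t s v) (t (rev v)) (b \<noteq> s (rev v))"

definition "swap_run t s u = swap_run_rev t s (rev u)"

lemma along_swap_run: "along (swap_run t s) c i = st D q0 (along t c) (swap s c) i"
  by (induction i) (simp_all add: along_def swap_run_def swap_def rev_map)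

lemma swap_run_less: "is_tree k t \<Longrightarrow> swap_run t s u < n"
proof -
  assume t: "is_tree k t"
  have "swap_run_rev t s v < n" for v
    by (induction v) (use t in \<open>auto simp: q0 is_tree_def intro: closed\<close>)
  then show ?thesis by (simp add: swap_run_def)
qed

lemma is_run_swap_run: "is_tree k t \<Longrightarrow> is_run (n, k, ts, q0, prio) t (swap_run t s)"
proof -
  assume t: "is_tree k t"
  have "(swap_run t s u, t u, swap_run t s (u @ [False]), swap_run t s (u @ [True])) \<in> set ts" for u
  proof -
    have "swap_run t s u < n" "t u < k" using swap_run_less[OF t] t by (auto simp: is_tree_def)
    then show ?thesis unfolding ts
      by (intro CollectI exI[of _ "swap_run t s u"] exI[of _ "t u"] exI[of _ "s u"]) (simp add: swap_run_def)
  qed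
  then show ?thesis by (simp add: swap_run_def)
qed

lemma measurable_swap_run: "(\<lambda>s. swap_run t s u) \<in> swaps \<rightarrow>\<^sub>M count_space UNIV"
proof -
  have "(\<lambda>s. swap_run_rev t s v) \<in> swaps \<rightarrow>\<^sub>M count_space UNIV" for v
  proof (induction v)
    case (Cons b v)
    have "(\<lambda>s. D x (t (rev v)) (b \<noteq> s (rev v))) \<in> swaps \<rightarrow>\<^sub>M count_space UNIV" for x
      by (rule measurable_compose[OF measurable_coins_component[of "rev v"], where g = "\<lambda>y. D x (t (rev v)) (b \<noteq> y)"]) simp
    from measurable_compose_countable[OF this Cons] show ?case by simp
  qed simp
  then show ?thesis by (simp add: swap_run_def)
qed

text \<open>For a fixed branch, swapping the successors at random yields independent fair coins; Fubini
  provides a branch along which almost all swaps are accepted.\<close>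

lemma nonempty_imp_word:
  assumes "t \<in> L_univ_qual (n, k, ts, q0, prio)"
  shows "\<exists>w. (\<forall>i. w i < k) \<and> (AE c in coin. acc 0 1 (st D q0 w c))"
proof -
  from assms have t: "is_tree k t" and all: "\<And>\<rho>. is_run (n, k, ts, q0, prio) t \<rho> \<Longrightarrow> qual_accepting (n, k, ts, q0, prio) \<rho>"
    by (auto simp del: is_run.simps qual_accepting.simps)
  have "AE c in coin. acc 0 1 (along (swap_run t s) c)" for s
    using all[OF is_run_swap_run[OF t, of s]] swap_run_less[OF t] by (simp add: qual_accepting_iff del: qual_accepting.simps)
  then have 1: "AE s in swaps. AE c in coin. acc 0 1 (along (swap_run t s) c)" by simp
  interpret pair_prob_space swaps coin ..
  have "(\<lambda>x. along (swap_run t (fst x)) (snd x) i) \<in> swaps \<Otimes>\<^sub>M coin \<rightarrow>\<^sub>M count_space UNIV" for i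
  proof -
    have "(\<lambda>x. swap_run t (fst x) u) \<in> swaps \<Otimes>\<^sub>M coin \<rightarrow>\<^sub>M count_space UNIV" for u
      by (rule measurable_compose[OF measurable_fst measurable_swap_run])
    moreover have "(\<lambda>x. map (snd x) [0..<i]) \<in> swaps \<Otimes>\<^sub>M coin \<rightarrow>\<^sub>M count_space UNIV"
      by (rule measurable_compose[OF measurable_snd measurable_prefix])
    ultimately show ?thesis unfolding along_def by (rule measurable_compose_countable)
  qed
  from pred_acc[where X = "\<lambda>i x. along (swap_run t (fst x)) (snd x) i", OF this]
  have "{x \<in> space (swaps \<Otimes>\<^sub>M coin). acc 0 1 (along (swap_run t (fst x)) (snd x))} \<in> sets (swaps \<Otimes>\<^sub>M coin)"
    by simp
  from AE_commute[OF this] 1 have "AE c in coin. AE s in swaps. acc 0 1 (along (swap_run t s) c)" by simp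
  then have "\<exists>c. AE s in swaps. acc 0 1 (along (swap_run t s) c)"
    using coin.AE_False by (metis (mono_tags, lifting) eventually_mono)
  then obtain c where c: "AE s in swaps. acc 0 1 (st D q0 (along t c) (swap s c))"
    by (auto simp: along_swap_run[abs_def])
  have "AE c' in distr swaps coin (\<lambda>s. swap s c). acc 0 1 (st D q0 (along t c) c')"
    using c pred_acc[where X = "\<lambda>i c'. st D q0 (along t c) c' i" and N = coin, OF measurable_st]
    by (subst AE_distr_iff[OF measurable_swap2]) auto
  then show ?thesis using t unfolding distr_swap2
    by (intro exI[of _ "along t c"]) (auto simp: is_tree_def along_def)
qed

text \<open>On a tree that is constant on each level, a run along a branch is the chain driven by
  the swapped flips of that branch, and swapping preserves the measure. So every run inherits almost
  sure acceptance.\<close>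

lemma word_imp_nonempty:
  assumes w: "\<And>i. w i < k" and ae: "AE c in coin. acc 0 1 (st D q0 w c)"
  shows "(\<lambda>u. w (length u)) \<in> L_univ_qual (n, k, ts, q0, prio)"
proof -
  have "qual_accepting (n, k, ts, q0, prio) \<rho>"
    if "is_run (n, k, ts, q0, prio) (\<lambda>u. w (length u)) \<rho>" for \<rho>
  proof -
    from that have \<rho>: "\<rho> [] = q0"
      "\<And>u. (\<rho> u, w (length u), \<rho> (u @ [False]), \<rho> (u @ [True])) \<in> set ts" by auto
    \<comment> \<open>Records in which order the run took the two successors at
      \<open>u\<close>.\<close>
    define s where "s u = (\<rho> (u @ [False]) \<noteq> D (\<rho> u) (w (length u)) False)" for u
    have step: "\<rho> (u @ [b]) = D (\<rho> u) (w (length u)) (b \<noteq> s u)" for u b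
    proof -
      from \<rho>(2)[of u] obtain b' where "\<rho> (u @ [False]) = D (\<rho> u) (w (length u)) b'"
        "\<rho> (u @ [True]) = D (\<rho> u) (w (length u)) (\<not> b')"
        unfolding ts by blast
      then show ?thesis
        by (cases "s u"; cases b; cases b') (auto simp: s_def)
    qed
    have eq: "along \<rho> c i = st D q0 w (swap s c) i" for c i
      by (induction i) (simp_all add: along_def \<rho>(1) step swap_def)
    have "\<rho> u < n" for u using \<rho>(2)[of u] unfolding ts by auto
    moreover have "AE c in coin. acc 0 1 (along \<rho> c)"
      using AE_distrD[OF measurable_swap[of s], of "\<lambda>c. acc 0 1 (st D q0 w c)"] ae
      unfolding distr_swap by (simp add: eq[abs_def])
    ultimately show ?thesis by (simp add: qual_accepting_iff del: qual_accepting.simps)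
  qed
  then show ?thesis using w by (simp add: is_tree_def del: is_run.simps qual_accepting.simps)
qed

lemma nonempty_iff: "L_univ_qual (n, k, ts, q0, prio) \<noteq> {} \<longleftrightarrow>
    (\<exists>w. (\<forall>i. w i < k) \<and> (AE c in coin. acc 0 1 (st D q0 w c)))"
  using nonempty_imp_word word_imp_nonempty by blast

end

section \<open>Encoding and diagonalisation\<close>

primrec idx :: "'a list \<Rightarrow> 'a \<Rightarrow> nat" where
  "idx [] x = 0"
| "idx (y # ys) x = (if y = x then 0 else Suc (idx ys x))"

lemma nth_idx: "x \<in> set xs \<Longrightarrow> xs ! idx xs x = x"
  by (induction xs) auto

lemma idx_less: "x \<in> set xs \<Longrightarrow> idx xs x < length xs"
  by (induction xs) auto

lemma idx_nth: "distinct xs \<Longrightarrow> i < length xs \<Longrightarrow> idx xs (xs ! i) = i"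
  by (simp add: idx_less nth_eq_iff_index_eq[symmetric] nth_idx)

lemma idx_append1: "x \<in> set xs \<Longrightarrow> idx (xs @ ys) x = idx xs x"
  by (induction xs) auto

text \<open>In the automaton, 3 is the number of \<open>Dead\<close>, 4 that of \<open>Launch\<close>, \<open>N\<close> that of the first control
  state and \<open>Suc N + i\<close> that of \<open>Chain i\<close>.\<close>

definition link :: "nat \<Rightarrow> nat \<Rightarrow> nat \<Rightarrow> (nat \<times> nat \<times> nat \<times> nat) list \<Rightarrow> (nat \<times> nat \<times> nat \<times> nat) list" where
  "link k0 q x L = (q, k0, x, 3) # (q, k0, 3, x) # rec_nat L (\<lambda>a y. (q, a, 3, 3) # y) k0"

definition chain_ts :: "nat \<Rightarrow> nat \<Rightarrow> nat \<Rightarrow> (nat \<times> nat \<times> nat \<times> nat) list \<Rightarrow> (nat \<times> nat \<times> nat \<times> nat) list" where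
  "chain_ts k0 N M L = link k0 4 (N + M) (rec_nat L (\<lambda>i y. link k0 (Suc N + i) (N + i) y) M)"

lemma set_link: "set (link k0 q x L) = {(q, k0, x, 3), (q, k0, 3, x)} \<union> {(q, a, 3, 3) | a. a < k0} \<union> set L"
proof -
  have "set (rec_nat L (\<lambda>a y. (q, a, 3, 3) # y) k) = {(q, a, 3, 3) | a. a < k} \<union> set L" for k :: nat
    by (induction k) (auto simp: less_Suc_eq)
  then show ?thesis by (auto simp: link_def)
qed

lemma mem_concat2: "t \<in> set (concat (map (\<lambda>q. concat (map (\<lambda>a. [F q a, G q a]) [0..<k])) xs))
    \<longleftrightarrow> (\<exists>q\<in>set xs. \<exists>a<k. t = F q a \<or> t = G q a)"
  by (simp add: Bex_def atLeast0LessThan)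

lemma set_link_eq:
  assumes "\<And>a b. D q a b = (if a = k \<and> \<not> b then x else 3)"
  shows "set (link k q x []) = {(q, a, D q a b, D q a (\<not> b)) | a b. a < Suc k}"
proof (rule set_eqI)
  fix t
  have "t \<in> {(q, a, D q a b, D q a (\<not> b)) | a b. a < Suc k} \<longleftrightarrow>
    (\<exists>a<Suc k. t = (q, a, 3, if a = k then x else 3) \<or> t = (q, a, if a = k then x else 3, 3))"
    unfolding mem_Collect_eq ex_bool_eq assms by auto
  also have "\<dots> \<longleftrightarrow> t \<in> set (link k q x [])"
    unfolding set_link by (auto simp: less_Suc_eq)
  finally show "t \<in> set (link k q x []) \<longleftrightarrow> t \<in> {(q, a, D q a b, D q a (\<not> b)) | a b. a < Suc k}"
    by simp
qed

lemma set_chain_ts: "set (chain_ts k0 N M L) = set (link k0 4 (N + M) []) \<union>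
    (\<Union>i<M. set (link k0 (Suc N + i) (N + i) [])) \<union> set L"
proof -
  have "set (rec_nat L (\<lambda>i y. link k0 (Suc N + i) (N + i) y) M)
      = (\<Union>i<M. set (link k0 (Suc N + i) (N + i) [])) \<union> set L"
    by (induction M) (auto simp: set_link lessThan_Suc)
  then show ?thesis by (auto simp: chain_ts_def set_link)
qed

definition push :: "nat \<Rightarrow> nat \<Rightarrow> nat" where
  "push x L = Suc (prod_encode (x, L))"

text \<open>The counterpart of \<open>link\<close> on list codes; both use \<open>rec_nat\<close>,
  so the correspondence is immediate and \<open>computable_rec\<close> applies.\<close>

definition link_code :: "nat \<Rightarrow> nat \<Rightarrow> nat \<Rightarrow> nat \<Rightarrow> nat" where
  "link_code k0 q x L = push (enc4 (q, k0, x, 3)) (push (enc4 (q, k0, 3, x))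
     (rec_nat L (\<lambda>a y. push (enc4 (q, a, 3, 3)) y) k0))"

definition chain_code :: "nat \<Rightarrow> nat \<Rightarrow> nat \<Rightarrow> nat \<Rightarrow> nat" where
  "chain_code k0 N M L = link_code k0 4 (N + M) (rec_nat L (\<lambda>i y. link_code k0 (Suc N + i) (N + i) y) M)"

lemma link_code: "list_encode (map enc4 (link k0 q x L)) = link_code k0 q x (list_encode (map enc4 L))"
proof -
  have "list_encode (map enc4 (rec_nat L (\<lambda>a y. (q, a, 3, 3) # y) k))
      = rec_nat (list_encode (map enc4 L)) (\<lambda>a y. push (enc4 (q, a, 3, 3)) y) k" for k :: nat
    by (induction k) (simp_all add: push_def)
  then show ?thesis by (simp add: link_def link_code_def push_def)
qed

lemma chain_code: "list_encode (map enc4 (chain_ts k0 N M L)) = chain_code k0 N M (list_encode (map enc4 L))"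
proof -
  have "list_encode (map enc4 (rec_nat L (\<lambda>i y. link k0 (Suc N + i) (N + i) y) M))
      = rec_nat (list_encode (map enc4 L)) (\<lambda>i y. link_code k0 (Suc N + i) (N + i) y) M"
    by (induction M) (simp_all add: link_code)
  then show ?thesis by (simp add: chain_ts_def chain_code_def link_code)
qed

text \<open>The self-reference: \<open>m\<close> is the code of the three arguments, and the chain
  of \<open>2 * m + 1\<close> states attached to this fixed part spells that code. There are
  \<open>Suc N\<close> other states, and the initial state 2 is \<open>Fresh\<close>.\<close>

definition pta_code :: "nat \<Rightarrow> nat \<Rightarrow> nat \<Rightarrow> nat" where
  "pta_code N k0 L = (let m = prod_encode (N, prod_encode (k0, L)) in
     prod_encode (Suc (N + Suc (m + m)), prod_encode (Suc k0, prod_encode (chain_code k0 N (Suc (m + m)) L,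
       prod_encode (2, push 1 (push 2 (rec_nat 0 (\<lambda>i y. push 3 y) (N + (m + m)))))))))"

lemma pta_code:
  assumes "m = prod_encode (N, prod_encode (k0, list_encode (map enc4 L)))"
  shows "pta_encode (Suc (N + Suc (m + m)), Suc k0, chain_ts k0 N (Suc (m + m)) L, 2,
      1 # 2 # replicate (N + (m + m)) 3) = pta_code N k0 (list_encode (map enc4 L))"
proof -
  have "list_encode (replicate j 3) = rec_nat 0 (\<lambda>i y. push 3 y) j" for j
    by (induction j) (simp_all add: push_def)
  then show ?thesis by (simp add: pta_code_def Let_def assms chain_code push_def del: prod_encode_def)
qed

lemma computable_push:
  "computable n F \<Longrightarrow> computable n G \<Longrightarrow> computable n (\<lambda>xs. push (F xs) (G xs))"
  unfolding push_def by (intro computable_intros)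

lemma computable_enc4:
  "computable n F \<Longrightarrow> computable n G \<Longrightarrow> computable n H \<Longrightarrow> computable n K \<Longrightarrow>
    computable n (\<lambda>xs. enc4 (F xs, G xs, H xs, K xs))"
  unfolding enc4.simps by (intro computable_intros)

lemma computable_pta_code: "computable 3 (\<lambda>xs. pta_code (xs ! 0) (xs ! 1) (xs ! 2))"
  unfolding pta_code_def chain_code_def link_code_def Let_def
  by (intro computable_intros computable_push computable_enc4;
      (simp only: drop_drop)?; (intro computable_intros computable_push computable_enc4)?; simp?)

section \<open>Numbering the states\<close>

context machine
begin

text \<open>\<open>Chain\<close> states are left out, so that the set does not depend on
  \<open>m\<close>.\<close>

definition states :: "'c mst set" where
  "states = {EvL, EvW, Fresh, Dead, Launch} \<union> range Init \<union> {Walk \<sigma> i j | \<sigma> i j. i < R \<and> j < R}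
     \<union> range WAcc \<union> range LAcc \<union> Ctl ` ({cs, cf} \<union> fst ` set es \<union> (\<lambda>e. snd (snd e)) ` set es)"

definition all_states :: "'c mst set" where
  "all_states = states \<union> (\<lambda>(x, y). Mid x y) ` (states \<times> states)"

lemma finite_states: "finite all_states"
proof -
  have "{Walk \<sigma> i j :: 'c mst | \<sigma> i j. i < R \<and> j < R} = (\<lambda>(\<sigma>, i, j). Walk \<sigma> i j) ` (UNIV \<times> {..<R} \<times> {..<R})"
    by force
  then have "finite states" by (simp add: states_def)
  then show ?thesis by (simp add: all_states_def)
qed

lemma moves_less: "regs a \<subseteq> {..<R} \<Longrightarrow> i < R \<Longrightarrow> j \<in> set (moves a i) \<Longrightarrow> j < R"
  by (cases a) (auto split: if_splits)

lemma tests_states: "o' \<in> set (tests a \<sigma> i j) \<Longrightarrow> o' \<in> states"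
  by (cases a) (auto simp: states_def split: if_splits)

lemma outs_states:
  assumes "q \<in> states" "is_macro q" "o' \<in> set (outs es cf q a)"
  shows "o' \<in> states"
proof (cases q)
  case (Walk \<sigma> i j)
  then have ij: "i < R" "j < R" using assms(1) by (auto simp: states_def)
  consider "a = 0" | "a = 1" | "2 \<le> a" by linarith
  then show ?thesis
  proof cases
    case 3
    have "regs (act a) \<subseteq> {..<R}" using 3 by (rule regs_act)
    then have m: "i' < R" if "i' \<in> set (moves (act a) i)" "i < R" for i' i
      using moves_less that by blast
    from 3 assms(3) consider "o' \<in> set (tests (act a) \<sigma> i j)"
      | i' j' where "i' \<in> set (moves (act a) i)" "j' \<in> set (moves (act a) j)" "o' = Walk \<sigma> i' j'"
      unfolding Walk by auto
    then show ?thesis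
    proof cases
      case 1
      then show ?thesis by (rule tests_states)
    next
      case 2
      then show ?thesis using m ij by (simp add: states_def)
    qed
  qed (use assms(3) R in \<open>auto simp: Walk states_def\<close>)
next
  case (Ctl c)
  have "es ! (a - 2) \<in> set es" if "a \<noteq> 0" "a \<noteq> 1" "a < k0" for a
    using that by (intro nth_mem) linarith
  then show ?thesis using assms(3) by (auto simp: Ctl states_def split: if_splits)
qed (use assms R in \<open>auto simp: states_def split: if_splits\<close>)

lemma Chain_notin: "Chain i \<notin> all_states"
  by (auto simp: all_states_def states_def)

lemma Mid_in: "Mid x y \<in> all_states \<Longrightarrow> x \<in> states \<and> y \<in> states"
proof -
  have "Mid x y \<notin> states" by (auto simp: states_def)
  then show "Mid x y \<in> all_states \<Longrightarrow> x \<in> states \<and> y \<in> states"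
    unfolding all_states_def by auto
qed

lemma delta_states:
  assumes "q \<in> all_states" "q \<noteq> Launch"
  shows "\<delta> q a b \<in> all_states"
proof (cases "is_macro q")
  case True
  then have q: "q \<in> states" using assms(1) by (auto simp: all_states_def)
  define l where "l = outs es cf q a @ replicate 4 Dead"
  have \<delta>: "\<delta> q a b = (if b then Mid (l ! 2) (l ! 3) else Mid (l ! 0) (l ! 1))"
    using True by (cases q) (simp_all add: l_def Let_def del: outs.simps)
  have "Dead \<in> states" by (simp add: states_def)
  then have "set l \<subseteq> states" using outs_states[OF q True] by (auto simp: l_def)
  moreover have "4 \<le> length l" by (simp add: l_def)
  ultimately have "l ! i \<in> states" if "i < 4" for i
    using that by (meson less_le_trans nth_mem subsetD)
  then have "l ! 0 \<in> states" "l ! 1 \<in> states" "l ! 2 \<in> states" "l ! 3 \<in> states" by simp_all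
  then show ?thesis unfolding \<delta> all_states_def by force
next
  case False
  have D: "Dead \<in> all_states" "Mid Fresh Fresh \<in> all_states"
    by (auto simp: all_states_def states_def)
  from False assms(2) consider "q = Dead" | i where "q = Chain i" | x y where "q = Mid x y"
    by (cases q) auto
  then show ?thesis
  proof cases
    case 1
    with D show ?thesis by simp
  next
    case 2
    with assms(1) show ?thesis by (simp add: Chain_notin)
  next
    case 3
    with assms(1) Mid_in[of x y] show ?thesis by (auto simp: all_states_def)
  qed
qed

text \<open>Only \<open>Launch\<close> knows the length of the chain. The transition table of the
  remaining states can thus be written down before \<open>m\<close> is chosen, which is what allows
  \<open>m\<close> to encode it.\<close>

lemma delta_m: "q \<in> all_states \<Longrightarrow> q \<noteq> Launch \<Longrightarrow> \<delta> q a b = delta es cs cf 0 q a b"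
  by (cases q) (simp_all add: Chain_notin del: outs.simps)

definition base_ts :: "'c mst list \<Rightarrow> (nat \<times> nat \<times> nat \<times> nat) list" where
  "base_ts base = concat (map (\<lambda>q. concat (map (\<lambda>a.
     [(idx base q, a, idx base (delta es cs cf 0 q a False), idx base (delta es cs cf 0 q a True)),
      (idx base q, a, idx base (delta es cs cf 0 q a True), idx base (delta es cs cf 0 q a False))])
     [0..<Suc k0])) (removeAll Launch base))"

text \<open>The first places of \<open>base\<close> match the priorities, the initial state and the
  numbers used by \<open>link\<close>. \<open>Ctl cs\<close> comes last so that, with the chain
  appended, \<open>cst cs i\<close> has the number \<open>N + i\<close> also for
  \<open>i = 0\<close>.\<close>

lemma automaton_nonempty_iff:
  assumes base: "base = [EvL, EvW, Fresh, Dead, Launch] @ rest @ [Ctl cs]" "distinct base" "set base = all_states"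
    and N: "length base = Suc N"
  defines "A \<equiv> (Suc (N + Suc (m + m)), Suc k0, chain_ts k0 N (Suc (m + m)) (base_ts base), 2,
      1 # 2 # replicate (N + (m + m)) 3)"
  shows "pta_wf A" and "L_univ_qual A \<noteq> {} \<longleftrightarrow> valid"
proof -
  define M where "M = Suc (m + m)"
  define ls where "ls = base @ map Chain [0..<M]"
  define D where "D q a b = idx ls (\<delta> (ls ! q) a b)" for q a b
  define n where "n = Suc N + M"
  have len: "length ls = n" by (simp add: ls_def n_def N)
  have dist: "distinct ls"
    using base(2) Chain_notin by (auto simp: ls_def base(3) distinct_map inj_on_def)
  have closed_ls: "\<delta> q a b \<in> set ls" if q: "q \<in> set ls" for q a b
  proof -
    have Dead: "Dead \<in> set ls" and cs: "Ctl cs \<in> set ls" by (auto simp: ls_def base(1))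
    have ch: "cst cs i \<in> set ls" if "i \<le> M" for i
      using that cs by (cases i) (auto simp: ls_def)
    from q consider "q \<in> all_states" "q \<noteq> Launch" | "q = Launch" | i where "q = Chain i" "i < M"
      unfolding ls_def by (auto simp: base(3))
    then show ?thesis
    proof cases
      case 1
      from delta_states[OF this] show ?thesis by (simp add: ls_def base(3))
    next
      case 2
      then show ?thesis using ch[of "2 * m + 1"] Dead by (auto simp: M_def)
    next
      case 3
      then show ?thesis using ch[of i] Dead by auto
    qed
  qed
  have D_less: "D q a b < n" if "q < n" for q a b
    using that closed_ls[of "ls ! q"] idx_less len by (metis D_def nth_mem)
  have idx_base: "idx ls q = idx base q" if "q \<in> all_states" for q
    using that by (simp add: ls_def idx_append1 base(3))
  have idx_Dead: "idx ls Dead = 3" by (simp add: ls_def base(1))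
  have idx_cst: "idx ls (cst cs i) = N + i" if "i \<le> M" for i
  proof (cases i)
    case 0
    have "base ! N = Ctl cs" using N by (auto simp: base(1) nth_append)
    then have "idx base (Ctl cs) = N" using idx_nth[OF base(2), of N] N by simp
    moreover have "Ctl cs \<in> set base" by (simp add: base(1))
    ultimately show ?thesis by (simp add: idx_base base(3) 0)
  next
    case (Suc j)
    have "ls ! (Suc N + j) = Chain j" using that N Suc by (simp add: ls_def nth_append)
    then show ?thesis using idx_nth[OF dist, of "Suc N + j"] that by (simp add: Suc len n_def)
  qed
  have link_launch: "set (link k0 4 (N + M) []) = {(4, a, D 4 a b, D 4 a (\<not> b)) | a b. a < Suc k0}"
  proof (rule set_link_eq)
    have "ls ! 4 = Launch" by (simp add: ls_def base(1))
    moreover have "idx ls (cst cs (2 * m + 1)) = N + M"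
      using idx_cst[of "2 * m + 1"] by (simp add: M_def mult_2)
    ultimately show "D 4 a b = (if a = k0 \<and> \<not> b then N + M else 3)" for a b
      by (simp add: D_def idx_Dead)
  qed
  have link_chain: "set (link k0 (Suc N + i) (N + i) []) = {(Suc N + i, a, D (Suc N + i) a b, D (Suc N + i) a (\<not> b)) | a b. a < Suc k0}"
    if "i < M" for i
  proof (rule set_link_eq)
    have "ls ! (Suc N + i) = Chain i" using that N by (simp add: ls_def nth_append)
    then show "D (Suc N + i) a b = (if a = k0 \<and> \<not> b then N + i else 3)" for a b
      using idx_cst[of i] that by (simp add: D_def idx_Dead)
  qed
  have N4: "4 < Suc N" unfolding N[symmetric] by (simp add: base(1))
  have base_ts: "set (base_ts base) = {(q, a, D q a b, D q a (\<not> b)) | q a b. q < Suc N \<and> q \<noteq> 4 \<and> a < Suc k0}"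
  proof -
    have step: "idx base (delta es cs cf 0 s a b) = D (idx base s) a b"
      if "s \<in> set base" "s \<noteq> Launch" for s a b
    proof -
      have s: "s \<in> all_states" using that(1) base(3) by simp
      have "ls ! idx base s = s" using s idx_base[of s] nth_idx[of s ls] by (simp add: ls_def base(3))
      then show ?thesis using idx_base[OF delta_states[OF s that(2)]] delta_m[OF s that(2)] by (simp add: D_def)
    qed
    have L4: "base ! 4 = Launch" by (simp add: base(1))
    have img: "idx base ` (set base - {Launch}) = {q. q < Suc N \<and> q \<noteq> 4}"
    proof (intro equalityI subsetI)
      fix i assume "i \<in> idx base ` (set base - {Launch})"
      then obtain s where s: "s \<in> set base" "s \<noteq> Launch" "i = idx base s" by auto
      then have "base ! i = s" "i < Suc N" using nth_idx[OF s(1)] idx_less[OF s(1)] N by auto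
      with s(2) L4 show "i \<in> {q. q < Suc N \<and> q \<noteq> 4}" by auto
    next
      fix i assume i: "i \<in> {q. q < Suc N \<and> q \<noteq> 4}"
      then have "base ! i \<noteq> base ! 4" using N4 base(2) N by (simp add: nth_eq_iff_index_eq)
      moreover have "base ! i \<in> set base" using i N by (intro nth_mem) simp
      moreover have "i = idx base (base ! i)" using idx_nth[OF base(2), of i] i N by simp
      ultimately show "i \<in> idx base ` (set base - {Launch})" using L4 by auto
    qed
    define F where "F q t \<longleftrightarrow> (\<exists>a<Suc k0. t = (q, a, D q a False, D q a True) \<or> t = (q, a, D q a True, D q a False))" for q t
    have "t \<in> set (base_ts base) \<longleftrightarrow> (\<exists>s\<in>set base - {Launch}. F (idx base s) t)" for t
    proof -
      have "t \<in> set (base_ts base) \<longleftrightarrow> (\<exists>s\<in>set base - {Launch}. \<exists>a<Suc k0.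
        t = (idx base s, a, idx base (delta es cs cf 0 s a False), idx base (delta es cs cf 0 s a True)) \<or>
        t = (idx base s, a, idx base (delta es cs cf 0 s a True), idx base (delta es cs cf 0 s a False)))"
        unfolding base_ts_def mem_concat2 by simp
      also have "\<dots> \<longleftrightarrow> (\<exists>s\<in>set base - {Launch}. F (idx base s) t)"
        unfolding F_def by (intro bex_cong refl) (simp add: step)
      finally show ?thesis .
    qed
    also have "(\<exists>s\<in>set base - {Launch}. F (idx base s) t) \<longleftrightarrow> (\<exists>q\<in>{q. q < Suc N \<and> q \<noteq> 4}. F q t)" for t
      unfolding img[symmetric] by blast
    also have "\<dots> t \<longleftrightarrow> t \<in> {(q, a, D q a b, D q a (\<not> b)) | q a b. q < Suc N \<and> q \<noteq> 4 \<and> a < Suc k0}" for t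
      unfolding F_def mem_Collect_eq ex_bool_eq by auto
    finally show ?thesis by blast
  qed
  have ts: "set (chain_ts k0 N M (base_ts base)) = {(q, a, D q a b, D q a (\<not> b)) | q a b. q < n \<and> a < Suc k0}"
    (is "?l = ?r")
  proof -
    have split: "q < n \<longleftrightarrow> q = 4 \<or> (\<exists>i<M. q = Suc N + i) \<or> (q < Suc N \<and> q \<noteq> 4)" for q
      using N4 by (auto simp: n_def) (metis add_Suc less_iff_Suc_add not_less_eq add_less_cancel_left linorder_neqE_nat plus_nat.simps(2) le_add_diff_inverse leI)
    have "?l = {(4, a, D 4 a b, D 4 a (\<not> b)) | a b. a < Suc k0}
      \<union> (\<Union>i<M. {(Suc N + i, a, D (Suc N + i) a b, D (Suc N + i) a (\<not> b)) | a b. a < Suc k0})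
      \<union> {(q, a, D q a b, D q a (\<not> b)) | q a b. q < Suc N \<and> q \<noteq> 4 \<and> a < Suc k0}"
      unfolding set_chain_ts link_launch base_ts using link_chain by simp
    also have "\<dots> = ?r" unfolding split by blast
    finally show ?thesis .
  qed
  have nf: "n - 2 = N + (m + m)" "2 \<le> n" "2 < n" using N4 by (auto simp: n_def M_def)
  interpret coin_automaton D n "Suc k0" "chain_ts k0 N M (base_ts base)" 2
  proof unfold_locales
    show "D q a b < n" if "q < n" for q a b using that by (rule D_less)
  qed (fact ts nf)+
  have A: "A = (n, Suc k0, chain_ts k0 N M (base_ts base), 2, prio)"
    by (simp add: A_def prio_def nf(1)) (simp add: n_def M_def)
  show "pta_wf A" unfolding A using nf ts D_less by (auto simp: prio_def)
  have st: "st D 2 w c i < n \<and> ls ! st D 2 w c i = st \<delta> Fresh w c i" for w c i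
  proof (induction i)
    case 0
    show ?case using nf(3) by (simp add: ls_def base(1))
  next
    case (Suc i)
    then have "ls ! st D 2 w c i \<in> set ls" using len by (intro nth_mem) simp
    from closed_ls[OF this] Suc have "\<delta> (st \<delta> Fresh w c i) (w i) (c i) \<in> set ls" by simp
    moreover have "D (st D 2 w c i) (w i) (c i) = idx ls (\<delta> (st \<delta> Fresh w c i) (w i) (c i))"
      unfolding D_def[of "st D 2 w c i"] using Suc by simp
    moreover have "D (st D 2 w c i) (w i) (c i) < n" using Suc by (intro D_less) simp
    ultimately show ?case by (simp add: nth_idx)
  qed
  have ls01: "ls ! 0 = EvL" "ls ! 1 = EvW" by (simp_all add: ls_def base(1))
  have eq: "st D 2 w c i = j \<longleftrightarrow> st \<delta> Fresh w c i = ls ! j" if "j < n" for w c i j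
    using st[of w c i] nth_eq_iff_index_eq[OF dist, of "st D 2 w c i" j] len that by auto
  have "acc 0 1 (st D 2 w c) \<longleftrightarrow> acc EvL EvW (st \<delta> Fresh w c)" for w c
    using eq[of 0] eq[of 1] nf(2) unfolding acc_def ls01 by simp
  then have "L_univ_qual A \<noteq> {} \<longleftrightarrow> (\<exists>w. (\<forall>i. w i < Suc k0) \<and> (AE c in coin. acc EvL EvW (st \<delta> Fresh w c)))"
    unfolding A nonempty_iff by simp
  also have "\<dots> \<longleftrightarrow> valid"
    using valid_imp not_valid_imp by (auto simp: less_Suc_eq_le)
  finally show "L_univ_qual A \<noteq> {} \<longleftrightarrow> valid" .
qed

end

section \<open>Diagonalisation\<close>

fun act_regs :: "prog \<Rightarrow> nat set" where
  "act_regs (Act a) = regs a"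
| "act_regs (Seq p q) = act_regs p \<union> act_regs q"
| "act_regs (Star p) = act_regs p"

lemma finite_act_regs: "finite (act_regs p)"
proof (induction p)
  case (Act a)
  show ?case by (cases a) auto
qed auto

lemma edges_regs: "(K, a, K') \<in> edges p K0 \<Longrightarrow> regs a \<subseteq> insert 0 (act_regs p)"
  by (induction p arbitrary: K0) auto

text \<open>The input is a single number, but \<open>g\<close> wants three. The program guesses
  them, recomputes their code with \<open>e\<close> and compares it with the input in register 1, so
  no decoding has to be programmed. The successor accounts for the \<open>m + 1\<close> increments
  that a chain with parameter \<open>m\<close> enforces.\<close>

lemma ex_program:
  assumes pair: "\<And>a b c. eval e [a, b, c] (Suc (prod_encode (a, prod_encode (b, c))))"
  shows "\<exists>P. \<forall>a b c. (\<exists>s'. sem P (init (Suc (prod_encode (a, prod_encode (b, c))))) s') \<longleftrightarrow> eval g [a, b, c] 1"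
proof -
  obtain p1 where p1: "computes p1 e [2, 3, 4] 5 7"
    using ex_computes[of "[2, 3, 4]" 7 5 e] by auto
  obtain p2 where p2: "computes p2 g [2, 3, 4] 6 7"
    using ex_computes[of "[2, 3, 4]" 7 6 g] by auto
  define guess where "guess r = Star (Act (Add r 0))" for r
  define P where "P = Seq (guess 2) (Seq (guess 3) (Seq (guess 4) (Seq p1 (Seq (Act (Tst 5 1)) (Seq p2 (Act (Tst 6 0)))))))"
  have "(\<exists>s'. sem P (init (Suc (prod_encode (a, prod_encode (b, c))))) s') \<longleftrightarrow> eval g [a, b, c] 1" for a b c
  proof
    define X where "X = Suc (prod_encode (a, prod_encode (b, c)))"
    assume "\<exists>s'. sem P (init (Suc (prod_encode (a, prod_encode (b, c))))) s'"
    then obtain s1 s2 s3 s4 s5 where s: "sem (guess 2) (init X) s1" "sem (guess 3) s1 s2" "sem (guess 4) s2 s3"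
      "sem p1 s3 s4" "s4 5 = s4 1" "sem p2 s4 s5" "s5 6 = s5 0"
      by (auto simp: P_def X_def guess_def simp del: sem.simps(3))
    obtain a' where s1: "s1 = (init X)(2 := a')"
      using guess_sem[OF s(1)[unfolded guess_def]] by (auto simp: init_def)
    obtain b' where s2: "s2 = s1(3 := b')"
      using guess_sem[OF s(2)[unfolded guess_def]] by (auto simp: init_def s1)
    obtain c' where s3: "s3 = s2(4 := c')"
      using guess_sem[OF s(3)[unfolded guess_def]] by (auto simp: init_def s1 s2)
    have r3: "s3 0 = 1" "s3 1 = X" "map s3 [2, 3, 4] = [a', b', c']"
      by (auto simp: s3 s2 s1 init_def)
    note c1 = computesD[OF p1 r3(1) s(4)]
    have r4: "s4 0 = 1" "s4 1 = X" "map s4 [2, 3, 4] = [a', b', c']"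
      using c1(1) r3 by auto
    note c2 = computesD[OF p2 r4(1) s(6)]
    have "s4 5 = Suc (prod_encode (a', prod_encode (b', c')))"
      using eval_functional[OF c1(2)] pair[of a' b' c'] unfolding r3(3) by blast
    then have abc: "a' = a" "b' = b" "c' = c" using s(5) r4(2) by (auto simp: X_def)
    have "s5 6 = 1" using s(7) c2(1)[of 0] r4(1) by simp
    with c2(2) show "eval g [a, b, c] 1" unfolding r4(3) abc by simp
  next
    define X where "X = Suc (prod_encode (a, prod_encode (b, c)))"
    assume ev: "eval g [a, b, c] 1"
    define s1 s2 s3 where "s1 = (init X)(2 := a)" and "s2 = s1(3 := b)" and "s3 = s2(4 := c)"
    have s: "sem (guess 2) (init X) s1" "sem (guess 3) s1 s2" "sem (guess 4) s2 s3"
      unfolding guess_def s1_def s2_def s3_def by (rule sem_guess; simp add: init_def)+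
    have r3: "s3 0 = 1" "s3 1 = X" "map s3 [2, 3, 4] = [a, b, c]"
      by (auto simp: s3_def s2_def s1_def init_def)
    obtain s4 where s4: "sem p1 s3 s4" "s4 5 = X" "\<And>r. r < 7 \<Longrightarrow> r \<noteq> 5 \<Longrightarrow> s4 r = s3 r"
      using computesE[OF p1, of s3 X] r3 pair[of a b c] unfolding X_def by metis
    have r4: "s4 0 = 1" "s4 1 = X" "map s4 [2, 3, 4] = [a, b, c]"
      using s4(3) r3 by auto
    obtain s5 where s5: "sem p2 s4 s5" "s5 6 = 1" "\<And>r. r < 7 \<Longrightarrow> r \<noteq> 6 \<Longrightarrow> s5 r = s4 r"
      using computesE[OF p2, of s4 1] r4 ev by metis
    have "s5 0 = 1" using s5(3)[of 0] r4 by simp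
    with s s4 s5 r4 have "sem P (init X) s5"
      unfolding P_def sem.simps(2) by (intro exI conjI) (assumption | simp)+
    then show "\<exists>s'. sem P (init (Suc (prod_encode (a, prod_encode (b, c))))) s'" unfolding X_def by blast
  qed
  then show ?thesis by blast
qed

theorem theorem3p11:
  shows "\<not> (\<exists>f. \<forall>A. pta_wf A \<longrightarrow>
           eval f [pta_encode A] (if L_univ_qual A = {} then 1 else 0))"
proof
  assume "\<exists>f. \<forall>A. pta_wf A \<longrightarrow> eval f [pta_encode A] (if L_univ_qual A = {} then 1 else 0)"
  then obtain f where f: "\<And>A. pta_wf A \<Longrightarrow> eval f [pta_encode A] (if L_univ_qual A = {} then 1 else 0)"
    by blast
  obtain e where e: "\<And>xs. length xs = 3 \<Longrightarrow> eval e xs (pta_code (xs ! 0) (xs ! 1) (xs ! 2))"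
    using computable_pta_code unfolding computable_def by blast
  have "computable 3 (\<lambda>xs. Suc (prod_encode (xs ! 0, prod_encode (xs ! 1, xs ! 2))))"
    by (intro computable_intros) auto
  then obtain e' where e': "\<And>xs. length xs = 3 \<Longrightarrow> eval e' xs (Suc (prod_encode (xs ! 0, prod_encode (xs ! 1, xs ! 2))))"
    unfolding computable_def by blast
  \<comment> \<open>Decides emptiness for the automaton that contains the given fixed part and the
    chain belonging to its code.\<close>
  define g where "g = Comp f [e]"
  have g: "eval g [a, b, c] 1 \<longleftrightarrow> eval f [pta_code a b c] 1" for a b c
  proof
    assume "eval g [a, b, c] 1"
    then obtain ys where "length ys = 1" "eval e [a, b, c] (ys ! 0)" "eval f ys 1"
      unfolding g_def by (auto elim: eval_CompE)
    moreover have "eval e [a, b, c] (pta_code a b c)" using e[of "[a, b, c]"] by simp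
    ultimately have "ys = [pta_code a b c]" using eval_functional by (cases ys) auto
    with \<open>eval f ys 1\<close> show "eval f [pta_code a b c] 1" by simp
  next
    assume "eval f [pta_code a b c] 1"
    then show "eval g [a, b, c] 1"
      unfolding g_def using e[of "[a, b, c]"] by (intro eval_Comp[where ys = "[pta_code a b c]"]) auto
  qed
  have "eval e' [a, b, c] (Suc (prod_encode (a, prod_encode (b, c))))" for a b c
    using e'[of "[a, b, c]"] by simp
  from ex_program[of e' g, OF this] obtain P where
    P: "\<And>a b c. (\<exists>s'. sem P (init (Suc (prod_encode (a, prod_encode (b, c))))) s') \<longleftrightarrow> eval g [a, b, c] 1"
    by blast
  obtain es where es: "set es = edges P []" using finite_list[OF finite_edges] by blast
  define R where "R = Suc (Suc (Max (insert 0 (act_regs P))))"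
  have R: "machine es R"
  proof
    show "regs a \<subseteq> {..<R}" if "(c, a, c') \<in> set es" for c a c'
    proof
      fix x assume "x \<in> regs a"
      moreover have "regs a \<subseteq> insert 0 (act_regs P)" using that edges_regs unfolding es by blast
      ultimately have "x \<le> Max (insert 0 (act_regs P))"
        using finite_act_regs[of P] by (intro Max_ge) auto
      then show "x \<in> {..<R}" by (simp add: R_def)
    qed
  qed (simp add: R_def)
  \<comment> \<open>The value 0 is a placeholder: only the state set and \<open>base_ts\<close> are
    taken from this interpretation, and neither depends on \<open>m\<close>.\<close>
  interpret m0: machine es "[P]" "[]" 0 R by (rule R)
  define rest where "rest = (SOME xs. set xs = m0.all_states - {EvL, EvW, Fresh, Dead, Launch, Ctl [P]} \<and> distinct xs)"
  have rest: "set rest = m0.all_states - {EvL, EvW, Fresh, Dead, Launch, Ctl [P]} \<and> distinct rest"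
    unfolding rest_def by (rule someI_ex) (use finite_distinct_list[OF finite_Diff[OF m0.finite_states]] in blast)
  define base where "base = [EvL, EvW, Fresh, Dead, Launch] @ rest @ [Ctl [P]]"
  have "{EvL, EvW, Fresh, Dead, Launch, Ctl [P]} \<subseteq> m0.all_states"
    by (simp add: m0.all_states_def m0.states_def)
  then have base: "distinct base" "set base = m0.all_states"
    using rest by (auto simp: base_def)
  obtain N where N: "length base = Suc N" by (auto simp: base_def)
  define k0 where "k0 = length es + 2"
  define L where "L = list_encode (map enc4 (m0.base_ts base))"
  \<comment> \<open>Not circular, since \<open>N\<close>, \<open>k0\<close> and \<open>L\<close>
    were fixed without \<open>m\<close>.\<close>
  define m where "m = prod_encode (N, prod_encode (k0, L))"
  define A where "A = (Suc (N + Suc (m + m)), Suc k0, chain_ts k0 N (Suc (m + m)) (m0.base_ts base), 2 :: nat,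
      1 # 2 # replicate (N + (m + m)) (3 :: nat))"
  interpret machine es "[P]" "[]" m R by (rule R)
  note main = automaton_nonempty_iff[OF base_def base N, folded k0_def, folded A_def]
  have code: "pta_encode A = pta_code N k0 L"
    unfolding A_def L_def by (rule pta_code) (simp add: m_def L_def)
  have "valid \<longleftrightarrow> (\<exists>s. sem P (init (Suc m)) s)"
    unfolding valid_def es using sem_imp_path[of P _ _ "[]" "edges P []"] path_imp_sem[of P] by simp blast
  also have "\<dots> \<longleftrightarrow> eval f [pta_encode A] 1"
    unfolding code g[symmetric] P[symmetric] m_def ..
  finally have v: "valid \<longleftrightarrow> eval f [pta_encode A] 1" .
  show False
  proof (cases "L_univ_qual A = {}")
    case True
    with f[OF main(1)] v main(2) show False by simp
  next
    case False
    with f[OF main(1)] v main(2) have "eval f [pta_encode A] 0" "eval f [pta_encode A] 1" by simp_all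
    then show False using eval_functional by fastforce
  qed
qed

end
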